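(* Let $n\ge4$ be an integer and $b=\frac{n-1}{2}$. Let $\epsilon\in\left(0,\frac{n(n-3)}{2(n-1)}\right)$, $\delta\in(0,n)$, and let $\theta$ be defined by $\delta=(\delta+\epsilon)\theta$. Then there is a constant $C<\infty$ (independent of $f$) such that $$\|e^{itD}f\|_{L^2_tL^\infty_x(\mathbb{R}\times\mathbb{R}^n)}\le C\,\|f\|_{\dot H^{b-\epsilon}(\mathbb{R}^n)}^{\theta}\,\|f\|_{\dot H^{b+\delta}(\mathbb{R}^n)}^{1-\theta}$$ for all $f\in\dot H^{b-\epsilon}(\mathbb{R}^n)$ with $\|f\|_{\dot H^{b+\delta}(\mathbb{R}^n)}<\infty$.
   Context: The Fourier transform of $f$ on $\mathbb{R}^n$ is denoted $\hat f=\mathcal F(f)$, and $p(D)f=\mathcal F^{-1}(p(|\xi|)\hat f(\xi))$; thus $e^{itD}f=\mathcal F^{-1}(e^{it|\xi|}\hat f(\xi))$. $\dot H^s=D^{-s}L^2(\mathbb{R}^n)$ is the homogeneous Sobolev space (for $s<n/2$; for $s\ge n/2$ it is interpreted modulo polynomials), with $\|f\|_{\dot H^s}=\|D^sf\|_{L^2}$. The norm $\|F\|_{L^q_tL^r_x}$ is the $L^q$ norm in $t\in\mathbb{R}$ of the $L^r$ norm in $x\in\mathbb{R}^n$. *)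

theory Defs
  imports "HOL-Probability.Essential_Supremum"
begin

text \<open>
  Schwartz functions. Smoothness asks every iterated partial derivative (indexed by the list of
  coordinate directions) to be Frechet differentiable everywhere; so all of them are continuous,
  and this is the usual \<open>C\<^sup>\<infinity>\<close>.
\<close>

definition partial_deriv :: "'n \<Rightarrow> (real ^ 'n::finite \<Rightarrow> complex) \<Rightarrow> real ^ 'n \<Rightarrow> complex" where
  "partial_deriv i \<phi> = (\<lambda>x. frechet_derivative \<phi> (at x) (axis i 1))"

definition iter_partial :: "'n list \<Rightarrow> (real ^ 'n::finite \<Rightarrow> complex) \<Rightarrow> real ^ 'n \<Rightarrow> complex" where
  "iter_partial is \<phi> = foldr partial_deriv is \<phi>"

definition smooth :: "(real ^ 'n::finite \<Rightarrow> complex) \<Rightarrow> bool" where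
  "smooth \<phi> \<longleftrightarrow> (\<forall>is x. iter_partial is \<phi> differentiable (at x))"

definition schwartz :: "(real ^ 'n::finite \<Rightarrow> complex) \<Rightarrow> bool" where
  "schwartz \<phi> \<longleftrightarrow> smooth \<phi> \<and>
     (\<forall>is k. bounded (range (\<lambda>x. (1 + norm x) ^ k *\<^sub>R iter_partial is \<phi> x)))"

definition schwartz_norm :: "nat \<Rightarrow> (real ^ 'n::finite \<Rightarrow> complex) \<Rightarrow> real" where
  "schwartz_norm N \<phi> =
     (SUP (is, x) \<in> {is. length is \<le> N} \<times> UNIV. (1 + norm x) ^ N * norm (iter_partial is \<phi> x))"

text \<open>
  A tempered distribution is a functional whose values on Schwartz functions matter; its values
  on other functions are irrelevant and are never used below.
\<close>

type_synonym 'n distr = "(real ^ 'n \<Rightarrow> complex) \<Rightarrow> complex"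

definition tempered :: "'n::finite distr \<Rightarrow> bool" where
  "tempered u \<longleftrightarrow>
     (\<forall>\<phi> \<psi> a b. schwartz \<phi> \<longrightarrow> schwartz \<psi> \<longrightarrow> u (\<lambda>x. a * \<phi> x + b * \<psi> x) = a * u \<phi> + b * u \<psi>) \<and>
     (\<exists>C N. \<forall>\<phi>. schwartz \<phi> \<longrightarrow> norm (u \<phi>) \<le> C * schwartz_norm N \<phi>)"

definition tempered_fun :: "(real ^ 'n::finite \<Rightarrow> complex) \<Rightarrow> bool" where
  "tempered_fun g \<longleftrightarrow> g \<in> borel_measurable lborel \<and>
     (\<forall>\<phi>. schwartz \<phi> \<longrightarrow> integrable lborel (\<lambda>x. g x * \<phi> x))"

definition distr_of_fun :: "(real ^ 'n::finite \<Rightarrow> complex) \<Rightarrow> 'n distr" where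
  "distr_of_fun g = (\<lambda>\<phi>. LINT x|lborel. g x * \<phi> x)"

definition distr_eq :: "'n::finite distr \<Rightarrow> 'n distr \<Rightarrow> bool" where
  "distr_eq u v \<longleftrightarrow> (\<forall>\<phi>. schwartz \<phi> \<longrightarrow> u \<phi> = v \<phi>)"

definition is_fun :: "'n::finite distr \<Rightarrow> (real ^ 'n \<Rightarrow> complex) \<Rightarrow> bool" where
  "is_fun u g \<longleftrightarrow> tempered_fun g \<and> distr_eq u (distr_of_fun g)"

definition fourier :: "(real ^ 'n::finite \<Rightarrow> complex) \<Rightarrow> real ^ 'n \<Rightarrow> complex" where
  "fourier \<phi> \<xi> = (LINT x|lborel. cis (- (x \<bullet> \<xi>)) * \<phi> x)"

definition inv_fourier :: "(real ^ 'n::finite \<Rightarrow> complex) \<Rightarrow> real ^ 'n \<Rightarrow> complex" where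
  "inv_fourier \<phi> x =
     complex_of_real (1 / (2 * pi) ^ CARD('n)) * (LINT \<xi>|lborel. cis (x \<bullet> \<xi>) * \<phi> \<xi>)"

definition fourier_distr :: "'n::finite distr \<Rightarrow> 'n distr" where
  "fourier_distr u = (\<lambda>\<phi>. u (fourier \<phi>))"

definition inv_fourier_distr :: "'n::finite distr \<Rightarrow> 'n distr" where
  "inv_fourier_distr u = (\<lambda>\<phi>. u (inv_fourier \<phi>))"

text \<open>
  The function representing \<open>\<F> u\<close>, when \<open>\<F> u\<close> is a function; it is then determined up to a
  null set, and the choice of a version has no influence below.
\<close>

definition fourier_fun :: "'n::finite distr \<Rightarrow> real ^ 'n \<Rightarrow> complex" where
  "fourier_fun u = (SOME g. is_fun (fourier_distr u) g)"

text \<open>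
  \<open>multiplier p u\<close> is \<open>p(D) u = \<F>\<^sup>-\<^sup>1 (p(|\<xi>|) \<F>u(\<xi>))\<close>. It is only meaningful under
  \<open>multiplier_dom p u\<close>: \<open>\<F> u\<close> is a function, and so is \<open>p(|\<xi>|) \<F>u(\<xi>)\<close> as a tempered distribution.
\<close>

definition multiplier :: "(real \<Rightarrow> complex) \<Rightarrow> 'n::finite distr \<Rightarrow> 'n distr" where
  "multiplier p u = inv_fourier_distr (distr_of_fun (\<lambda>\<xi>. p (norm \<xi>) * fourier_fun u \<xi>))"

definition multiplier_dom :: "(real \<Rightarrow> complex) \<Rightarrow> 'n::finite distr \<Rightarrow> bool" where
  "multiplier_dom p u \<longleftrightarrow> tempered u \<and> (\<exists>g. is_fun (fourier_distr u) g) \<and>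
     tempered_fun (\<lambda>\<xi>. p (norm \<xi>) * fourier_fun u \<xi>)"

definition Dpow :: "real \<Rightarrow> real \<Rightarrow> complex" where
  "Dpow s r = complex_of_real (r powr s)"

text \<open>\<open>e\<^sup>i\<^sup>t\<^sup>D\<close>; the multiplier has modulus one, so it is defined whenever \<open>\<F> u\<close> is a function.\<close>

definition half_wave :: "real \<Rightarrow> 'n::finite distr \<Rightarrow> 'n distr" where
  "half_wave t u = multiplier (\<lambda>r. cis (t * r)) u"

text \<open>Powers of extended nonnegative reals, for exponents \<open>a > 0\<close> only.\<close>

definition ennreal_powr :: "ennreal \<Rightarrow> real \<Rightarrow> ennreal" where
  "ennreal_powr x a = (if x = \<infinity> then \<infinity> else ennreal (enn2real x powr a))"

definition Lp_norm :: "ennreal \<Rightarrow> 'a measure \<Rightarrow> ('a \<Rightarrow> ennreal) \<Rightarrow> ennreal" where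
  "Lp_norm p M h =
     (if p = \<infinity> then esssup M h
      else ennreal_powr (\<integral>\<^sup>+ x. ennreal_powr (h x) (enn2real p) \<partial>M) (1 / enn2real p))"

text \<open>
  The \<open>L\<^sup>p\<close> norm of a distribution is the norm of the function representing it (all
  representatives agree almost everywhere), and \<open>\<infinity>\<close> if it is not a function.
\<close>

definition distr_Lp_norm :: "ennreal \<Rightarrow> 'n::finite distr \<Rightarrow> ennreal" where
  "distr_Lp_norm p u = (INF h \<in> {h. is_fun u h}. Lp_norm p lborel (\<lambda>x. ennreal (norm (h x))))"

text \<open>
  The norm \<open>L\<^sup>q\<^sub>t L\<^sup>r\<^sub>x\<close> of a time-dependent distribution. For the half-wave flow the inner norm is
  lower semicontinuous in \<open>t\<close>, so the outer norm is taken of a Borel function.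
\<close>

definition mixed_norm :: "ennreal \<Rightarrow> ennreal \<Rightarrow> (real \<Rightarrow> 'n::finite distr) \<Rightarrow> ennreal" where
  "mixed_norm q r U = Lp_norm q lborel (\<lambda>t. distr_Lp_norm r (U t))"

text \<open>
  The space \<open>D\<^sup>-\<^sup>s L\<^sup>2\<close>, as a space of tempered distributions for \<open>s < n/2\<close> (for larger \<open>s\<close> one
  would have to pass to the quotient by polynomials).
\<close>

definition hom_sobolev :: "real \<Rightarrow> 'n::finite distr set" where
  "hom_sobolev s = {f. tempered f \<and>
     (\<exists>g. g \<in> borel_measurable lborel \<and> Lp_norm 2 lborel (\<lambda>x. ennreal (norm (g x))) < \<infinity> \<and>
          multiplier_dom (Dpow (- s)) (distr_of_fun g) \<and>
          distr_eq f (multiplier (Dpow (- s)) (distr_of_fun g)))}"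

text \<open>
  The norm of \<open>D\<^sup>s f\<close> in \<open>L\<^sup>2\<close>, infinite if \<open>D\<^sup>s f\<close> is undefined. No restriction on \<open>s\<close> is needed:
  the polynomial ambiguity does not arise once \<open>\<F> f\<close> is a function.
\<close>

definition hom_sobolev_norm :: "real \<Rightarrow> 'n::finite distr \<Rightarrow> ennreal" where
  "hom_sobolev_norm s f =
     (if multiplier_dom (Dpow s) f then distr_Lp_norm 2 (multiplier (Dpow s) f) else \<infinity>)"

end

theory Submission
  imports Defs "HOL-Probability.Probability" "HOL-Complex_Analysis.Complex_Analysis"
begin

text \<open>
  Let \<open>G\<close> be the Fourier transform of \<open>f\<close>, so that the flow is
  \<open>u(t,x) = 1 / (2 pi) ^ n * \<integral> cis (x \<bullet> \<xi> + t |\<xi>|) G(\<xi>) d\<xi>\<close>. For \<open>G\<close> supported in a shell \<open>|\<xi>| ~ r\<close> the endpoint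
  Strichartz estimate \<open>\<parallel>u\<parallel> \<le> C r\<^sup>b \<parallel>G\<parallel>\<close> holds, with the norm of \<open>L\<^sup>2\<^sub>t L\<^sup>\<infinity>\<^sub>x\<close> on the left and that of \<open>L\<^sup>2\<close> on the right.
  The statement is obtained by summing this over dyadic shells: those with
  \<open>r \<le> R\<close> are controlled by the norm of order \<open>b - \<epsilon>\<close> with a geometrically decaying factor, the others by
  the norm of order \<open>b + \<delta>\<close>, and the two contributions are balanced by the choice of \<open>R\<close>.

  The Strichartz estimate on a shell rests on an explicit kernel instead of stationary phase. Up to a bounded
  factor the frequency cutoff may be taken to be \<open>exp (- |\<xi>| / r)\<close>, and then the convolution kernel of the
  composition of the flow with its adjoint is the Poisson kernel, continued analytically to
  the complex height \<open>1 / r - i t\<close> (\<open>poisson_kernel\<close>). Its closed form shows that it is bounded,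
  uniformly in \<open>x\<close>, by a multiple of \<open>|t|\<close> to the power \<open>- (n - 1) / 2\<close> for large \<open>t\<close>
  (\<open>poisson_kernel_dispersive_bound\<close>). For \<open>n \<ge> 4\<close> this is integrable in \<open>t\<close>, so Schur's test and duality
  (\<open>adjoint_estimate_TT_star\<close>) give the estimate along any measurable curve \<open>x = X(t)\<close>, and hence for the
  supremum over \<open>x\<close> (\<open>strichartz_maximal_function\<close>, \<open>dyadic_strichartz\<close>).

  It remains to connect this with distributions. The Sobolev norm of \<open>f\<close> is the \<open>L\<^sup>2\<close> norm of a function
  \<open>h\<close> that represents \<open>D\<^sup>s f\<close>; that it dominates the weighted \<open>L\<^sup>2\<close> norm of \<open>G\<close> is the content
  of \<open>plancherel_dual\<close>, which is proved by testing with Gaussian mollifications, for which all transforms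
  are explicit. Conversely, the sum of the flows of the dyadic pieces converges uniformly in \<open>x\<close> at
  every time where the sum of their suprema is finite, and represents the flow of \<open>f\<close> there
  (\<open>half_wave_sup_bound\<close>).
\<close>

section \<open>Gaussians and the Poisson kernel\<close>

lemma cis_measurable [measurable]: "cis \<in> borel_measurable borel"
  by (intro borel_measurable_continuous_onI continuous_intros)

text \<open>
  A rescaling of the characteristic function of the standard normal distribution.
\<close>

lemma gaussian_fourier_real:
  fixes s x :: real
  assumes "s > 0"
  shows "integrable lborel (\<lambda>y. cis (x * y) * complex_of_real (exp (- s * y\<^sup>2)))"
    and "(LINT y|lborel. cis (x * y) * complex_of_real (exp (- s * y\<^sup>2)))
           = complex_of_real (sqrt (pi / s) * exp (- x\<^sup>2 / (4 * s)))"
proof -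
  \<comment> \<open>Scaling by \<open>c\<close> turns \<open>exp (- s * y\<^sup>2)\<close> into \<open>exp (- y\<^sup>2 / 2)\<close>.\<close>
  define c where "c = 1 / sqrt (2 * s)"
  have c: "c > 0" "c\<^sup>2 = 1 / (2 * s)"
    using assms by (auto simp: c_def power_divide)
  define f where "f = (\<lambda>y. cis (x * y) * complex_of_real (exp (- s * y\<^sup>2)))"
  have f_scaled: "f (0 + c * y) = complex_of_real (sqrt (2 * pi)) *
      (complex_of_real (std_normal_density y) * cis ((x * c) * y))" for y
  proof -
    have "s * (c * y)\<^sup>2 = y\<^sup>2 / 2"
      using assms by (simp add: power_mult_distrib c(2))
    then show ?thesis
      by (simp add: f_def std_normal_density_def mult_ac)
  qed
  have "complex_of_real (exp (- ((x * c)\<^sup>2) / 2)) = char std_normal_distribution (x * c)"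
    by (simp add: char_std_normal_distribution)
  also have "\<dots> = (LINT y|density lborel (\<lambda>x. ennreal (std_normal_density x)). cis ((x * c) * y))"
    by (simp add: char_def cis_conv_exp)
  also have "\<dots> = (LINT y|lborel. std_normal_density y *\<^sub>R cis ((x * c) * y))"
    by (rule integral_density) auto
  finally have char: "(LINT y|lborel. complex_of_real (std_normal_density y) * cis ((x * c) * y))
      = complex_of_real (exp (- ((x * c)\<^sup>2) / 2))"
    by (simp add: scaleR_conv_of_real)
  have "integrable lborel (\<lambda>y. complex_of_real (std_normal_density y) * cis ((x * c) * y))"
    by (rule Bochner_Integration.integrable_bound[where f = std_normal_density])
      (auto simp: norm_mult)
  then have "integrable lborel (\<lambda>y. f (0 + c * y))"
    unfolding f_scaled by simp
  then show "integrable lborel f"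
    using c lborel_integrable_real_affine_iff[of c f 0] by simp
  have "integral\<^sup>L lborel f = \<bar>c\<bar> *\<^sub>R (LINT y|lborel. f (0 + c * y))"
    using c by (intro lborel_integral_real_affine) auto
  also have "\<dots> = complex_of_real (c * sqrt (2 * pi) * exp (- ((x * c)\<^sup>2) / 2))"
    unfolding f_scaled using c by (simp add: char scaleR_conv_of_real)
  also have "c * sqrt (2 * pi) = sqrt (pi / s)"
    by (simp add: c_def real_sqrt_divide real_sqrt_mult)
  also have "- ((x * c)\<^sup>2) / 2 = - x\<^sup>2 / (4 * s)"
    by (simp add: power_mult_distrib c)
  finally show "integral\<^sup>L lborel f = complex_of_real (sqrt (pi / s) * exp (- x\<^sup>2 / (4 * s)))" .
qed

lemma lborel_integral_prod_Basis:
  fixes f :: "'a::euclidean_space \<Rightarrow> real \<Rightarrow> complex"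
  assumes int: "\<And>b. b \<in> Basis \<Longrightarrow> integrable lborel (f b)"
  shows "integrable lborel (\<lambda>x::'a. \<Prod>b\<in>Basis. f b (x \<bullet> b))"
    and "(LINT x|lborel. (\<Prod>b\<in>Basis. f b (x \<bullet> b))) = (\<Prod>b\<in>Basis. LINT y|lborel. f b y)"
proof -
  interpret product_sigma_finite "\<lambda>b::'a. lborel :: real measure"
    by standard
  define T where "T = (\<lambda>g. \<Sum>b\<in>Basis. g b *\<^sub>R b :: 'a)"
  have T_meas [measurable]: "T \<in> (\<Pi>\<^sub>M b\<in>Basis. lborel) \<rightarrow>\<^sub>M borel"
    unfolding T_def by measurable
  have [measurable]: "(\<lambda>x::'a. \<Prod>b\<in>Basis. f b (x \<bullet> b)) \<in> borel_measurable borel"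
    using int[THEN borel_measurable_integrable] by (intro borel_measurable_prod) auto
  have T_coord: "(\<Prod>b\<in>Basis. f b (T g \<bullet> b)) = (\<Prod>b\<in>Basis. f b (g b))" for g
    by (intro prod.cong refl)
      (simp add: T_def inner_sum_left inner_Basis if_distrib sum.delta cong: if_cong)
  have lb: "(lborel :: 'a measure) = distr (\<Pi>\<^sub>M b\<in>Basis. lborel) borel T"
    unfolding T_def by (rule lborel_eq)
  show "integrable lborel (\<lambda>x::'a. \<Prod>b\<in>Basis. f b (x \<bullet> b))"
    unfolding lb by (subst integrable_distr_eq) (auto simp: T_coord intro!: product_integrable_prod int)
  show "(LINT x|lborel. (\<Prod>b\<in>Basis. f b (x \<bullet> b))) = (\<Prod>b\<in>Basis. LINT y|lborel. f b y)"
    unfolding lb by (subst integral_distr) (auto simp: T_coord product_integral_prod int)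
qed

lemma gaussian_fourier:
  fixes x :: "'a::euclidean_space"
  assumes "s > 0"
  shows "integrable lborel (\<lambda>y::'a. cis (x \<bullet> y) * complex_of_real (exp (- s * (norm y)\<^sup>2)))"
    and "(LINT y|lborel. cis (x \<bullet> y) * complex_of_real (exp (- s * (norm y)\<^sup>2)))
           = complex_of_real (sqrt (pi / s) ^ DIM('a) * exp (- (norm x)\<^sup>2 / (4 * s)))"
proof -
  define f where "f = (\<lambda>b y. cis ((x \<bullet> b) * y) * complex_of_real (exp (- s * y\<^sup>2)))"
  have prod_cis: "(\<Prod>b\<in>I. cis (h b)) = cis (\<Sum>b\<in>I. h b)" if "finite I" for h :: "'a \<Rightarrow> real" and I
    using that by (induction rule: finite_induct) (auto simp: cis_mult)
  have norm_sum: "(\<Sum>b\<in>Basis. (z \<bullet> b)\<^sup>2) = (norm z)\<^sup>2" for z :: 'a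
    by (subst power2_norm_eq_inner, subst euclidean_inner) (simp add: power2_eq_square)
  have factor: "cis (x \<bullet> y) * complex_of_real (exp (- s * (norm y)\<^sup>2)) = (\<Prod>b\<in>Basis. f b (y \<bullet> b))" for y
  proof -
    have "(\<Prod>b\<in>Basis. f b (y \<bullet> b)) = cis (\<Sum>b\<in>Basis. (x \<bullet> b) * (y \<bullet> b)) *
        complex_of_real (exp (\<Sum>b\<in>Basis. - s * (y \<bullet> b)\<^sup>2))"
      by (simp add: f_def prod.distrib prod_cis exp_sum)
    also have "(\<Sum>b\<in>Basis. - s * (y \<bullet> b)\<^sup>2) = - s * (norm y)\<^sup>2"
      by (simp only: sum_distrib_left[symmetric] norm_sum)
    finally show ?thesis
      by (simp add: euclidean_inner[symmetric])
  qed
  have fi: "integrable lborel (f b)" for b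
    using gaussian_fourier_real(1)[OF assms, of "x \<bullet> b"] by (simp add: f_def)
  show "integrable lborel (\<lambda>y::'a. cis (x \<bullet> y) * complex_of_real (exp (- s * (norm y)\<^sup>2)))"
    unfolding factor by (intro lborel_integral_prod_Basis fi)
  have "(LINT y|lborel. cis (x \<bullet> y) * complex_of_real (exp (- s * (norm y)\<^sup>2)))
      = (\<Prod>b\<in>Basis. LINT y|lborel. f b y)"
    unfolding factor by (intro lborel_integral_prod_Basis fi)
  also have "\<dots> = (\<Prod>b\<in>(Basis::'a set). complex_of_real (sqrt (pi / s) * exp (- (x \<bullet> b)\<^sup>2 / (4 * s))))"
    using gaussian_fourier_real(2)[OF assms] by (simp add: f_def)
  also have "\<dots> = complex_of_real (sqrt (pi / s) ^ DIM('a) * exp (\<Sum>b\<in>Basis. - (x \<bullet> b)\<^sup>2 / (4 * s)))"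
    by (simp add: prod.distrib exp_sum)
  also have "(\<Sum>b\<in>Basis. - (x \<bullet> b)\<^sup>2 / (4 * s)) = - (norm x)\<^sup>2 / (4 * s)"
    by (simp only: sum_divide_distrib[symmetric] sum_negf norm_sum)
  finally show "(LINT y|lborel. cis (x \<bullet> y) * complex_of_real (exp (- s * (norm y)\<^sup>2)))
      = complex_of_real (sqrt (pi / s) ^ DIM('a) * exp (- (norm x)\<^sup>2 / (4 * s)))" .
qed

text \<open>
  The map \<open>u \<mapsto> u - a / (2 u)\<close> takes the half line bijectively onto the real line and turns the
  Gaussian weight \<open>exp (- v\<^sup>2)\<close> into the integrand, up to the factor \<open>exp a\<close> and the Jacobian
  \<open>1 + a / (2 u\<^sup>2)\<close>. The involution \<open>u \<mapsto> a / (2 u)\<close> exchanges the two summands of the Jacobian,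
  so that each of them contributes half of \<open>sqrt pi\<close>.
\<close>

lemma glasser_integral:
  fixes a :: real
  assumes "a > 0"
  shows "set_integrable lborel {0<..} (\<lambda>u. exp (- u\<^sup>2 - a\<^sup>2 / (4 * u\<^sup>2)))"
    and "(LINT u:{0<..}|lborel. exp (- u\<^sup>2 - a\<^sup>2 / (4 * u\<^sup>2))) = sqrt pi / 2 * exp (- a)"
proof -
  define F where "F = (\<lambda>v::real. exp (- v\<^sup>2))"
  define g where "g = (\<lambda>u::real. u - a / (2 * u))"
  define h where "h = (\<lambda>u::real. a / (2 * u))"
  have F_int: "integrable lborel F" "integral\<^sup>L lborel F = sqrt pi"
  proof -
    have "integrable lborel (\<lambda>v. complex_of_real (F v))"
      "(LINT v|lborel. complex_of_real (F v)) = complex_of_real (sqrt pi)"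
      using gaussian_fourier_real[of 1 0] by (simp_all add: F_def)
    then show "integrable lborel F" "integral\<^sup>L lborel F = sqrt pi"
      by (simp_all only: complex_of_real_integrable_eq integral_complex_of_real of_real_eq_iff)
  qed
  have F_abs: "F absolutely_integrable_on UNIV" "integral UNIV F = sqrt pi"
  proof -
    have "integrable lebesgue F"
      using F_int(1) by (simp add: integrable_completion F_def)
    then show 1: "F absolutely_integrable_on UNIV"
      by (simp add: set_integrable_def)
    have "integral UNIV F = (LINT x:UNIV|lebesgue. F x)"
      using 1 by (simp add: set_lebesgue_integral_eq_integral)
    also have "\<dots> = sqrt pi"
      unfolding set_lebesgue_integral_def using F_int(2) by (simp add: integral_completion F_def)
    finally show "integral UNIV F = sqrt pi" .
  qed
  have g_less: "g u < g v" if "0 < u" "u < v" for u v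
    using that assms unfolding g_def by (intro diff_strict_mono divide_strict_left_mono) auto
  have g_inj: "inj_on g {0<..}"
  proof (rule inj_onI)
    fix u v assume "u \<in> {0<..}" "v \<in> {0<..}" "g u = g v"
    then show "u = v"
      using g_less[of u v] g_less[of v u] by (cases u v rule: linorder_cases) auto
  qed
  have g_image: "g ` {0<..} = UNIV"
  proof -
    have "\<exists>u>0. g u = v" for v
    proof -
      define w where "w = sqrt (v\<^sup>2 + 2 * a)"
      \<comment> \<open>The positive root of \<open>u\<^sup>2 - v * u - a / 2 = 0\<close>.\<close>
      define u where "u = (v + w) / 2"
      have "\<bar>v\<bar> < w"
        using assms unfolding w_def by (intro real_less_rsqrt) auto
      then have "u > 0"
        by (simp add: u_def)
      have "w * w = v * v + 2 * a"
        using assms by (simp add: w_def power2_eq_square)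
      then have "u * u = v * u + a / 2"
        by (simp add: u_def algebra_simps add_divide_distrib)
      then have "u = v + a / (2 * u)"
        using \<open>u > 0\<close> by (metis (no_types, lifting) add_divide_distrib divide_divide_eq_left less_irrefl nonzero_mult_div_cancel_right)
      then have "g u = v"
        by (simp add: g_def)
      with \<open>u > 0\<close> show ?thesis
        by blast
    qed
    then show ?thesis
      by (metis UNIV_eq_I greaterThan_iff image_eqI)
  qed
  have h_inj: "inj_on h {0<..}"
    using assms by (auto simp: inj_on_def h_def)
  have h_image: "h ` {0<..} = {0<..}"
  proof -
    have "v \<in> h ` {0<..}" if "v > 0" for v
      using that assms by (intro image_eqI[of _ _ "a / (2 * v)"]) (auto simp: h_def)
    moreover have "h u > 0" if "u > 0" for u
      using that assms by (simp add: h_def)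
    ultimately show ?thesis
      by auto
  qed
  have Fgh: "F (g (h u)) = F (g u)" if "u > 0" for u
    using that assms by (simp add: F_def g_def h_def power2_commute)
  have der_g: "(g has_field_derivative 1 + a / (2 * u\<^sup>2)) (at u within {0<..})" if "u \<in> {0<..}" for u
    using that unfolding g_def
    by (auto intro!: derivative_eq_intros simp: field_simps power2_eq_square)
  have der_h: "(h has_field_derivative - a / (2 * u\<^sup>2)) (at u within {0<..})" if "u \<in> {0<..}" for u
    using that unfolding h_def
    by (auto intro!: derivative_eq_intros simp: field_simps power2_eq_square)
  have A: "(\<lambda>u. \<bar>1 + a / (2 * u\<^sup>2)\<bar> * F (g u)) absolutely_integrable_on {0<..}"
      "integral {0<..} (\<lambda>u. \<bar>1 + a / (2 * u\<^sup>2)\<bar> * F (g u)) = sqrt pi"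
    using has_absolute_integral_change_of_variables_1'[OF _ der_g g_inj, of F "sqrt pi"]
      F_abs g_image by auto
  have B: "(\<lambda>u. F (g u)) absolutely_integrable_on {0<..}"
  proof (rule set_integrable_bound[OF A(1)])
    show "set_borel_measurable lebesgue {0<..} (\<lambda>u. F (g u))"
      unfolding set_borel_measurable_def F_def g_def
      by (intro measurable_completion) (measurable)
    show "AE u in lebesgue. u \<in> {0<..} \<longrightarrow>
        norm (F (g u)) \<le> norm (\<bar>1 + a / (2 * u\<^sup>2)\<bar> * F (g u))"
      using assms by (auto simp: F_def abs_mult mult_le_cancel_right1)
  qed
  \<comment> \<open>The integrand is invariant under \<open>h\<close>, so the second part of the Jacobian integrates to the same as the first.\<close>
  have C: "(\<lambda>u. \<bar>- a / (2 * u\<^sup>2)\<bar> * F (g (h u))) absolutely_integrable_on {0<..}"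
      "integral {0<..} (\<lambda>u. \<bar>- a / (2 * u\<^sup>2)\<bar> * F (g (h u))) = integral {0<..} (\<lambda>u. F (g u))"
    using has_absolute_integral_change_of_variables_1'[OF _ der_h h_inj,
        of "\<lambda>u. F (g u)" "integral {0<..} (\<lambda>u. F (g u))"] B h_image by auto
  have "sqrt pi = integral {0<..} (\<lambda>u. F (g u) + \<bar>- a / (2 * u\<^sup>2)\<bar> * F (g (h u)))"
    unfolding A(2)[symmetric]
    by (intro Henstock_Kurzweil_Integration.integral_cong) (use assms in \<open>auto simp: Fgh distrib_right\<close>)
  also have "\<dots> = 2 * integral {0<..} (\<lambda>u. F (g u))"
    using B C set_lebesgue_integral_eq_integral(1)
    by (subst Henstock_Kurzweil_Integration.integral_add) (auto simp: absolutely_integrable_on_def)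
  finally have FG: "integral {0<..} (\<lambda>u. F (g u)) = sqrt pi / 2"
    by simp
  have exp_eq: "exp (- u\<^sup>2 - a\<^sup>2 / (4 * u\<^sup>2)) = exp (- a) * F (g u)" if "u > 0" for u
  proof -
    have "(u - a / (2 * u))\<^sup>2 = u\<^sup>2 + a\<^sup>2 / (4 * u\<^sup>2) - a"
      using that by (simp add: power2_eq_square field_simps)
    then show ?thesis
      by (simp add: F_def g_def exp_add[symmetric])
  qed
  have ind_eq: "indicator {0<..} u *\<^sub>R exp (- u\<^sup>2 - a\<^sup>2 / (4 * u\<^sup>2))
      = exp (- a) * (indicator {0<..} u *\<^sub>R F (g u))" for u
    by (cases "u > 0") (simp_all only: exp_eq, auto)
  have Fg_meas: "(\<lambda>u. indicator {0<..} u *\<^sub>R F (g u)) \<in> borel_measurable lborel"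
    unfolding F_def g_def by measurable
  have "integrable lborel (\<lambda>u. indicator {0<..} u *\<^sub>R F (g u))"
    using B unfolding set_integrable_def integrable_completion[OF Fg_meas] .
  then show "set_integrable lborel {0<..} (\<lambda>u. exp (- u\<^sup>2 - a\<^sup>2 / (4 * u\<^sup>2)))"
    unfolding set_integrable_def ind_eq by simp
  have "(LINT u|lborel. indicator {0<..} u *\<^sub>R F (g u)) = (LINT u:{0<..}|lebesgue. F (g u))"
    unfolding set_lebesgue_integral_def integral_completion[OF Fg_meas] ..
  also have "\<dots> = sqrt pi / 2"
    using B FG by (simp add: set_lebesgue_integral_eq_integral)
  finally show "(LINT u:{0<..}|lborel. exp (- u\<^sup>2 - a\<^sup>2 / (4 * u\<^sup>2))) = sqrt pi / 2 * exp (- a)"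
    unfolding set_lebesgue_integral_def ind_eq by simp
qed

text \<open>
  All uses of Fubini's theorem below concern a product of integrable functions of separate
  variables times an oscillating factor of modulus at most one.
\<close>

lemma (in pair_sigma_finite) integrable_tensor_kernel:
  fixes f :: "'a \<Rightarrow> complex" and g :: "'b \<Rightarrow> complex"
  assumes f: "integrable M1 f" and g: "integrable M2 g"
    and E [measurable]: "case_prod E \<in> borel_measurable (M1 \<Otimes>\<^sub>M M2)" and E_le: "\<And>x y. norm (E x y) \<le> 1"
  shows "integrable (M1 \<Otimes>\<^sub>M M2) (\<lambda>(x, y). f x * g y * E x y)"
proof -
  have [measurable]: "f \<in> borel_measurable M1" "g \<in> borel_measurable M2"
    using f g by auto
  have "integrable (M1 \<Otimes>\<^sub>M M2) (\<lambda>(x, y). f x * g y)"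
  proof (rule Fubini_integrable)
    have "(\<lambda>x. LINT y|M2. norm (case (x, y) of (x, y) \<Rightarrow> f x * g y)) = (\<lambda>x. norm (f x) * (LINT y|M2. norm (g y)))"
      by (simp add: norm_mult)
    then show "integrable M1 (\<lambda>x. LINT y|M2. norm (case (x, y) of (x, y) \<Rightarrow> f x * g y))"
      using f by simp
  qed (measurable, use g in simp)
  then show ?thesis
  proof (rule Bochner_Integration.integrable_bound)
    show "AE p in M1 \<Otimes>\<^sub>M M2. norm (case p of (x, y) \<Rightarrow> f x * g y * E x y) \<le> norm (case p of (x, y) \<Rightarrow> f x * g y)"
      using E_le by (intro AE_I2) (auto simp: norm_mult split: prod.split intro!: mult_left_le)
  qed measurable
qed

lemma (in pair_sigma_finite) integrable_tensor:
  fixes f :: "'a \<Rightarrow> complex" and g :: "'b \<Rightarrow> complex"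
  assumes "integrable M1 f" "integrable M2 g"
  shows "integrable (M1 \<Otimes>\<^sub>M M2) (\<lambda>(x, y). f x * g y)"
  using integrable_tensor_kernel[OF assms, of "\<lambda>_ _. 1"] by simp

lemma integrable_power_gaussian:
  "integrable lborel (\<lambda>u::real. indicator {0<..} u * (u ^ n * exp (- u\<^sup>2)))"
proof -
  have "integrable lborel (\<lambda>u::real. indicator {0..} u *\<^sub>R (exp (- u\<^sup>2) * u ^ n))"
  proof (cases "even n")
    case True
    then show ?thesis
      using gaussian_moment_even_pos[of "n div 2"] by (auto simp: has_bochner_integral_iff)
  next
    case False
    then show ?thesis
      using gaussian_moment_odd_pos[of "n div 2"] by (auto simp: has_bochner_integral_iff)
  qed
  then show ?thesis
    by (rule Bochner_Integration.integrable_bound) (auto split: split_indicator simp: mult.commute)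
qed

text \<open>
  The constant in the Fourier transform of \<open>exp (- |y|)\<close>; its last factor is half a Gamma value,
  but only its sign is ever used.
\<close>

definition poisson_const :: "nat \<Rightarrow> real" where
  "poisson_const n = 2 / sqrt pi * (2 * sqrt pi) ^ n *
     (LINT u|lborel. indicator {0<..} u * (u ^ n * exp (- u\<^sup>2)))"

text \<open>
  Subordination: by Glasser's integral, \<open>exp (- \<kappa> |y|)\<close> is an average over \<open>u\<close> of the Gaussians
  \<open>exp (- (\<kappa> |y|)\<^sup>2 / (4 u\<^sup>2))\<close> with weight \<open>exp (- u\<^sup>2)\<close>. Their Fourier transforms are Gaussians
  again, and a rescaling of \<open>u\<close> evaluates the average of these.
\<close>

lemma poisson_kernel_real:
  fixes x :: "'a::euclidean_space"
  assumes "\<kappa> > 0"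
  shows integrable_exp_norm: "integrable lborel (\<lambda>y::'a. exp (- \<kappa> * norm y))"
    and "(LINT y|lborel. cis (x \<bullet> y) * complex_of_real (exp (- \<kappa> * norm y)))
         = complex_of_real (poisson_const DIM('a) * \<kappa> / sqrt (\<kappa>\<^sup>2 + (norm x)\<^sup>2) ^ (DIM('a) + 1))"
proof -
  let ?n = "DIM('a)"

  define \<Psi> where "\<Psi> = (\<lambda>(u::real) (y::'a). indicator {0<..} u * (2 / sqrt pi) *
      exp (- u\<^sup>2 - (\<kappa> * norm y)\<^sup>2 / (4 * u\<^sup>2)))"
  have \<Psi>_nonneg: "\<Psi> u y \<ge> 0" for u y
    by (simp add: \<Psi>_def)
  have \<Psi>_split: "\<Psi> u y = indicator {0<..} u * (2 / sqrt pi) * exp (- u\<^sup>2) *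
      exp (- (\<kappa>\<^sup>2 / (4 * u\<^sup>2)) * (norm y)\<^sup>2)" for u y
    by (simp add: \<Psi>_def exp_add[symmetric] power_mult_distrib)
  have gauss: "integrable lborel (\<lambda>y. cis (z \<bullet> y) * complex_of_real (\<Psi> u y))"
    "(LINT y|lborel. cis (z \<bullet> y) * complex_of_real (\<Psi> u y)) = complex_of_real
       (2 / sqrt pi * (2 * sqrt pi / \<kappa>) ^ ?n *
         (indicator {0<..} u * (u ^ ?n * exp (- (1 + (norm z)\<^sup>2 / \<kappa>\<^sup>2) * u\<^sup>2))))" for u and z :: 'a
  proof -
    have "integrable lborel (\<lambda>y. cis (z \<bullet> y) * complex_of_real (\<Psi> u y)) \<and>
      (LINT y|lborel. cis (z \<bullet> y) * complex_of_real (\<Psi> u y)) = complex_of_real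
       (2 / sqrt pi * (2 * sqrt pi / \<kappa>) ^ ?n *
         (indicator {0<..} u * (u ^ ?n * exp (- (1 + (norm z)\<^sup>2 / \<kappa>\<^sup>2) * u\<^sup>2))))"
    proof (cases "u > 0")
      case False
      then show ?thesis
        by (simp add: \<Psi>_def)
    next
      case True
      define s where "s = \<kappa>\<^sup>2 / (4 * u\<^sup>2)"
      have s: "s > 0"
        using True assms by (simp add: s_def)
      have \<Psi>_s: "cis (z \<bullet> y) * complex_of_real (\<Psi> u y) = complex_of_real (2 / sqrt pi * exp (- u\<^sup>2)) *
          (cis (z \<bullet> y) * complex_of_real (exp (- s * (norm y)\<^sup>2)))" for y
        using True unfolding \<Psi>_split s_def[symmetric] by (simp add: mult_ac)
      have sqrt_s: "sqrt (pi / s) = 2 * sqrt pi / \<kappa> * u"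
        using True assms by (simp add: s_def real_sqrt_divide real_sqrt_mult)
      have exps: "exp (- u\<^sup>2) * exp (- (norm z)\<^sup>2 / (4 * s)) = exp (- (1 + (norm z)\<^sup>2 / \<kappa>\<^sup>2) * u\<^sup>2)"
        using True assms by (simp add: s_def exp_add[symmetric] left_diff_distrib)
      have "2 / sqrt pi * exp (- u\<^sup>2) * (sqrt (pi / s) ^ ?n * exp (- (norm z)\<^sup>2 / (4 * s)))
          = 2 / sqrt pi * (2 * sqrt pi / \<kappa>) ^ ?n * (u ^ ?n * exp (- (1 + (norm z)\<^sup>2 / \<kappa>\<^sup>2) * u\<^sup>2))"
        unfolding exps[symmetric] sqrt_s power_mult_distrib by (simp only: mult_ac)
      then show ?thesis
        using True gaussian_fourier[OF s, of z] unfolding \<Psi>_s by (simp flip: of_real_mult)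
    qed
    then show "integrable lborel (\<lambda>y. cis (z \<bullet> y) * complex_of_real (\<Psi> u y))"
      "(LINT y|lborel. cis (z \<bullet> y) * complex_of_real (\<Psi> u y)) = complex_of_real
       (2 / sqrt pi * (2 * sqrt pi / \<kappa>) ^ ?n *
         (indicator {0<..} u * (u ^ ?n * exp (- (1 + (norm z)\<^sup>2 / \<kappa>\<^sup>2) * u\<^sup>2))))"
      by auto
  qed
  have [measurable]: "case_prod \<Psi> \<in> borel_measurable (lborel \<Otimes>\<^sub>M lborel)"
    unfolding \<Psi>_def by measurable
  have \<Psi>_int_y: "integrable lborel (\<Psi> u)" "integral\<^sup>L lborel (\<Psi> u)
      = 2 / sqrt pi * (2 * sqrt pi / \<kappa>) ^ ?n * (indicator {0<..} u * (u ^ ?n * exp (- u\<^sup>2)))" for u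
    using gauss[of 0 u]
    by (simp_all add: complex_of_real_integrable_eq del: of_real_mult of_real_divide of_real_power)
  have \<Psi>_int: "integrable (lborel \<Otimes>\<^sub>M lborel) (case_prod \<Psi>)"
  proof (rule lborel_pair.Fubini_integrable)
    show "integrable lborel (\<lambda>u. LINT y|lborel. norm (case_prod \<Psi> (u, y)))"
      using \<Psi>_nonneg \<Psi>_int_y(2) integrable_power_gaussian[of ?n] by simp
  qed (use \<Psi>_int_y(1) in auto)
  have cis_int: "integrable (lborel \<Otimes>\<^sub>M lborel) (\<lambda>(u, y). cis (x \<bullet> y) * complex_of_real (\<Psi> u y))"
    by (rule Bochner_Integration.integrable_bound[OF \<Psi>_int]) (auto simp: norm_mult split_beta')
  have \<Psi>_u: "(LINT u|lborel. \<Psi> u y) = exp (- \<kappa> * norm y)" if "y \<noteq> 0" for y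
  proof -
    have "(LINT u|lborel. \<Psi> u y) =
        2 / sqrt pi * (LINT u:{0<..}|lborel. exp (- u\<^sup>2 - (\<kappa> * norm y)\<^sup>2 / (4 * u\<^sup>2)))"
      unfolding set_lebesgue_integral_def integral_mult_right_zero[symmetric]
      by (intro Bochner_Integration.integral_cong) (auto simp: \<Psi>_def)
    also have "\<dots> = exp (- \<kappa> * norm y)"
      by (subst glasser_integral(2)) (use that assms in simp_all)
    finally show ?thesis .
  qed
  have nonzero: "AE y in lborel. y \<noteq> (0::'a)"
    by (rule AE_lborel_singleton)
  show "integrable lborel (\<lambda>y::'a. exp (- \<kappa> * norm y))"
  proof (rule integrable_cong_AE_imp[OF lborel_pair.integrable_snd[OF \<Psi>_int]])
    show "AE y in lborel. (LINT u|lborel. \<Psi> u y) = exp (- \<kappa> * norm y)"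
      using nonzero by eventually_elim (rule \<Psi>_u)
  qed measurable
  have "(LINT y|lborel. cis (x \<bullet> y) * complex_of_real (exp (- \<kappa> * norm y)))
      = (LINT y|lborel. LINT u|lborel. cis (x \<bullet> y) * complex_of_real (\<Psi> u y))"
  proof (rule integral_cong_AE)
    show "AE y in lborel. cis (x \<bullet> y) * complex_of_real (exp (- \<kappa> * norm y))
        = (LINT u|lborel. cis (x \<bullet> y) * complex_of_real (\<Psi> u y))"
      using nonzero by eventually_elim (simp add: \<Psi>_u)
    show "(\<lambda>y. LINT u|lborel. cis (x \<bullet> y) * complex_of_real (\<Psi> u y)) \<in> borel_measurable lborel"
      using lborel_pair.integrable_snd[OF cis_int] by (rule borel_measurable_integrable)
  qed measurable
  also have "\<dots> = (LINT u|lborel. LINT y|lborel. cis (x \<bullet> y) * complex_of_real (\<Psi> u y))"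
    by (rule lborel_pair.Fubini_integral[OF cis_int])
  also have "\<dots> = complex_of_real (2 / sqrt pi * (2 * sqrt pi / \<kappa>) ^ ?n *
      (LINT u|lborel. indicator {0<..} u * (u ^ ?n * exp (- (1 + (norm x)\<^sup>2 / \<kappa>\<^sup>2) * u\<^sup>2))))"
    unfolding gauss(2) integral_complex_of_real integral_mult_right_zero ..
  also have "(LINT u|lborel. indicator {0<..} u * (u ^ ?n * exp (- (1 + (norm x)\<^sup>2 / \<kappa>\<^sup>2) * u\<^sup>2)))
      = (\<kappa> / sqrt (\<kappa>\<^sup>2 + (norm x)\<^sup>2)) ^ (?n + 1) *
        (LINT u|lborel. indicator {0<..} u * (u ^ ?n * exp (- u\<^sup>2)))"
  proof -
    define k where "k = \<kappa> / sqrt (\<kappa>\<^sup>2 + (norm x)\<^sup>2)"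
    have pos: "\<kappa>\<^sup>2 + (norm x)\<^sup>2 > 0"
      using assms by (simp add: add_pos_nonneg)
    then have k: "k > 0"
      using assms by (simp add: k_def)
    have "1 + (norm x)\<^sup>2 / \<kappa>\<^sup>2 = (\<kappa>\<^sup>2 + (norm x)\<^sup>2) / \<kappa>\<^sup>2"
      using assms by (simp add: add_divide_distrib)
    then have "(1 + (norm x)\<^sup>2 / \<kappa>\<^sup>2) * k\<^sup>2 = 1"
      using pos assms by (simp add: k_def power_divide)
    then have kk: "(1 + (norm x)\<^sup>2 / \<kappa>\<^sup>2) * (k * u)\<^sup>2 = u\<^sup>2" for u
      by (simp add: power_mult_distrib)
    have "(LINT u|lborel. indicator {0<..} u * (u ^ ?n * exp (- (1 + (norm x)\<^sup>2 / \<kappa>\<^sup>2) * u\<^sup>2)))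
       = \<bar>k\<bar> *\<^sub>R (LINT u|lborel. indicator {0<..} (0 + k * u) * ((0 + k * u) ^ ?n *
            exp (- (1 + (norm x)\<^sup>2 / \<kappa>\<^sup>2) * (0 + k * u)\<^sup>2)))"
      using k by (intro lborel_integral_real_affine) auto
    also have "(\<lambda>u. indicator {0<..} (0 + k * u) * ((0 + k * u) ^ ?n *
            exp (- (1 + (norm x)\<^sup>2 / \<kappa>\<^sup>2) * (0 + k * u)\<^sup>2)))
       = (\<lambda>u. k ^ ?n * (indicator {0<..} u * (u ^ ?n * exp (- u\<^sup>2))))"
      unfolding add_0 mult_minus_left kk using k
      by (auto simp: power_mult_distrib zero_less_mult_iff split: split_indicator)
    finally show ?thesis
      using k assms by (simp add: k_def)
  qed
  also have "2 / sqrt pi * (2 * sqrt pi / \<kappa>) ^ ?n * ((\<kappa> / sqrt (\<kappa>\<^sup>2 + (norm x)\<^sup>2)) ^ (?n + 1) *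
        (LINT u|lborel. indicator {0<..} u * (u ^ ?n * exp (- u\<^sup>2))))
      = poisson_const ?n * \<kappa> / sqrt (\<kappa>\<^sup>2 + (norm x)\<^sup>2) ^ (?n + 1)"
    using assms by (simp add: poisson_const_def power_divide)
  finally show "(LINT y|lborel. cis (x \<bullet> y) * complex_of_real (exp (- \<kappa> * norm y)))
      = complex_of_real (poisson_const ?n * \<kappa> / sqrt (\<kappa>\<^sup>2 + (norm x)\<^sup>2) ^ (?n + 1))" .
qed

lemma poisson_const_nonneg: "poisson_const n \<ge> 0"
proof -
  have "0 \<le> indicator {0<..} u * (u ^ n * exp (- u\<^sup>2))" for u :: real
    by (simp split: split_indicator)
  from Bochner_Integration.integral_nonneg[OF this] show ?thesis
    unfolding poisson_const_def by (intro mult_nonneg_nonneg) auto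
qed

lemma integrable_exp_norm_cis:
  fixes x :: "'a::euclidean_space"
  assumes "Re z > 0"
  shows "integrable lborel (\<lambda>y::'a. cis (x \<bullet> y) * exp (- z * complex_of_real (norm y)))"
proof (rule Bochner_Integration.integrable_bound[OF integrable_exp_norm[OF assms]])
  show "AE y in lborel. norm (cis (x \<bullet> y) * exp (- z * complex_of_real (norm y)))
      \<le> norm (exp (- Re z * norm (y::'a)))"
    by (simp add: norm_mult norm_exp)
qed measurable

lemma exp_difference_bound:
  fixes z w :: complex and m r :: real
  assumes "r \<ge> 0" "Re z \<ge> m" "Re w \<ge> m"
  shows "norm (exp (- z * of_real r) - exp (- w * of_real r)) \<le> r * exp (- m * r) * norm (z - w)"
proof (rule field_differentiable_bound[where S = "{z. Re z \<ge> m}"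
      and f' = "\<lambda>z. - of_real r * exp (- z * of_real r)"])
  show "convex {z. Re z \<ge> m}"
    by (rule convex_halfspace_Re_ge)
  show "((\<lambda>z. exp (- z * of_real r)) has_field_derivative - of_real r * exp (- v * of_real r))
      (at v within {z. Re z \<ge> m})" for v
    by (auto intro!: derivative_eq_intros)
  show "norm (- of_real r * exp (- v * of_real r)) \<le> r * exp (- m * r)" if "v \<in> {z. Re z \<ge> m}" for v
    using that assms by (auto simp: norm_mult norm_exp intro!: mult_left_mono mult_right_mono)
qed (use assms in auto)

text \<open>
  Differentiation under the integral sign. Near \<open>z\<^sub>0\<close> the real part stays above \<open>m = Re z\<^sub>0 / 2\<close>, so the
  difference quotients of the integrand are dominated by \<open>|y| exp (- m |y|)\<close>.
\<close>

lemma poisson_integral_holomorphic: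
  fixes x :: "'a::euclidean_space"
  shows "(\<lambda>z. LINT y|lborel. cis (x \<bullet> y) * exp (- z * complex_of_real (norm y)))
    holomorphic_on {z. Re z > 0}"
proof (rule holomorphic_onI)
  fix z\<^sub>0 :: complex
  assume "z\<^sub>0 \<in> {z. Re z > 0}"
  then have z\<^sub>0: "Re z\<^sub>0 > 0"
    by simp
  define m where "m = Re z\<^sub>0 / 2"
  have m: "m > 0"
    using z\<^sub>0 by (simp add: m_def)
  define e where "e = (\<lambda>z (y::'a). cis (x \<bullet> y) * exp (- z * complex_of_real (norm y)))"
  define d where "d = (\<lambda>y::'a. - complex_of_real (norm y) * e z\<^sub>0 y)"
  \<comment> \<open>Half of the exponential decay absorbs the factor \<open>norm y\<close>.\<close>
  define W where "W = (\<lambda>y::'a. (2 / m) * exp (- (m / 2) * norm y))"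
  have e_int: "integrable lborel (e z)" if "Re z > 0" for z
    using integrable_exp_norm_cis[OF that] by (simp add: e_def)
  have W_int: "integrable lborel W"
    unfolding W_def using m by (intro integrable_mult_right integrable_exp_norm) simp
  have W_bound: "norm y * exp (- m * norm y) \<le> W y" for y
  proof -
    have "(m / 2) * norm y \<le> exp ((m / 2) * norm y)"
      using exp_ge_add_one_self[of "(m / 2) * norm y"] by linarith
    then have "norm y \<le> (2 / m) * exp ((m / 2) * norm y)"
      using m by (simp add: field_simps)
    then have "norm y * exp (- m * norm y) \<le> (2 / m) * exp ((m / 2) * norm y) * exp (- m * norm y)"
      by (rule mult_right_mono) simp
    also have "\<dots> = W y"
      by (simp add: W_def exp_add[symmetric])
    finally show ?thesis .
  qed
  have [measurable]: "e z \<in> borel_measurable borel" "d \<in> borel_measurable borel"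
      "W \<in> borel_measurable borel" for z
    unfolding d_def e_def W_def by measurable
  have quot: "((\<lambda>z. (integral\<^sup>L lborel (e z) - integral\<^sup>L lborel (e z\<^sub>0)) / (z - z\<^sub>0)) \<longlongrightarrow> integral\<^sup>L lborel d)
      (at z\<^sub>0)"
    unfolding tendsto_at_iff_sequentially comp_def
  proof (intro allI impI)
    fix Z :: "nat \<Rightarrow> complex"
    assume Z: "\<forall>i. Z i \<in> UNIV - {z\<^sub>0}" "Z \<longlonglongrightarrow> z\<^sub>0"
    have "(\<lambda>i. Re (Z i)) \<longlonglongrightarrow> Re z\<^sub>0"
      using Z(2) by (rule tendsto_Re)
    then have "\<forall>\<^sub>F i in sequentially. m < Re (Z i)"
      by (rule order_tendstoD) (use z\<^sub>0 in \<open>simp add: m_def\<close>)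
    then obtain N where N: "\<And>i. i \<ge> N \<Longrightarrow> m < Re (Z i)"
      by (auto simp: eventually_sequentially)
    define s where "s = (\<lambda>i y. (e (Z (i + N)) y - e z\<^sub>0 y) / (Z (i + N) - z\<^sub>0))"
    have "(\<lambda>i. integral\<^sup>L lborel (s i)) \<longlonglongrightarrow> integral\<^sup>L lborel d"
    proof (rule integral_dominated_convergence[where w = W])
      show "AE y in lborel. (\<lambda>i. s i y) \<longlonglongrightarrow> d y"
      proof (rule AE_I2)
        fix y :: 'a
        have "((\<lambda>z. e z y) has_field_derivative d y) (at z\<^sub>0)"
          unfolding e_def d_def by (auto intro!: derivative_eq_intros)
        then have lim: "((\<lambda>z. (e z y - e z\<^sub>0 y) / (z - z\<^sub>0)) \<longlongrightarrow> d y) (at z\<^sub>0)"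
          by (simp add: has_field_derivative_iff)
        have "filterlim (\<lambda>i. Z (i + N)) (at z\<^sub>0) sequentially"
          using Z LIMSEQ_ignore_initial_segment[OF Z(2), of N] by (auto simp: filterlim_at)
        then show "(\<lambda>i. s i y) \<longlonglongrightarrow> d y"
          unfolding s_def by (rule filterlim_compose[OF lim])
      qed
      show "AE y in lborel. norm (s i y) \<le> W y" for i
      proof (rule AE_I2)
        fix y :: 'a
        have "norm (e (Z (i + N)) y - e z\<^sub>0 y)
            = norm (exp (- Z (i + N) * complex_of_real (norm y)) - exp (- z\<^sub>0 * complex_of_real (norm y)))"
          unfolding e_def right_diff_distrib[symmetric] by (simp add: norm_mult)
        also have "\<dots> \<le> norm y * exp (- m * norm y) * norm (Z (i + N) - z\<^sub>0)"
          using N[of "i + N"] z\<^sub>0 by (intro exp_difference_bound) (auto simp: m_def)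
        also have "\<dots> \<le> W y * norm (Z (i + N) - z\<^sub>0)"
          by (intro mult_right_mono W_bound) auto
        finally show "norm (s i y) \<le> W y"
          using Z(1) by (simp add: s_def norm_divide divide_le_eq)
      qed
      show "s i \<in> borel_measurable lborel" for i
        unfolding s_def by measurable
    qed (simp_all add: W_int)
    moreover have "integral\<^sup>L lborel (s i)
        = (integral\<^sup>L lborel (e (Z (i + N))) - integral\<^sup>L lborel (e z\<^sub>0)) / (Z (i + N) - z\<^sub>0)" for i
      unfolding s_def integral_divide_zero
      by (subst Bochner_Integration.integral_diff) (use N[of "i + N"] m z\<^sub>0 in \<open>auto intro!: e_int\<close>)
    ultimately show "(\<lambda>i. (integral\<^sup>L lborel (e (Z i)) - integral\<^sup>L lborel (e z\<^sub>0)) / (Z i - z\<^sub>0))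
        \<longlonglongrightarrow> integral\<^sup>L lborel d"
      by - (rule LIMSEQ_offset[of _ N], simp)
  qed
  then have "((\<lambda>z. integral\<^sup>L lborel (e z)) has_field_derivative integral\<^sup>L lborel d)
      (at z\<^sub>0 within {z. Re z > 0})"
    by - (rule has_field_derivative_at_within, simp add: has_field_derivative_iff)
  then show "(\<lambda>z. LINT y|lborel. cis (x \<bullet> y) * exp (- z * complex_of_real (norm y)))
      field_differentiable at z\<^sub>0 within {z. Re z > 0}"
    unfolding field_differentiable_def e_def by blast
qed

text \<open>
  This makes the principal branch of the square root holomorphic in the closed formula for the
  Poisson kernel, throughout the right half plane.
\<close>

lemma square_plus_not_nonpos_Real:
  fixes z :: complex and r :: real
  assumes "Re z > 0"
  shows "z\<^sup>2 + complex_of_real (r\<^sup>2) \<notin> \<real>\<^sub>\<le>\<^sub>0"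
proof
  assume "z\<^sup>2 + complex_of_real (r\<^sup>2) \<in> \<real>\<^sub>\<le>\<^sub>0"
  then have "Re (z\<^sup>2 + complex_of_real (r\<^sup>2)) \<le> 0" "Im (z\<^sup>2 + complex_of_real (r\<^sup>2)) = 0"
    by (auto simp: complex_nonpos_Reals_iff)
  then have "Im z = 0" "(Re z)\<^sup>2 - (Im z)\<^sup>2 + r\<^sup>2 \<le> 0"
    using assms by (auto simp: Re_power2 Im_power2 simp flip: of_real_power)
  moreover have "(Re z)\<^sup>2 > 0"
    using assms by simp
  ultimately show False
    using zero_le_power2[of r] by (simp del: zero_le_power2)
qed

text \<open>
  Both sides are holomorphic in the right half plane and agree on the positive real axis.
  At \<open>z = k - i t\<close> the left-hand side is the kernel of the half-wave flow, damped at frequencies above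
  \<open>1 / k\<close>.
\<close>

lemma poisson_kernel:
  fixes x :: "'a::euclidean_space"
  assumes "Re z > 0"
  shows "(LINT y|lborel. cis (x \<bullet> y) * exp (- z * complex_of_real (norm y)))
    = complex_of_real (poisson_const DIM('a)) * z /
        csqrt (z\<^sup>2 + complex_of_real ((norm x)\<^sup>2)) ^ (DIM('a) + 1)"
proof -
  define K where "K = (\<lambda>z. complex_of_real (poisson_const DIM('a)) * z /
        csqrt (z\<^sup>2 + complex_of_real ((norm x)\<^sup>2)) ^ (DIM('a) + 1))"
  define P where "P = (\<lambda>z. LINT y|lborel. cis (x \<bullet> y) * exp (- z * complex_of_real (norm y)))"
  have "(\<lambda>z. csqrt (z\<^sup>2 + complex_of_real ((norm x)\<^sup>2))) holomorphic_on {z. Re z > 0}"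
    by (intro holomorphic_on_csqrt' holomorphic_intros)
      (simp add: square_plus_not_nonpos_Real del: of_real_power)
  moreover have "csqrt (z\<^sup>2 + complex_of_real ((norm x)\<^sup>2)) \<noteq> 0" if "Re z > 0" for z
    using square_plus_not_nonpos_Real[OF that, of "norm x"] by (metis csqrt_eq_0 nonpos_Reals_zero_I)
  ultimately have K_hol: "K holomorphic_on {z. Re z > 0}"
    unfolding K_def by (intro holomorphic_on_divide holomorphic_on_mult holomorphic_on_power
        holomorphic_on_const holomorphic_on_ident) (simp_all del: csqrt_eq_0)
  have P_hol: "P holomorphic_on {z. Re z > 0}"
    unfolding P_def by (rule poisson_integral_holomorphic)
  have "P z - K z = 0"
  proof (rule analytic_continuation[where f = "\<lambda>z. P z - K z" and w = z and U = "complex_of_real ` {0<..}"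
        and \<xi> = 1 and S = "{z. Re z > 0}"])
    show "(\<lambda>z. P z - K z) holomorphic_on {z. Re z > 0}"
      by (intro holomorphic_intros P_hol K_hol)
    show "open {z. Re z > 0}"
      by (rule open_halfspace_Re_gt)
    show "connected {z. Re z > 0}"
      by (intro convex_connected convex_halfspace_Re_gt)
    show "1 islimpt complex_of_real ` {0<..}"
      unfolding islimpt_sequential
    proof (intro exI conjI allI)
      show "(\<lambda>n. complex_of_real (1 + inverse (real (Suc n)))) \<longlonglongrightarrow> 1"
        using tendsto_of_real[OF LIMSEQ_inverse_real_of_nat_add[of 1], where ?'a = complex]
        by (simp only: of_real_1)
      show "complex_of_real (1 + inverse (real (Suc n))) \<in> complex_of_real ` {0<..} - {1}" for n
      proof -
        have "0 < inverse (real (Suc n))"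
          by simp
        then have "1 + inverse (real (Suc n)) \<in> {0<..}" "1 + inverse (real (Suc n)) \<noteq> 1"
          unfolding greaterThan_iff by linarith+
        then show ?thesis
          by (simp only: Diff_iff imageI singleton_iff of_real_eq_1_iff not_False_eq_True)
      qed
    qed
    show "P w - K w = 0" if w: "w \<in> complex_of_real ` {0<..}" for w
    proof -
      obtain k where k: "w = complex_of_real k" "k > 0"
        using w by auto
      have csqrt_w: "csqrt (w\<^sup>2 + complex_of_real ((norm x)\<^sup>2)) = complex_of_real (sqrt (k\<^sup>2 + (norm x)\<^sup>2))"
      proof -
        have "w\<^sup>2 + complex_of_real ((norm x)\<^sup>2) = complex_of_real (k\<^sup>2 + (norm x)\<^sup>2)"
          by (simp add: k(1))
        then show ?thesis
          by (simp only: add_nonneg_nonneg zero_le_power2 of_real_sqrt)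
      qed
      have exp_w: "exp (- w * complex_of_real (norm y)) = complex_of_real (exp (- k * norm y))" for y :: 'a
        by (simp add: k(1) exp_of_real[symmetric])
      show ?thesis
        unfolding P_def K_def exp_w csqrt_w poisson_kernel_real(2)[OF k(2)]
        by (simp add: k(1))
    qed
  qed (use assms in auto)
  then show ?thesis
    by (simp add: P_def K_def)
qed

text \<open>
  The dispersive estimate, read off from the Poisson kernel at \<open>z = k - i t\<close>. Its denominator stays away
  from zero: either the imaginary part \<open>- 2 k t\<close> of \<open>z\<^sup>2 + |x|\<^sup>2\<close> is large, or
  \<open>|t| < k / 2\<close> and then its real part is at least \<open>3 k\<^sup>2 / 4\<close>. For fixed \<open>k\<close> the bound is uniform in
  \<open>x\<close> and decays like \<open>|t|\<close> to the power \<open>- (n - 1) / 2\<close>, which is integrable once \<open>n \<ge> 4\<close>.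
\<close>

lemma poisson_kernel_dispersive_bound:
  fixes x :: "'a::euclidean_space"
  assumes "k > 0"
  shows "norm (LINT y|lborel. cis (x \<bullet> y + t * norm y) * complex_of_real (exp (- k * norm y)))
    \<le> poisson_const DIM('a) * (k + \<bar>t\<bar>) / sqrt (k * (k + \<bar>t\<bar>) / 2) ^ (DIM('a) + 1)"
proof -
  define z where "z = Complex k (- t)"
  define w where "w = z\<^sup>2 + complex_of_real ((norm x)\<^sup>2)"
  have z: "Re z > 0"
    using assms by (simp add: z_def)
  have "cis (x \<bullet> y + t * norm y) * complex_of_real (exp (- k * norm y))
      = cis (x \<bullet> y) * exp (- z * complex_of_real (norm y))" for y
  proof -
    have "exp (- z * complex_of_real (norm y)) = complex_of_real (exp (- k * norm y)) * cis (t * norm y)"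
      by (subst exp_eq_polar) (simp add: z_def)
    then show ?thesis
      by (simp add: mult_ac flip: cis_mult)
  qed
  then have eq: "(LINT y|lborel. cis (x \<bullet> y + t * norm y) * complex_of_real (exp (- k * norm y)))
      = complex_of_real (poisson_const DIM('a)) * z / csqrt w ^ (DIM('a) + 1)"
    using poisson_kernel[OF z, of x] by (simp add: w_def)
  have norm_z: "norm z \<le> k + \<bar>t\<bar>"
    using cmod_le[of z] assms by (simp add: z_def)
  have w_parts: "Re w = k\<^sup>2 - t\<^sup>2 + (norm x)\<^sup>2" "Im w = - 2 * k * t"
    by (simp_all add: w_def z_def Re_power2 Im_power2)
  have norm_w: "k * (k + \<bar>t\<bar>) / 2 \<le> norm w"
  proof (cases "\<bar>t\<bar> \<ge> k / 2")
    case True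
    then have "k * (k + \<bar>t\<bar>) / 2 \<le> k * (4 * \<bar>t\<bar>) / 2"
      using assms by (intro divide_right_mono mult_left_mono) auto
    also have "\<dots> = \<bar>Im w\<bar>"
      using assms by (simp add: w_parts abs_mult)
    finally show ?thesis
      using abs_Im_le_cmod[of w] by linarith
  next
    case False
    then have "t\<^sup>2 \<le> (k / 2)\<^sup>2"
      using assms by (intro power2_le_iff_abs_le[THEN iffD2]) auto
    then have "3 / 4 * k\<^sup>2 \<le> Re w"
      by (simp add: w_parts power_divide) (use zero_le_power2[of "norm x"] in linarith)
    moreover have "k * (k + \<bar>t\<bar>) / 2 \<le> k * (3 / 2 * k) / 2"
      using assms False by (intro divide_right_mono mult_left_mono) auto
    ultimately show ?thesis
      using complex_Re_le_cmod[of w] by (simp add: power2_eq_square)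
  qed
  have pos: "k * (k + \<bar>t\<bar>) / 2 > 0"
    using assms by simp
  have "norm (complex_of_real (poisson_const DIM('a)) * z / csqrt w ^ (DIM('a) + 1))
      = poisson_const DIM('a) * norm z / sqrt (norm w) ^ (DIM('a) + 1)"
    using poisson_const_nonneg by (simp add: norm_mult norm_divide norm_power)
  also have "\<dots> \<le> poisson_const DIM('a) * (k + \<bar>t\<bar>) / sqrt (k * (k + \<bar>t\<bar>) / 2) ^ (DIM('a) + 1)"
  proof (rule frac_le)
    show "0 \<le> poisson_const DIM('a) * (k + \<bar>t\<bar>)"
      using assms poisson_const_nonneg by (intro mult_nonneg_nonneg) auto
    show "poisson_const DIM('a) * norm z \<le> poisson_const DIM('a) * (k + \<bar>t\<bar>)"
      by (rule mult_left_mono[OF norm_z poisson_const_nonneg])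
    show "0 < sqrt (k * (k + \<bar>t\<bar>) / 2) ^ (DIM('a) + 1)"
      by (rule zero_less_power) (simp only: real_sqrt_gt_0_iff pos)
    show "sqrt (k * (k + \<bar>t\<bar>) / 2) ^ (DIM('a) + 1) \<le> sqrt (norm w) ^ (DIM('a) + 1)"
      using pos norm_w by (intro power_mono real_sqrt_le_mono) simp_all
  qed
  finally show ?thesis
    unfolding eq .
qed

section \<open>Schur's test and the TT* argument\<close>

abbreviation sq_norm :: "'a measure \<Rightarrow> ('a \<Rightarrow> complex) \<Rightarrow> ennreal" where
  "sq_norm M f \<equiv> \<integral>\<^sup>+x. ennreal ((norm (f x))\<^sup>2) \<partial>M"

lemma cnj_measurable [measurable]: "cnj \<in> borel_measurable borel"
  by (intro borel_measurable_continuous_onI continuous_intros)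

lemma ennreal_le_cancel:
  fixes x a :: ennreal
  assumes le: "x * x \<le> a * x" and fin: "x < \<infinity>"
  shows "x \<le> a"
proof (cases "x = 0")
  case False
  have "x * x / x \<le> a * x / x"
    by (rule divide_right_mono_ennreal[OF le])
  then show ?thesis
    using False fin by (simp add: ennreal_mult_divide_eq)
qed simp

lemma nn_integral_le_exhaustion:
  fixes S :: "nat \<Rightarrow> 'a set"
  assumes [measurable]: "f \<in> borel_measurable M" "\<And>i. S i \<in> sets M"
    and S: "incseq S" "(\<Union>i. S i) = space M"
    and le: "\<And>i. (\<integral>\<^sup>+x. f x * indicator (S i) x \<partial>M) \<le> c"
  shows "(\<integral>\<^sup>+x. f x \<partial>M) \<le> c"
proof -
  have "(\<integral>\<^sup>+x. f x \<partial>M) = (\<integral>\<^sup>+x. (SUP i. f x * indicator (S i) x) \<partial>M)"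
  proof (rule nn_integral_cong)
    fix x assume "x \<in> space M"
    then obtain i where "x \<in> S i"
      using S(2) by auto
    then show "f x = (SUP i. f x * indicator (S i) x)"
      by (intro antisym SUP_least SUP_upper2[of i]) (auto split: split_indicator)
  qed
  also have "\<dots> = (SUP i. \<integral>\<^sup>+x. f x * indicator (S i) x \<partial>M)"
  proof (rule nn_integral_monotone_convergence_SUP)
    show "incseq (\<lambda>i x. f x * indicator (S i) x)"
      using S(1) by (auto simp: incseq_def le_fun_def split: split_indicator)
  qed measurable
  also have "\<dots> \<le> c"
    by (intro SUP_least le)
  finally show ?thesis .
qed

text \<open>
  Expanding the square of the modulus and integrating over \<open>y\<close> first gives the quadratic form
  of \<open>v\<close> with kernel \<open>\<integral> E(t,y) cnj E(s,y) \<omega>(y) dy\<close>. Schur's test (\<open>2 |v(t) v(s)| \<le> |v(t)|\<^sup>2 + |v(s)|\<^sup>2\<close>)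
  bounds it by the row and column integrals of the kernel.
\<close>

lemma schur_quadratic_form:
  fixes E :: "'t \<Rightarrow> 'y \<Rightarrow> complex" and \<kappa> :: "'t \<Rightarrow> 't \<Rightarrow> ennreal"
  assumes "sigma_finite_measure M" "sigma_finite_measure N"
    and E_meas [measurable]: "case_prod E \<in> borel_measurable (M \<Otimes>\<^sub>M N)"
    and E_le: "\<And>t y. norm (E t y) \<le> 1"
    and \<omega>_int: "integrable N \<omega>" and \<omega>_nonneg: "\<And>y. \<omega> y \<ge> (0::real)"
    and v_int: "integrable M v"
    and \<kappa>_meas [measurable]: "case_prod \<kappa> \<in> borel_measurable (M \<Otimes>\<^sub>M M)"
    and \<kappa>: "\<And>t s. ennreal (norm (LINT y|N. E t y * cnj (E s y) * complex_of_real (\<omega> y))) \<le> \<kappa> t s"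
    and \<kappa>_rows: "\<And>t. (\<integral>\<^sup>+s. \<kappa> t s \<partial>M) \<le> A" and \<kappa>_cols: "\<And>s. (\<integral>\<^sup>+t. \<kappa> t s \<partial>M) \<le> A"
  shows "(\<integral>\<^sup>+y. ennreal ((norm (LINT t|M. v t * E t y))\<^sup>2 * \<omega> y) \<partial>N)
    \<le> A * sq_norm M v"
proof -
  interpret M: sigma_finite_measure M by fact
  interpret N: sigma_finite_measure N by fact
  interpret MM: pair_sigma_finite M M ..
  interpret MN: pair_sigma_finite M N ..
  interpret P: pair_sigma_finite "M \<Otimes>\<^sub>M M" N ..
  have [measurable]: "v \<in> borel_measurable M" "\<omega> \<in> borel_measurable N"
    using v_int \<omega>_int by auto
  define V where "V = (\<lambda>y. LINT t|M. v t * E t y)"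
  define F where "F = (\<lambda>p y. v (fst p) * E (fst p) y * cnj (v (snd p) * E (snd p) y) * complex_of_real (\<omega> y))"
  define B where "B = sq_norm M v"
  have vE_int: "integrable M (\<lambda>t. v t * E t y)" if "y \<in> space N" for y
  proof (rule Bochner_Integration.integrable_bound[OF v_int])
    show "(\<lambda>t. v t * E t y) \<in> borel_measurable M"
      using that by measurable
    show "AE t in M. norm (v t * E t y) \<le> norm (v t)"
      using E_le by (auto simp: norm_mult intro!: mult_left_le)
  qed
  have [measurable]: "V \<in> borel_measurable N"
    unfolding V_def by measurable
  have V_le: "norm (V y) \<le> (LINT t|M. norm (v t))" for y
  proof -
    have "norm (V y) \<le> (LINT t|M. norm (v t * E t y))"
      unfolding V_def by (rule integral_norm_bound)
    also have "\<dots> \<le> (LINT t|M. norm (v t))"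
      using E_le v_int by (intro integral_mono') (auto simp: norm_mult intro!: mult_left_le)
    finally show ?thesis .
  qed
  have vv_int: "integrable (M \<Otimes>\<^sub>M M) (\<lambda>p. v (fst p) * cnj (v (snd p)))"
    using MM.integrable_tensor[OF v_int, of "\<lambda>s. cnj (v s)"] v_int by (simp add: split_beta')
  have F_int: "integrable ((M \<Otimes>\<^sub>M M) \<Otimes>\<^sub>M N) (case_prod F)"
  proof -
    have "integrable ((M \<Otimes>\<^sub>M M) \<Otimes>\<^sub>M N) (\<lambda>(p, y). v (fst p) * cnj (v (snd p)) * complex_of_real (\<omega> y)
        * (E (fst p) y * cnj (E (snd p) y)))"
      by (rule P.integrable_tensor_kernel[OF vv_int])
        (use \<omega>_int E_le in \<open>auto simp: norm_mult intro!: mult_le_one\<close>)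
    then show ?thesis
      by (simp add: F_def mult_ac)
  qed
  have inner: "(LINT p|(M \<Otimes>\<^sub>M M). F p y) = complex_of_real ((norm (V y))\<^sup>2 * \<omega> y)" if y: "y \<in> space N" for y
  proof -
    have "(LINT p|(M \<Otimes>\<^sub>M M). F p y) = (LINT p|(M \<Otimes>\<^sub>M M). (case p of (t, s) \<Rightarrow> v t * E t y * cnj (v s * E s y))) * complex_of_real (\<omega> y)"
      unfolding integral_mult_left_zero[symmetric] by (simp add: F_def split_beta')
    also have "(LINT p|(M \<Otimes>\<^sub>M M). (case p of (t, s) \<Rightarrow> v t * E t y * cnj (v s * E s y)))
       = (LINT t|M. LINT s|M. v t * E t y * cnj (v s * E s y))"
    proof (rule MM.integral_fst[symmetric])
      show "integrable (M \<Otimes>\<^sub>M M) (\<lambda>(t, s). v t * E t y * cnj (v s * E s y))"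
        using MM.integrable_tensor[OF vE_int[OF y], of "\<lambda>s. cnj (v s * E s y)"] vE_int[OF y]
        by (simp del: complex_cnj_mult)
    qed
    also have "\<dots> = V y * cnj (V y)"
      by (simp add: V_def del: complex_cnj_mult)
    finally show ?thesis
      by (simp only: complex_norm_square[symmetric] of_real_mult of_real_power)
  qed
  have finite_lhs: "integrable N (\<lambda>y. (norm (V y))\<^sup>2 * \<omega> y)"
  proof (rule Bochner_Integration.integrable_bound)
    show "integrable N (\<lambda>y. (LINT t|M. norm (v t))\<^sup>2 * \<omega> y)"
      using \<omega>_int by simp
    show "AE y in N. norm ((norm (V y))\<^sup>2 * \<omega> y) \<le> norm ((LINT t|M. norm (v t))\<^sup>2 * \<omega> y)"
      using \<omega>_nonneg V_le by (auto simp: abs_mult intro!: mult_right_mono power_mono)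
  qed measurable
  have "(\<integral>\<^sup>+y. ennreal ((norm (V y))\<^sup>2 * \<omega> y) \<partial>N) = ennreal (LINT y|N. (norm (V y))\<^sup>2 * \<omega> y)"
    using \<omega>_nonneg by (intro nn_integral_eq_integral finite_lhs) auto
  also have "\<dots> = ennreal (norm (LINT y|N. complex_of_real ((norm (V y))\<^sup>2 * \<omega> y)))"
    using \<omega>_nonneg by (simp only: integral_complex_of_real norm_of_real)
      (simp add: Bochner_Integration.integral_nonneg)
  also have "(LINT y|N. complex_of_real ((norm (V y))\<^sup>2 * \<omega> y)) = (LINT y|N. LINT p|(M \<Otimes>\<^sub>M M). F p y)"
    by (intro Bochner_Integration.integral_cong refl) (simp only: inner)
  also have "\<dots> = (LINT p|(M \<Otimes>\<^sub>M M). LINT y|N. F p y)"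
    by (rule P.Fubini_integral[OF F_int])
  also have "ennreal (norm \<dots>) \<le> (\<integral>\<^sup>+p. ennreal (norm (LINT y|N. F p y)) \<partial>(M \<Otimes>\<^sub>M M))"
    using P.integrable_fst[OF F_int] by (rule integral_norm_bound_ennreal)
  also have "\<dots> \<le> (\<integral>\<^sup>+p. (ennreal ((norm (v (fst p)))\<^sup>2) * \<kappa> (fst p) (snd p)
      + ennreal ((norm (v (snd p)))\<^sup>2) * \<kappa> (fst p) (snd p)) / 2 \<partial>(M \<Otimes>\<^sub>M M))"
  proof (rule nn_integral_mono)
    fix p
    let ?a = "norm (v (fst p))" and ?b = "norm (v (snd p))"
    have "(LINT y|N. F p y) = v (fst p) * cnj (v (snd p)) *
        (LINT y|N. E (fst p) y * cnj (E (snd p) y) * complex_of_real (\<omega> y))"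
      unfolding integral_mult_right_zero[symmetric] by (simp add: F_def mult_ac)
    then have "ennreal (norm (LINT y|N. F p y)) = ennreal (?a * ?b) *
        ennreal (norm (LINT y|N. E (fst p) y * cnj (E (snd p) y) * complex_of_real (\<omega> y)))"
      by (simp add: norm_mult ennreal_mult mult.assoc)
    also have "\<dots> \<le> ennreal (?a * ?b) * \<kappa> (fst p) (snd p)"
      by (intro mult_left_mono \<kappa>) auto
    also have "\<dots> \<le> ennreal ((?a\<^sup>2 + ?b\<^sup>2) / 2) * \<kappa> (fst p) (snd p)"
    proof (intro mult_right_mono ennreal_leI)
      show "?a * ?b \<le> (?a\<^sup>2 + ?b\<^sup>2) / 2"
        using sum_squares_bound[of ?a ?b] by simp
    qed auto
    also have "ennreal ((?a\<^sup>2 + ?b\<^sup>2) / 2) = (ennreal (?a\<^sup>2) + ennreal (?b\<^sup>2)) / 2"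
      by (simp add: divide_ennreal[symmetric] ennreal_numeral)
    finally show "ennreal (norm (LINT y|N. F p y)) \<le> (ennreal (?a\<^sup>2) * \<kappa> (fst p) (snd p)
      + ennreal (?b\<^sup>2) * \<kappa> (fst p) (snd p)) / 2"
      by (simp only: divide_ennreal_def distrib_right distrib_left mult_ac)
  qed
  also have "\<dots> = ((\<integral>\<^sup>+p. ennreal ((norm (v (fst p)))\<^sup>2) * \<kappa> (fst p) (snd p) \<partial>(M \<Otimes>\<^sub>M M))
      + (\<integral>\<^sup>+p. ennreal ((norm (v (snd p)))\<^sup>2) * \<kappa> (fst p) (snd p) \<partial>(M \<Otimes>\<^sub>M M))) / 2"
    by (simp add: nn_integral_divide nn_integral_add)
  also have "\<dots> \<le> (A * B + A * B) / 2"
  proof (intro divide_right_mono_ennreal add_mono)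
    have "(\<integral>\<^sup>+p. ennreal ((norm (v (fst p)))\<^sup>2) * \<kappa> (fst p) (snd p) \<partial>(M \<Otimes>\<^sub>M M))
        = (\<integral>\<^sup>+t. ennreal ((norm (v t))\<^sup>2) * (\<integral>\<^sup>+s. \<kappa> t s \<partial>M) \<partial>M)"
      by (subst M.nn_integral_fst[symmetric]) (auto intro!: nn_integral_cong nn_integral_cmult)
    also have "\<dots> \<le> (\<integral>\<^sup>+t. ennreal ((norm (v t))\<^sup>2) * A \<partial>M)"
      by (intro nn_integral_mono mult_left_mono \<kappa>_rows) auto
    also have "\<dots> = A * B"
      by (subst nn_integral_multc) (auto simp: B_def mult.commute)
    finally show "(\<integral>\<^sup>+p. ennreal ((norm (v (fst p)))\<^sup>2) * \<kappa> (fst p) (snd p) \<partial>(M \<Otimes>\<^sub>M M)) \<le> A * B" .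
    have "(\<integral>\<^sup>+p. ennreal ((norm (v (snd p)))\<^sup>2) * \<kappa> (fst p) (snd p) \<partial>(M \<Otimes>\<^sub>M M))
        = (\<integral>\<^sup>+t. \<integral>\<^sup>+s. ennreal ((norm (v s))\<^sup>2) * \<kappa> t s \<partial>M \<partial>M)"
      by (subst M.nn_integral_fst[symmetric]) auto
    also have "\<dots> = (\<integral>\<^sup>+s. \<integral>\<^sup>+t. ennreal ((norm (v s))\<^sup>2) * \<kappa> t s \<partial>M \<partial>M)"
      by (rule MM.Fubini'[symmetric]) measurable
    also have "\<dots> = (\<integral>\<^sup>+s. ennreal ((norm (v s))\<^sup>2) * (\<integral>\<^sup>+t. \<kappa> t s \<partial>M) \<partial>M)"
      by (intro nn_integral_cong nn_integral_cmult) measurable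
    also have "\<dots> \<le> (\<integral>\<^sup>+s. ennreal ((norm (v s))\<^sup>2) * A \<partial>M)"
      by (intro nn_integral_mono mult_left_mono \<kappa>_cols) auto
    also have "\<dots> = A * B"
      by (subst nn_integral_multc) (auto simp: B_def mult.commute)
    finally show "(\<integral>\<^sup>+p. ennreal ((norm (v (snd p)))\<^sup>2) * \<kappa> (fst p) (snd p) \<partial>(M \<Otimes>\<^sub>M M)) \<le> A * B" .
  qed
  also have "\<dots> = A * B"
    by (simp only: mult_2_right[symmetric]) (simp add: ennreal_mult_divide_eq)
  finally show ?thesis
    unfolding V_def B_def .
qed

text \<open>
  The \<open>TT\<^sup>*\<close> argument: the bound for the adjoint operator in Schur's test above is dualised. Pairing \<open>u\<close> with its own
  conjugate on a set of finite measure gives \<open>I \<le> \<integral> |g| |V|\<close>, where \<open>V y\<close> is the integral of \<open>cnj (u t) * E t y\<close>; the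
  Cauchy-Schwarz inequality with weight \<open>\<omega>\<close> then yields \<open>I\<^sup>2 \<le> A G I\<close>, and \<open>I\<close> is finite because the
  set is.
\<close>

lemma adjoint_estimate_TT_star:
  fixes E :: "'t \<Rightarrow> 'y \<Rightarrow> complex" and \<kappa> :: "'t \<Rightarrow> 't \<Rightarrow> ennreal"
  assumes M: "sigma_finite_measure M" and N: "sigma_finite_measure N"
    and E_meas [measurable]: "case_prod E \<in> borel_measurable (M \<Otimes>\<^sub>M N)"
    and E_le: "\<And>t y. norm (E t y) \<le> 1"
    and \<omega>_int: "integrable N \<omega>" and \<omega>_pos: "\<And>y. \<omega> y > (0::real)"
    and g_int: "integrable N g"
    and \<kappa>_meas [measurable]: "case_prod \<kappa> \<in> borel_measurable (M \<Otimes>\<^sub>M M)"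
    and \<kappa>: "\<And>t s. ennreal (norm (LINT y|N. E t y * cnj (E s y) * complex_of_real (\<omega> y))) \<le> \<kappa> t s"
    and \<kappa>_rows: "\<And>t. (\<integral>\<^sup>+s. \<kappa> t s \<partial>M) \<le> A" and \<kappa>_cols: "\<And>s. (\<integral>\<^sup>+t. \<kappa> t s \<partial>M) \<le> A"
  shows "(\<integral>\<^sup>+t. ennreal ((norm (LINT y|N. g y * E t y))\<^sup>2) \<partial>M)
    \<le> A * (\<integral>\<^sup>+y. ennreal ((norm (g y))\<^sup>2 / \<omega> y) \<partial>N)"
proof -
  interpret M: sigma_finite_measure M by fact
  interpret N: sigma_finite_measure N by fact
  interpret MN: pair_sigma_finite M N ..
  have [measurable]: "g \<in> borel_measurable N" "\<omega> \<in> borel_measurable N"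
    using g_int \<omega>_int by auto
  define u where "u = (\<lambda>t. LINT y|N. g y * E t y)"
  define G where "G = (\<integral>\<^sup>+y. ennreal ((norm (g y))\<^sup>2 / \<omega> y) \<partial>N)"
  have [measurable]: "u \<in> borel_measurable M"
    unfolding u_def by measurable
  have u_le: "norm (u t) \<le> (LINT y|N. norm (g y))" for t
  proof -
    have "norm (u t) \<le> (LINT y|N. norm (g y * E t y))"
      unfolding u_def by (rule integral_norm_bound)
    also have "\<dots> \<le> (LINT y|N. norm (g y))"
      using E_le g_int by (intro integral_mono') (auto simp: norm_mult intro!: mult_left_le)
    finally show ?thesis .
  qed
  \<comment> \<open>On sets of finite measure, where \<open>u\<close> is integrable and square integrable because it is bounded.\<close>
  have local: "(\<integral>\<^sup>+t. ennreal ((norm (u t))\<^sup>2) * indicator S t \<partial>M) \<le> A * G"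
    if S [measurable]: "S \<in> sets M" and S_fin: "emeasure M S < \<infinity>" for S
  proof -
    define v where "v = (\<lambda>t. indicator S t * cnj (u t))"
    define V where "V = (\<lambda>y. LINT t|M. v t * E t y)"
    have v_int: "integrable M v"
    proof (rule Bochner_Integration.integrable_bound)
      show "integrable M (\<lambda>t. indicator S t * (LINT y|N. norm (g y)))"
        using S_fin by (intro integrable_mult_left) (simp add: integrable_indicator_iff)
      show "AE t in M. norm (v t) \<le> norm (indicator S t * (LINT y|N. norm (g y)))"
        using u_le by (auto simp: v_def split: split_indicator intro: order_trans)
    qed (simp add: v_def)
    have [measurable]: "v \<in> borel_measurable M"
      using v_int by auto
    have [measurable]: "V \<in> borel_measurable N"
      unfolding V_def by measurable
    have v_sq: "v t * u t = complex_of_real ((norm (v t))\<^sup>2)" for t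
      by (cases "t \<in> S") (simp_all only: v_def indicator_simps mult_1 mult_zero_left complex_mod_cnj
          complex_norm_square mult.commute complex_cnj_cnj norm_zero, simp_all)
    have v_nn: "ennreal ((norm (v t))\<^sup>2) = ennreal ((norm (u t))\<^sup>2) * indicator S t" for t
      by (simp add: v_def split: split_indicator)
    have gvE_int: "integrable (M \<Otimes>\<^sub>M N) (\<lambda>(t, y). v t * g y * E t y)"
      by (rule MN.integrable_tensor_kernel[OF v_int g_int E_meas E_le])
    have v_sq_int: "integrable M (\<lambda>t. (norm (v t))\<^sup>2)"
    proof (rule Bochner_Integration.integrable_bound)
      show "integrable M (\<lambda>t. (LINT y|N. norm (g y)) * norm (v t))"
        using v_int by simp
      show "AE t in M. norm ((norm (v t))\<^sup>2) \<le> norm ((LINT y|N. norm (g y)) * norm (v t))"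
      proof (rule AE_I2)
        fix t
        have "norm (v t) \<le> (LINT y|N. norm (g y))"
          using u_le[of t] by (auto simp: v_def split: split_indicator intro: order_trans[OF norm_ge_zero])
        then have "norm (v t) * norm (v t) \<le> (LINT y|N. norm (g y)) * norm (v t)"
          by (rule mult_right_mono) simp
        then show "norm ((norm (v t))\<^sup>2) \<le> norm ((LINT y|N. norm (g y)) * norm (v t))"
          by (simp add: power2_eq_square)
      qed
    qed measurable
    define I where "I = sq_norm M v"
    have I_fin: "I < \<infinity>"
      using v_sq_int by (simp add: I_def nn_integral_eq_integral)
    have "I = ennreal (LINT t|M. (norm (v t))\<^sup>2)"
      unfolding I_def by (intro nn_integral_eq_integral v_sq_int) simp
    also have "\<dots> = ennreal (norm (LINT t|M. v t * u t))"
      unfolding v_sq integral_complex_of_real norm_of_real by (simp add: Bochner_Integration.integral_nonneg)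
    also have "(LINT t|M. v t * u t) = (LINT t|M. LINT y|N. v t * g y * E t y)"
      unfolding u_def by (simp add: mult.assoc)
    also have "\<dots> = (LINT y|N. LINT t|M. v t * g y * E t y)"
      by (rule MN.Fubini_integral[OF gvE_int, symmetric])
    also have "\<dots> = (LINT y|N. g y * V y)"
      unfolding V_def integral_mult_right_zero[symmetric] by (simp add: mult_ac)
    also have "ennreal (norm \<dots>) \<le> (\<integral>\<^sup>+y. ennreal (norm (g y * V y)) \<partial>N)"
    proof (rule integral_norm_bound_ennreal)
      have "integrable N (\<lambda>y. LINT t|M. v t * g y * E t y)"
        by (rule MN.integrable_snd[OF gvE_int])
      also have "(\<lambda>y. LINT t|M. v t * g y * E t y) = (\<lambda>y. g y * V y)"
        unfolding V_def integral_mult_right_zero[symmetric] by (simp add: mult_ac)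
      finally show "integrable N (\<lambda>y. g y * V y)" .
    qed
    also have "\<dots> = (\<integral>\<^sup>+y. ennreal (norm (g y) / sqrt (\<omega> y)) * ennreal (norm (V y) * sqrt (\<omega> y)) \<partial>N)"
      using \<omega>_pos by (intro nn_integral_cong)
        (simp add: norm_mult ennreal_mult[symmetric] less_imp_le less_imp_neq[THEN not_sym])
    finally have "I\<^sup>2 \<le> (\<integral>\<^sup>+y. ennreal (norm (g y) / sqrt (\<omega> y)) * ennreal (norm (V y) * sqrt (\<omega> y)) \<partial>N)\<^sup>2"
      by (rule power_mono) simp
    also have "\<dots> \<le> (\<integral>\<^sup>+y. (ennreal (norm (g y) / sqrt (\<omega> y)))\<^sup>2 \<partial>N) * (\<integral>\<^sup>+y. (ennreal (norm (V y) * sqrt (\<omega> y)))\<^sup>2 \<partial>N)"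
      by (rule Cauchy_Schwarz_nn_integral) measurable
    also have "(\<integral>\<^sup>+y. (ennreal (norm (g y) / sqrt (\<omega> y)))\<^sup>2 \<partial>N) = G"
      using \<omega>_pos by (simp add: G_def ennreal_power power_divide less_imp_le)
    also have "(\<integral>\<^sup>+y. (ennreal (norm (V y) * sqrt (\<omega> y)))\<^sup>2 \<partial>N) = (\<integral>\<^sup>+y. ennreal ((norm (V y))\<^sup>2 * \<omega> y) \<partial>N)"
      using \<omega>_pos by (simp add: ennreal_power power_mult_distrib less_imp_le)
    also have "\<dots> \<le> A * I"
      unfolding V_def I_def
      by (rule schur_quadratic_form[OF M N E_meas E_le \<omega>_int less_imp_le[OF \<omega>_pos] v_int \<kappa>_meas \<kappa> \<kappa>_rows \<kappa>_cols])
    finally have "I\<^sup>2 \<le> G * (A * I)"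
      by (simp add: mult_left_mono)
    then have I_sq: "I * I \<le> (A * G) * I"
      by (simp only: power2_eq_square mult_ac)
    have "I \<le> A * G"
      by (rule ennreal_le_cancel[OF I_sq I_fin])
    then show ?thesis
      unfolding I_def v_nn .
  qed
  obtain S where S: "range S \<subseteq> sets M" "(\<Union>i. S i) = space M" "\<And>i. emeasure M (S i) \<noteq> \<infinity>" "incseq S"
    using M.sigma_finite_incseq by blast
  have [measurable]: "S i \<in> sets M" for i
    using S(1) by auto
  have "sq_norm M u \<le> A * G"
    using S by - (rule nn_integral_le_exhaustion[of _ _ S], auto simp: less_top intro!: local)
  then show ?thesis
    unfolding u_def G_def .
qed

section \<open>The Strichartz estimate at a single frequency scale\<close>

text \<open>
  The profile in \<open>t\<close> of the dispersive bound at \<open>k = 1\<close>.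
\<close>

definition wave_decay :: "nat \<Rightarrow> real \<Rightarrow> real" where
  "wave_decay n s = (1 + \<bar>s\<bar>) / sqrt ((1 + \<bar>s\<bar>) / 2) ^ (n + 1)"

lemma wave_decay_nonneg: "wave_decay n s \<ge> 0"
  by (simp add: wave_decay_def)

lemma wave_decay_measurable [measurable]: "wave_decay n \<in> borel_measurable borel"
  unfolding wave_decay_def by measurable

lemma wave_decay_integrable:
  assumes "n \<ge> 4"
  shows "integrable lborel (wave_decay n)"
proof -
  define f where "f = (\<lambda>s::real. (1 + s) powr (- 3 / 2))"
  have f_meas [measurable]: "f \<in> borel_measurable borel"
    unfolding f_def by measurable
  have half: "(\<integral>\<^sup>+s. ennreal (f s) * indicator {0..} s \<partial>lborel) = ennreal 2"
  proof -
    have "(\<integral>\<^sup>+s. ennreal (f s) * indicator {0..} s \<partial>lborel) = ennreal (0 - (- 2 * (1 + 0) powr (- 1 / 2)))"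
    proof (rule nn_integral_FTC_atLeast)
      show "((\<lambda>s. - 2 * (1 + s) powr (- 1 / 2)) has_real_derivative f s) (at s)" if "0 \<le> s" for s :: real
        using that unfolding f_def by (auto intro!: derivative_eq_intros)
      show "((\<lambda>s::real. - 2 * (1 + s) powr (- 1 / 2)) \<longlongrightarrow> 0) at_top"
        by real_asymp
    qed (auto simp: f_def)
    then show ?thesis
      by simp
  qed
  \<comment> \<open>The case \<open>n = 4\<close> is the slowest decay.\<close>
  have bound: "wave_decay n s \<le> sqrt 2 ^ (n + 1) * f \<bar>s\<bar>" for s
  proof -
    define a where "a = sqrt (1 + \<bar>s\<bar>)"
    have a: "a \<ge> 1" "a\<^sup>2 = 1 + \<bar>s\<bar>"
      by (auto simp: a_def)
    have f_a: "f \<bar>s\<bar> = 1 / a ^ 3"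
    proof -
      have "f \<bar>s\<bar> = (a powr 2) powr (- 3 / 2)"
        using a by (simp add: f_def)
      also have "\<dots> = a powr (- 3)"
        by (simp add: powr_powr)
      also have "\<dots> = 1 / a ^ 3"
        using a(1) by (simp add: powr_minus_divide)
      finally show ?thesis .
    qed
    have "wave_decay n s = sqrt 2 ^ (n + 1) * (a\<^sup>2 / a ^ (n + 1))"
      by (simp add: wave_decay_def a(2) a_def real_sqrt_divide power_divide)
    also have "a\<^sup>2 / a ^ (n + 1) \<le> a\<^sup>2 / a ^ 5"
      using a(1) assms by (intro divide_left_mono power_increasing mult_pos_pos) auto
    also have "a\<^sup>2 / a ^ 5 = f \<bar>s\<bar>"
    proof -
      have "a ^ 5 = a\<^sup>2 * a ^ 3"
        by (simp only: power_add[symmetric]) simp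
      then show ?thesis
        using a(1) by (simp only: f_a) (rule nonzero_divide_mult_cancel_left, simp)
    qed
    finally show ?thesis
      by (simp add: mult_left_mono)
  qed
  have "(\<integral>\<^sup>+s. ennreal (norm (wave_decay n s)) \<partial>lborel) \<le>
      (\<integral>\<^sup>+s. ennreal (sqrt 2 ^ (n + 1)) * (ennreal (f s) * indicator {0..} s
        + ennreal (f (0 + (- 1) * s)) * indicator {0..} (0 + (- 1) * s)) \<partial>lborel)"
  proof (rule nn_integral_mono)
    fix s :: real
    have "ennreal (norm (wave_decay n s)) \<le> ennreal (sqrt 2 ^ (n + 1)) * ennreal (f \<bar>s\<bar>)"
      using bound[of s] wave_decay_nonneg[of n s]
      by (simp add: ennreal_mult[symmetric] f_def del: power_Suc)
    also have "ennreal (f \<bar>s\<bar>) \<le> ennreal (f s) * indicator {0..} s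
        + ennreal (f (0 + (- 1) * s)) * indicator {0..} (0 + (- 1) * s)"
      by (cases "s \<ge> 0") (auto split: split_indicator)
    finally show "ennreal (norm (wave_decay n s)) \<le> ennreal (sqrt 2 ^ (n + 1)) * (ennreal (f s) * indicator {0..} s
        + ennreal (f (0 + (- 1) * s)) * indicator {0..} (0 + (- 1) * s))"
      by (simp add: mult_left_mono)
  qed
  also have "\<dots> = ennreal (sqrt 2 ^ (n + 1)) * ((\<integral>\<^sup>+s. ennreal (f s) * indicator {0..} s \<partial>lborel)
     + (\<integral>\<^sup>+s. ennreal (f (0 + (- 1) * s)) * indicator {0..} (0 + (- 1) * s) \<partial>lborel))"
    by (subst nn_integral_cmult, measurable, subst nn_integral_add) auto
  also have "(\<integral>\<^sup>+s. ennreal (f (0 + (- 1) * s)) * indicator {0..} (0 + (- 1) * s) \<partial>lborel)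
      = (\<integral>\<^sup>+s. ennreal (f s) * indicator {0..} s \<partial>lborel)"
    using nn_integral_real_affine[of "\<lambda>s. ennreal (f s) * indicator {0..} s" "- 1" 0] by simp
  also have "ennreal (sqrt 2 ^ (n + 1)) * ((\<integral>\<^sup>+s. ennreal (f s) * indicator {0..} s \<partial>lborel)
     + (\<integral>\<^sup>+s. ennreal (f s) * indicator {0..} s \<partial>lborel)) < \<infinity>"
    unfolding half by (simp add: ennreal_mult_less_top)
  finally show ?thesis
    by (intro integrableI_bounded) auto
qed

text \<open>
  The substitution \<open>t = k s\<close>. The resulting power of \<open>k\<close> is \<open>- 2 b\<close> with \<open>b = (n - 1) / 2\<close>, the scaling
  exponent of the Strichartz estimate.
\<close>

lemma dispersive_kernel_integral:
  fixes k :: real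
  assumes "k > 0" "n \<ge> 4"
  shows "(\<integral>\<^sup>+t. ennreal ((k + \<bar>t\<bar>) / sqrt (k * (k + \<bar>t\<bar>) / 2) ^ (n + 1)) \<partial>lborel)
    = ennreal (integral\<^sup>L lborel (wave_decay n) / k ^ (n - 1))"
proof -
  have scale: "(k + \<bar>0 + k * s\<bar>) / sqrt (k * (k + \<bar>0 + k * s\<bar>) / 2) ^ (n + 1) = wave_decay n s / k ^ n" for s
  proof -
    have sum: "k + \<bar>0 + k * s\<bar> = k * (1 + \<bar>s\<bar>)"
      using assms by (simp add: abs_mult distrib_left)
    have "sqrt (k * (k * (1 + \<bar>s\<bar>)) / 2) = k * sqrt ((1 + \<bar>s\<bar>) / 2)"
    proof -
      have "k * (k * (1 + \<bar>s\<bar>)) / 2 = k\<^sup>2 * ((1 + \<bar>s\<bar>) / 2)"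
        by (simp add: power2_eq_square)
      then show ?thesis
        using assms by (simp only: real_sqrt_mult real_sqrt_abs abs_of_pos)
    qed
    then show ?thesis
      unfolding sum wave_decay_def using assms by (simp add: power_mult_distrib)
  qed
  have "(\<integral>\<^sup>+t. ennreal ((k + \<bar>t\<bar>) / sqrt (k * (k + \<bar>t\<bar>) / 2) ^ (n + 1)) \<partial>lborel)
      = \<bar>k\<bar> * (\<integral>\<^sup>+s. ennreal (wave_decay n s / k ^ n) \<partial>lborel)"
    unfolding scale[symmetric] using assms by (intro nn_integral_real_affine) auto
  also have "(\<integral>\<^sup>+s. ennreal (wave_decay n s / k ^ n) \<partial>lborel) = ennreal (integral\<^sup>L lborel (wave_decay n) / k ^ n)"
    using assms wave_decay_nonneg wave_decay_integrable[OF assms(2)]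
    by (subst nn_integral_eq_integral) auto
  also have "\<bar>k\<bar> * ennreal (integral\<^sup>L lborel (wave_decay n) / k ^ n)
      = ennreal (k * (integral\<^sup>L lborel (wave_decay n) / k ^ n))"
    using assms wave_decay_nonneg by (subst ennreal_mult) (auto intro!: divide_nonneg_nonneg Bochner_Integration.integral_nonneg)
  also have "k * (integral\<^sup>L lborel (wave_decay n) / k ^ n) = integral\<^sup>L lborel (wave_decay n) / k ^ (n - 1)"
    using assms by (simp add: power_eq_if[of k n])
  finally show ?thesis .
qed

text \<open>
  Up to the factor \<open>1 / (2 pi) ^ n\<close>, the half-wave flow at time \<open>t\<close> of data with Fourier transform \<open>g\<close>.
\<close>

definition wave :: "('a::euclidean_space \<Rightarrow> complex) \<Rightarrow> real \<Rightarrow> 'a \<Rightarrow> complex" where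
  "wave g t x = (LINT y|lborel. g y * cis (x \<bullet> y + t * norm y))"

lemma wave_measurable [measurable]:
  fixes g :: "'a::euclidean_space \<Rightarrow> complex"
  assumes [measurable]: "g \<in> borel_measurable borel"
  shows "case_prod (wave g) \<in> borel_measurable (borel \<Otimes>\<^sub>M borel)"
  unfolding wave_def by measurable

definition strichartz_const :: "nat \<Rightarrow> real" where
  "strichartz_const n = poisson_const n * integral\<^sup>L lborel (wave_decay n) * exp 2"

lemma strichartz_const_nonneg: "strichartz_const n \<ge> 0"
  unfolding strichartz_const_def using poisson_const_nonneg wave_decay_nonneg
  by (intro mult_nonneg_nonneg Bochner_Integration.integral_nonneg) auto

text \<open>
  The endpoint Strichartz estimate in linearised form: the supremum over \<open>x\<close> is replaced by the
  value at an arbitrary measurable curve \<open>X\<close>. In the \<open>TT\<^sup>*\<close> argument the weight \<open>exp (- |y| / R)\<close> costs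
  a factor at most \<open>exp 2\<close> on the support of \<open>g\<close>, and makes the composed kernel a Poisson kernel at
  \<open>X t - X s\<close>; the dispersive bound is uniform in that point and integrable in \<open>t - s\<close>.
\<close>

lemma strichartz_along_curve:
  fixes g :: "'a::euclidean_space \<Rightarrow> complex"
  assumes dim: "DIM('a) \<ge> 4" and R: "R > 0"
    and g_int: "integrable lborel g"
    and supp: "\<And>y. g y \<noteq> 0 \<Longrightarrow> norm y \<le> 2 * R"
    and X [measurable]: "X \<in> borel_measurable borel"
  shows "(\<integral>\<^sup>+t. ennreal ((norm (wave g t (X t)))\<^sup>2) \<partial>lborel)
    \<le> ennreal (strichartz_const DIM('a) * R ^ (DIM('a) - 1)) * sq_norm lborel g"
proof -
  let ?n = "DIM('a)"
  \<comment> \<open>The weight then varies by a bounded factor on the ball of radius \<open>2 * R\<close>.\<close>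
  define k where "k = 1 / R"
  have k: "k > 0"
    using R by (simp add: k_def)
  have [measurable]: "g \<in> borel_measurable borel"
    using g_int by auto
  define E where "E = (\<lambda>t (y::'a). cis (X t \<bullet> y + t * norm y))"
  define h where "h = (\<lambda>t. poisson_const ?n * ((k + \<bar>t\<bar>) / sqrt (k * (k + \<bar>t\<bar>) / 2) ^ (?n + 1)))"
  define A where "A = ennreal (poisson_const ?n * (integral\<^sup>L lborel (wave_decay ?n) / k ^ (?n - 1)))"
  have h_meas [measurable]: "h \<in> borel_measurable borel"
    unfolding h_def by measurable
  have h_total: "(\<integral>\<^sup>+t. ennreal (h t) \<partial>lborel) = A"
  proof -
    have "(\<integral>\<^sup>+t. ennreal (h t) \<partial>lborel) = (\<integral>\<^sup>+t. ennreal (poisson_const ?n) *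
        ennreal ((k + \<bar>t\<bar>) / sqrt (k * (k + \<bar>t\<bar>) / 2) ^ (?n + 1)) \<partial>lborel)"
      unfolding h_def by (intro nn_integral_cong ennreal_mult' poisson_const_nonneg)
    also have "\<dots> = ennreal (poisson_const ?n) * ennreal (integral\<^sup>L lborel (wave_decay ?n) / k ^ (?n - 1))"
      by (subst nn_integral_cmult) (measurable, simp only: dispersive_kernel_integral[OF k dim])
    also have "\<dots> = A"
      unfolding A_def by (rule ennreal_mult'[OF poisson_const_nonneg, symmetric])
    finally show ?thesis .
  qed
  have h_shift: "(\<integral>\<^sup>+s. ennreal (h (t - s)) \<partial>lborel) = A" "(\<integral>\<^sup>+s. ennreal (h (s - t)) \<partial>lborel) = A" for t
    using nn_integral_real_affine[of "\<lambda>s. ennreal (h s)" "- 1" t]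
      nn_integral_real_affine[of "\<lambda>s. ennreal (h s)" 1 "- t"] by (simp_all add: h_total)
  have "(\<integral>\<^sup>+t. ennreal ((norm (LINT y|lborel. g y * E t y))\<^sup>2) \<partial>lborel)
      \<le> A * (\<integral>\<^sup>+y. ennreal ((norm (g y))\<^sup>2 / exp (- k * norm y)) \<partial>lborel)"
  proof (rule adjoint_estimate_TT_star[where \<kappa> = "\<lambda>t s. ennreal (h (t - s))"])
    show "case_prod E \<in> borel_measurable (lborel \<Otimes>\<^sub>M lborel)"
      unfolding E_def by measurable
    show "integrable lborel (\<lambda>y::'a. exp (- k * norm y))"
      by (rule integrable_exp_norm[OF k])
    show "ennreal (norm (LINT y|lborel. E t y * cnj (E s y) * complex_of_real (exp (- k * norm y)))) \<le> ennreal (h (t - s))"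
      for t s
    proof (rule ennreal_leI)
      have "E t y * cnj (E s y) = cis ((X t - X s) \<bullet> y + (t - s) * norm y)" for y
        by (simp add: E_def cis_cnj cis_mult algebra_simps)
      then show "norm (LINT y|lborel. E t y * cnj (E s y) * complex_of_real (exp (- k * norm y))) \<le> h (t - s)"
        using poisson_kernel_dispersive_bound[OF k, of "X t - X s" "t - s"] by (simp add: h_def)
    qed
    show "case_prod (\<lambda>t s. ennreal (h (t - s))) \<in> borel_measurable (lborel \<Otimes>\<^sub>M lborel)"
      by measurable
  qed (auto simp: E_def g_int h_shift sigma_finite_lborel)
  also have "\<dots> \<le> A * (\<integral>\<^sup>+y. ennreal (exp 2) * ennreal ((norm (g y))\<^sup>2) \<partial>lborel)"
  proof (intro mult_left_mono nn_integral_mono)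
    fix y
    have "(norm (g y))\<^sup>2 / exp (- k * norm y) = exp (k * norm y) * (norm (g y))\<^sup>2"
      by (simp add: exp_minus field_simps)
    also have "\<dots> \<le> exp 2 * (norm (g y))\<^sup>2"
      using supp[of y] R by (cases "g y = 0") (auto simp: k_def field_simps)
    finally show "ennreal ((norm (g y))\<^sup>2 / exp (- k * norm y)) \<le> ennreal (exp 2) * ennreal ((norm (g y))\<^sup>2)"
      by (simp add: ennreal_mult[symmetric])
  qed auto
  also have "\<dots> = A * ennreal (exp 2) * sq_norm lborel g"
    by (subst nn_integral_cmult) (auto simp: mult.assoc)
  also have "A * ennreal (exp 2) = ennreal (strichartz_const ?n * R ^ (?n - 1))"
    unfolding A_def by (subst ennreal_mult''[symmetric]) (simp_all add: strichartz_const_def k_def power_divide mult_ac)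
  finally show ?thesis
    by (simp add: wave_def E_def)
qed

lemma wave_continuous:
  fixes g :: "'a::euclidean_space \<Rightarrow> complex"
  assumes g_int: "integrable lborel g"
  shows "continuous_on UNIV (wave g t)"
proof (rule continuous_on_sequentiallyI)
  fix X :: "nat \<Rightarrow> 'a" and x
  assume "X \<longlonglongrightarrow> x"
  have [measurable]: "g \<in> borel_measurable borel"
    using g_int by auto
  show "(\<lambda>i. wave g t (X i)) \<longlonglongrightarrow> wave g t x"
    unfolding wave_def
  proof (rule integral_dominated_convergence[where w = "\<lambda>y. norm (g y)"])
    show "AE y in lborel. (\<lambda>i. g y * cis (X i \<bullet> y + t * norm y)) \<longlonglongrightarrow> g y * cis (x \<bullet> y + t * norm y)"
      by (intro AE_I2 tendsto_intros \<open>X \<longlonglongrightarrow> x\<close>)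
  qed (use g_int in \<open>auto simp: norm_mult\<close>)
qed

text \<open>
  A measurable choice, among finitely many points, of one where \<open>f t\<close> is largest.
\<close>

primrec running_argmax :: "('t \<Rightarrow> 'a \<Rightarrow> real) \<Rightarrow> (nat \<Rightarrow> 'a) \<Rightarrow> nat \<Rightarrow> 't \<Rightarrow> 'a" where
  "running_argmax f d 0 = (\<lambda>t. d 0)"
| "running_argmax f d (Suc k) = (\<lambda>t. if f t (running_argmax f d k t) < f t (d (Suc k))
     then d (Suc k) else running_argmax f d k t)"

lemma running_argmax_measurable:
  fixes f :: "real \<Rightarrow> 'a::euclidean_space \<Rightarrow> real"
  assumes [measurable]: "case_prod f \<in> borel_measurable (borel \<Otimes>\<^sub>M borel)"
  shows "running_argmax f d k \<in> borel_measurable borel"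
proof (induction k)
  case (Suc k)
  then have [measurable]: "running_argmax f d k \<in> borel_measurable borel" .
  show ?case
    unfolding running_argmax.simps by measurable
qed simp

lemma running_argmax_mono: "f t (running_argmax f d k t) \<le> f t (running_argmax f d (Suc k) t)"
  by auto

lemma running_argmax_ge: "j \<le> k \<Longrightarrow> f t (d j) \<le> f t (running_argmax f d k t)"
proof (induction k)
  case (Suc k)
  then show ?case
    by (cases "j = Suc k") (auto simp: le_Suc_eq)
qed simp

text \<open>
  By continuity in \<open>x\<close> the supremum may be taken over a countable dense set, and it is the increasing
  limit of the values along the curves that follow the largest of the first \<open>k\<close> points.
\<close>

lemma strichartz_maximal_function:
  fixes g :: "'a::euclidean_space \<Rightarrow> complex"
  assumes dim: "DIM('a) \<ge> 4" and R: "R > 0"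
    and g_int: "integrable lborel g"
    and supp: "\<And>y. g y \<noteq> 0 \<Longrightarrow> norm y \<le> 2 * R"
  obtains U :: "real \<Rightarrow> ennreal" where "U \<in> borel_measurable borel"
    "\<And>t x. ennreal (norm (wave g t x)) \<le> U t"
    "(\<integral>\<^sup>+t. (U t)\<^sup>2 \<partial>lborel)
      \<le> ennreal (strichartz_const DIM('a) * R ^ (DIM('a) - 1)) * sq_norm lborel g"
proof -
  obtain D :: "'a set" where D: "countable D" "\<And>X. open X \<Longrightarrow> X \<noteq> {} \<Longrightarrow> \<exists>d\<in>D. d \<in> X"
    using countable_dense_exists by blast
  have "D \<noteq> {}"
    using D(2)[of UNIV] by auto
  define d where "d = from_nat_into D"
  have d_range: "range d = D"
    unfolding d_def using D(1) \<open>D \<noteq> {}\<close> by (rule range_from_nat_into[rotated])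
  define f where "f = (\<lambda>t x. norm (wave g t x))"
  have [measurable]: "g \<in> borel_measurable borel"
    using g_int by auto
  have f_meas [measurable]: "case_prod f \<in> borel_measurable (borel \<Otimes>\<^sub>M borel)"
    unfolding f_def by measurable
  define X where "X = running_argmax f d"
  have X_meas [measurable]: "X k \<in> borel_measurable borel" for k
    unfolding X_def by (rule running_argmax_measurable[OF f_meas])
  define U where "U = (\<lambda>t. SUP k. ennreal (f t (X k t)))"
  show thesis
  proof (rule that[of U])
    show "U \<in> borel_measurable borel"
      unfolding U_def by measurable
    show "ennreal (norm (wave g t x)) \<le> U t" for t x
    proof (rule ccontr)
      assume "\<not> ennreal (norm (wave g t x)) \<le> U t"
      then have less: "U t < ennreal (f t x)"
        by (simp add: f_def)
      then obtain s where s: "U t = ennreal s" "s \<ge> 0"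
        by (cases "U t") (auto simp: top_unique)
      have "open {x. s < f t x}"
        unfolding f_def by (intro open_Collect_less continuous_intros wave_continuous g_int)
      moreover have "x \<in> {x. s < f t x}"
        using less s by (simp add: ennreal_less_iff)
      ultimately obtain j where "s < f t (d j)"
        using D(2) d_range by blast
      also have "f t (d j) \<le> f t (X j t)"
        unfolding X_def by (rule running_argmax_ge) simp
      finally have "ennreal s < ennreal (f t (X j t))"
        using s by (simp add: ennreal_less_iff)
      moreover have "ennreal (f t (X j t)) \<le> U t"
        unfolding U_def by (rule SUP_upper) simp
      ultimately show False
        by (metis leD s(1))
    qed
    have "(\<integral>\<^sup>+t. (U t)\<^sup>2 \<partial>lborel) = (\<integral>\<^sup>+t. (SUP k. ennreal ((f t (X k t))\<^sup>2)) \<partial>lborel)"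
    proof (rule nn_integral_cong)
      fix t
      have "(U t)\<^sup>2 = (SUP k. (ennreal (f t (X k t)))\<^sup>2)"
      proof (rule antisym)
        let ?F = "\<lambda>k. ennreal (f t (X k t))"
        have inc: "incseq ?F"
          unfolding X_def by (intro incseq_SucI ennreal_leI running_argmax_mono)
        have "?F i * ?F j \<le> (SUP k. (?F k)\<^sup>2)" for i j
        proof -
          have "?F i * ?F j \<le> ?F (max i j) * ?F (max i j)"
            using inc by (intro mult_mono) (auto simp: incseq_def)
          also have "\<dots> \<le> (SUP k. (?F k)\<^sup>2)"
            unfolding power2_eq_square by (rule SUP_upper) simp
          finally show ?thesis .
        qed
        then have "(SUP i. SUP j. ?F j * ?F i) \<le> (SUP k. (?F k)\<^sup>2)"
          by (intro SUP_least)
        then show "(U t)\<^sup>2 \<le> (SUP k. (?F k)\<^sup>2)"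
          by (simp add: U_def power2_eq_square SUP_mult_left_ennreal SUP_mult_right_ennreal)
        show "(SUP k. (?F k)\<^sup>2) \<le> (U t)\<^sup>2"
          unfolding U_def by (intro SUP_least power_mono SUP_upper) auto
      qed
      then show "(U t)\<^sup>2 = (SUP k. ennreal ((f t (X k t))\<^sup>2))"
        by (simp add: ennreal_power f_def)
    qed
    also have "\<dots> = (SUP k. \<integral>\<^sup>+t. ennreal ((f t (X k t))\<^sup>2) \<partial>lborel)"
    proof (rule nn_integral_monotone_convergence_SUP)
      show "incseq (\<lambda>k t. ennreal ((f t (X k t))\<^sup>2))"
        unfolding X_def by (intro incseq_SucI le_funI ennreal_leI power_mono running_argmax_mono) (simp add: f_def)
    qed measurable
    also have "\<dots> \<le> ennreal (strichartz_const DIM('a) * R ^ (DIM('a) - 1)) * sq_norm lborel g"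
      unfolding f_def by (intro SUP_least strichartz_along_curve dim R g_int supp X_meas)
    finally show "(\<integral>\<^sup>+t. (U t)\<^sup>2 \<partial>lborel)
      \<le> ennreal (strichartz_const DIM('a) * R ^ (DIM('a) - 1)) * sq_norm lborel g" .
  qed
qed

section \<open>Summation over dyadic frequency shells\<close>

text \<open>
  The integer powers of two, enumerated by the natural numbers so that ordinary series apply.
\<close>

definition dyadic :: "nat \<Rightarrow> real" where
  "dyadic j = 2 powr real_of_int (int_decode j)"

lemma dyadic_pos: "dyadic j > 0"
  by (simp add: dyadic_def)

definition dyadic_shell :: "real \<Rightarrow> nat \<Rightarrow> 'a::euclidean_space set" where
  "dyadic_shell R j = {y. R * dyadic j \<le> norm y \<and> norm y < 2 * (R * dyadic j)}"

lemma dyadic_shell_measurable [measurable]: "dyadic_shell R j \<in> sets borel"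
  unfolding dyadic_shell_def by measurable

lemma dyadic_shell_iff:
  fixes y :: "'a::euclidean_space"
  assumes "R > 0" "y \<noteq> 0"
  shows "y \<in> dyadic_shell R j \<longleftrightarrow> int_decode j = \<lfloor>log 2 (norm y / R)\<rfloor>"
proof -
  define w where "w = norm y / R"
  have w: "w > 0" "norm y = R * w"
    using assms by (auto simp: w_def)
  have "y \<in> dyadic_shell R j \<longleftrightarrow> dyadic j \<le> w \<and> w < 2 * dyadic j"
    using assms(1) by (simp add: dyadic_shell_def w(2) mult.left_commute[of 2])
  also have "2 * dyadic j = 2 powr (real_of_int (int_decode j) + 1)"
    by (simp add: dyadic_def powr_add)
  also have "dyadic j \<le> w \<longleftrightarrow> real_of_int (int_decode j) \<le> log 2 w"
    using w by (simp add: dyadic_def le_log_iff)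
  also have "w < 2 powr (real_of_int (int_decode j) + 1) \<longleftrightarrow> log 2 w < real_of_int (int_decode j) + 1"
    using w by (simp add: log_less_iff)
  finally show ?thesis
    unfolding w_def[symmetric] by (simp add: floor_eq_iff eq_commute[of "int_decode j"] )
qed

lemma dyadic_shell_disjoint:
  assumes "R > 0"
  shows "disjoint_family (dyadic_shell R :: nat \<Rightarrow> 'a::euclidean_space set)"
  unfolding disjoint_family_on_def
proof (intro ballI impI)
  have "y \<noteq> 0" if "y \<in> dyadic_shell R j" for y :: 'a and j
    using that assms dyadic_pos[of j] by (auto simp: dyadic_shell_def mult_le_0_iff)
  then show "dyadic_shell R i \<inter> (dyadic_shell R j :: 'a set) = {}" if "i \<noteq> j" for i j
    using that dyadic_shell_iff[OF assms] by (metis (no_types, lifting) disjoint_iff int_decode_eq)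
qed

lemma dyadic_shell_cover:
  fixes y :: "'a::euclidean_space"
  assumes "R > 0" "y \<noteq> 0"
  shows "\<exists>j. y \<in> dyadic_shell R j"
  using dyadic_shell_iff[OF assms] surj_int_decode by (metis surjD)

text \<open>
  Chosen so that \<open>1 / dyadic_weight e d j\<close> turns the Strichartz factor \<open>r ^ (n - 1)\<close> of the shell of radius
  \<open>r = R * dyadic j\<close> into exactly \<open>R powr (2 e) * r powr (2 (b - e)) + R powr (- 2 d) * r powr (2 (b + d))\<close>.
\<close>

definition dyadic_weight :: "real \<Rightarrow> real \<Rightarrow> nat \<Rightarrow> real" where
  "dyadic_weight e d j = 1 / (dyadic j powr (- 2 * e) + dyadic j powr (2 * d))"

lemma dyadic_weight_pos: "dyadic_weight e d j > 0"
  using dyadic_pos[of j] by (simp add: dyadic_weight_def add_pos_pos)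

text \<open>
  The weight decays geometrically in both directions, at rate \<open>2 powr (- 2 min e d)\<close> per scale; the
  enumeration visits the integer \<open>i\<close> at an index of size about \<open>2 |i|\<close>.
\<close>

lemma dyadic_weight_summable:
  assumes "e > 0" "d > 0"
  shows "summable (dyadic_weight e d)"
proof -
  define m where "m = min e d"
  have m: "m > 0" "m \<le> e" "m \<le> d"
    using assms by (auto simp: m_def)
  have "dyadic_weight e d j \<le> (2 powr (- m)) ^ j" for j
  proof -
    define i where "i = int_decode j"
    have j: "j = int_encode i"
      by (simp add: i_def)
    have "2 powr (m * j) \<le> dyadic j powr (- 2 * e) + dyadic j powr (2 * d)"
    proof (cases "i \<ge> 0")
      case True
      then have "real j = 2 * real_of_int i"
        unfolding j by (simp add: int_encode_def sum_encode_def)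
      then have "m * j \<le> real_of_int i * (2 * d)"
        using m True by (simp add: mult_mono mult.commute)
      then have "2 powr (m * j) \<le> dyadic j powr (2 * d)"
        unfolding dyadic_def i_def[symmetric] powr_powr by simp
      then show ?thesis
        by (rule order_trans) simp
    next
      case False
      then have "real j = - 2 * real_of_int i - 1"
        unfolding j by (simp add: int_encode_def sum_encode_def)
      then have "m * j \<le> m * (- 2 * real_of_int i)"
        using m by (intro mult_left_mono) auto
      also have "\<dots> \<le> e * (- 2 * real_of_int i)"
        using m False by (intro mult_right_mono) auto
      finally have "2 powr (m * j) \<le> dyadic j powr (- 2 * e)"
        unfolding dyadic_def i_def[symmetric] powr_powr by (simp add: mult_ac)
      then show ?thesis
        by (rule order_trans) simp
    qed
    then have "dyadic_weight e d j \<le> 1 / 2 powr (m * j)"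
      unfolding dyadic_weight_def using dyadic_pos[of j] by (intro divide_left_mono mult_pos_pos) (auto simp: add_pos_pos)
    also have "\<dots> = (2 powr (- m)) ^ j"
    proof -
      have "(2 powr (- m)) ^ j = (2 :: real) powr (- (m * j))"
        by (subst powr_realpow[symmetric]) (simp_all only: powr_powr, simp_all)
      then show ?thesis
        by (simp only: powr_minus_divide)
    qed
    finally show ?thesis .
  qed
  moreover have "summable (\<lambda>j. (2 powr (- m)) ^ j)"
    using m powr_less_mono[of "- m" 0 2] by (intro summable_geometric) simp
  ultimately show ?thesis
    using less_imp_le[OF dyadic_weight_pos]
    by - (rule summable_comparison_test'[of "\<lambda>j. (2 powr (- m)) ^ j" 0], auto)
qed

text \<open>
  Cauchy-Schwarz; it takes the place of Minkowski's inequality in summing the dyadic pieces.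
\<close>

lemma weighted_suminf_square_le:
  fixes U :: "nat \<Rightarrow> ennreal" and c :: "nat \<Rightarrow> real"
  assumes "\<And>j. c j > 0" "summable c"
  shows "(\<Sum>j. U j)\<^sup>2 \<le> ennreal (\<Sum>j. c j) * (\<Sum>j. ennreal (1 / c j) * (U j)\<^sup>2)"
proof -
  have split: "ennreal (sqrt (c j)) * (ennreal (1 / sqrt (c j)) * U j) = U j" for j
    using assms(1)[of j] by (simp add: mult.assoc[symmetric] ennreal_mult[symmetric])
  have "(\<Sum>j. U j)\<^sup>2 = (\<integral>\<^sup>+j. ennreal (sqrt (c j)) * (ennreal (1 / sqrt (c j)) * U j) \<partial>count_space UNIV)\<^sup>2"
    unfolding split nn_integral_count_space_nat ..
  also have "\<dots> \<le> (\<integral>\<^sup>+j. (ennreal (sqrt (c j)))\<^sup>2 \<partial>count_space UNIV) *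
      (\<integral>\<^sup>+j. (ennreal (1 / sqrt (c j)) * U j)\<^sup>2 \<partial>count_space UNIV)"
    by (rule Cauchy_Schwarz_nn_integral) auto
  also have "(\<integral>\<^sup>+j. (ennreal (sqrt (c j)))\<^sup>2 \<partial>count_space UNIV) = ennreal (\<Sum>j. c j)"
    using assms less_imp_le[OF assms(1)] by (simp add: nn_integral_count_space_nat ennreal_power suminf_ennreal2)
  also have "(\<integral>\<^sup>+j. (ennreal (1 / sqrt (c j)) * U j)\<^sup>2 \<partial>count_space UNIV) = (\<Sum>j. ennreal (1 / c j) * (U j)\<^sup>2)"
    using less_imp_le[OF assms(1)]
    by (simp add: nn_integral_count_space_nat power_mult_distrib ennreal_power power_divide)
  finally show ?thesis .
qed

definition dyadic_piece :: "real \<Rightarrow> ('a::euclidean_space \<Rightarrow> complex) \<Rightarrow> nat \<Rightarrow> 'a \<Rightarrow> complex" where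
  "dyadic_piece R G j y = indicator (dyadic_shell R j) y * G y"

text \<open>
  Up to a constant factor, the square of the homogeneous Sobolev norm of order \<open>s\<close>, in terms of the
  Fourier transform \<open>G\<close>.
\<close>

definition weighted_energy :: "real \<Rightarrow> ('a::euclidean_space \<Rightarrow> complex) \<Rightarrow> ennreal" where
  "weighted_energy s G = (\<integral>\<^sup>+y. ennreal ((norm y powr s * norm (G y))\<^sup>2) \<partial>lborel)"

lemma dyadic_piece_measurable [measurable]:
  "G \<in> borel_measurable borel \<Longrightarrow> dyadic_piece R G j \<in> borel_measurable borel"
  unfolding dyadic_piece_def by measurable

lemma dyadic_piece_bounds:
  assumes "dyadic_piece R G j y \<noteq> 0"
  shows "R * dyadic j \<le> norm y" "norm y \<le> 2 * (R * dyadic j)" "dyadic_piece R G j y = G y"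
  using assms by (auto simp: dyadic_piece_def dyadic_shell_def split: split_indicator_asm)

text \<open>
  On a shell the weight \<open>|y| powr s\<close> is bounded below, so the piece is square integrable with bounded
  support.
\<close>

lemma dyadic_piece_integrable:
  fixes G :: "'a::euclidean_space \<Rightarrow> complex"
  assumes [measurable]: "G \<in> borel_measurable borel" and R: "R > 0"
    and fin: "weighted_energy s G < \<infinity>"
  shows "integrable lborel (dyadic_piece R G j)"
proof (rule integrableI_bounded)
  define r where "r = R * dyadic j"
  have r: "r > 0"
    using R dyadic_pos by (simp add: r_def)
  define m where "m = min (r powr s) ((2 * r) powr s)"
  have m: "m > 0"
    using r by (simp add: m_def)
  have m_le: "m \<le> norm y powr s" if "r \<le> norm y" "norm y \<le> 2 * r" for y :: 'a
  proof (cases "s \<ge> 0")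
    case True
    then have "r powr s \<le> norm y powr s"
      using that r by (intro powr_mono2) auto
    then show ?thesis
      by (simp add: m_def)
  next
    case False
    then have "(2 * r) powr s \<le> norm y powr s"
      using that r by (intro powr_mono2') auto
    then show ?thesis
      by (simp add: m_def)
  qed
  have "(\<integral>\<^sup>+y. ennreal (norm (dyadic_piece R G j y)) \<partial>lborel) \<le>
      (\<integral>\<^sup>+y. indicator (cball 0 (2 * r)) y + ennreal (1 / m\<^sup>2) * ennreal ((norm y powr s * norm (G y))\<^sup>2) \<partial>lborel)"
  proof (rule nn_integral_mono)
    fix y :: 'a
    show "ennreal (norm (dyadic_piece R G j y)) \<le>
        indicator (cball 0 (2 * r)) y + ennreal (1 / m\<^sup>2) * ennreal ((norm y powr s * norm (G y))\<^sup>2)"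
    proof (cases "dyadic_piece R G j y = 0")
      case False
      note y = dyadic_piece_bounds[OF False, folded r_def]
      have "m * norm (G y) \<le> norm y powr s * norm (G y)"
        using m_le[OF y(1,2)] by (intro mult_right_mono) auto
      then have "(m * norm (G y))\<^sup>2 \<le> (norm y powr s * norm (G y))\<^sup>2"
        using m by (intro power_mono) auto
      then have "(norm (G y))\<^sup>2 \<le> 1 / m\<^sup>2 * (norm y powr s * norm (G y))\<^sup>2"
        using m by (simp add: power_mult_distrib field_simps)
      moreover have "norm (G y) \<le> 1 + (norm (G y))\<^sup>2"
        using sum_squares_bound[of 1 "norm (G y)"] zero_le_power2[of "norm (G y)"]
        unfolding mult_1_right power_one by linarith
      ultimately have "ennreal (norm (G y)) \<le> ennreal (1 + 1 / m\<^sup>2 * (norm y powr s * norm (G y))\<^sup>2)"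
        by (intro ennreal_leI) linarith
      also have "\<dots> = 1 + ennreal (1 / m\<^sup>2) * ennreal ((norm y powr s * norm (G y))\<^sup>2)"
        by (subst ennreal_plus) (auto simp: ennreal_mult[symmetric])
      finally show ?thesis
        using y by simp
    qed simp
  qed
  also have "\<dots> = emeasure lborel (cball (0::'a) (2 * r)) + ennreal (1 / m\<^sup>2) * weighted_energy s G"
    by (subst nn_integral_add) (auto simp: nn_integral_cmult weighted_energy_def intro!: borel_measurable_indicator)
  also have "\<dots> < \<infinity>"
    using fin emeasure_lborel_cball_finite[of "0::'a" "2 * r"] by (simp add: ennreal_mult_less_top)
  finally show "(\<integral>\<^sup>+y. ennreal (norm (dyadic_piece R G j y)) \<partial>lborel) < \<infinity>" .
qed measurable

text \<open>
  The Strichartz estimate on each shell, summed with the weights \<open>dyadic_weight\<close>. The bound also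
  shows that \<open>\<Sum>j. U j t\<close> is finite for almost every \<open>t\<close>, which is how the flow is known to be a bounded
  function of \<open>x\<close>: for small \<open>d\<close> its Fourier transform need not be integrable.
\<close>

lemma dyadic_strichartz:
  fixes G :: "'a::euclidean_space \<Rightarrow> complex"
  assumes dim: "DIM('a) \<ge> 4" and R: "R > 0" and e: "e > 0" and d: "d > 0"
    and b: "b = (real DIM('a) - 1) / 2" and e_le: "e \<le> b"
    and G [measurable]: "G \<in> borel_measurable borel"
    and fin: "weighted_energy (b - e) G < \<infinity>"
  obtains U :: "nat \<Rightarrow> real \<Rightarrow> ennreal" where "\<And>j. U j \<in> borel_measurable borel"
    "\<And>j t x. ennreal (norm (wave (dyadic_piece R G j) t x)) \<le> U j t"
    "(\<integral>\<^sup>+t. (\<Sum>j. U j t)\<^sup>2 \<partial>lborel) \<le> ennreal ((\<Sum>j. dyadic_weight e d j) * strichartz_const DIM('a)) *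
       (ennreal (R powr (2 * e)) * weighted_energy (b - e) G
        + ennreal (R powr (- 2 * d)) * weighted_energy (b + d) G)"
proof -
  define r where "r = (\<lambda>j. R * dyadic j)"
  have r: "r j > 0" for j
    using R dyadic_pos by (simp add: r_def)
  define C where "C = strichartz_const DIM('a)"
  have C: "C \<ge> 0"
    unfolding C_def by (rule strichartz_const_nonneg)
  have "\<exists>U. U \<in> borel_measurable borel \<and> (\<forall>t x. ennreal (norm (wave (dyadic_piece R G j) t x)) \<le> U t) \<and>
      (\<integral>\<^sup>+t. (U t)\<^sup>2 \<partial>lborel) \<le> ennreal (C * r j ^ (DIM('a) - 1)) *
         sq_norm lborel (dyadic_piece R G j)" for j
    unfolding C_def
    by (rule strichartz_maximal_function[OF dim r[of j] dyadic_piece_integrable[OF G R fin, of j]])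
      (auto dest: dyadic_piece_bounds(2) simp: r_def)
  then obtain U where U [measurable]: "\<And>j. U j \<in> borel_measurable borel"
    and U_ge: "\<And>j t x. ennreal (norm (wave (dyadic_piece R G j) t x)) \<le> U j t"
    and U_int: "\<And>j. (\<integral>\<^sup>+t. (U j t)\<^sup>2 \<partial>lborel) \<le> ennreal (C * r j ^ (DIM('a) - 1)) *
         sq_norm lborel (dyadic_piece R G j)"
    by metis
  let ?c = "dyadic_weight e d"
  define H where "H = (\<lambda>y::'a. R powr (2 * e) * (norm y powr (b - e) * norm (G y))\<^sup>2
      + R powr (- 2 * d) * (norm y powr (b + d) * norm (G y))\<^sup>2)"
  have H_nonneg: "H y \<ge> 0" for y
    by (simp add: H_def)
  have [measurable]: "H \<in> borel_measurable borel"
    unfolding H_def by measurable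
  have piece: "1 / ?c j * (C * r j ^ (DIM('a) - 1)) * (norm (dyadic_piece R G j y))\<^sup>2
      \<le> C * (indicator (dyadic_shell R j) y * H y)" for j y
  proof (cases "y \<in> dyadic_shell R j")
    case True
    have le: "r j \<le> norm y"
      using True by (simp add: dyadic_shell_def r_def)
    have mono: "r j powr (2 * s) \<le> (norm y powr s)\<^sup>2" if "s \<ge> 0" for s
    proof -
      have "r j powr (2 * s) = (r j powr s)\<^sup>2"
        using r[of j] by (simp add: power2_eq_square powr_add[symmetric])
      also have "\<dots> \<le> (norm y powr s)\<^sup>2"
        using le r[of j] that by (intro power_mono powr_mono2) auto
      finally show ?thesis .
    qed
    have quotient: "(r j / R) powr a = r j powr a * R powr (- a)" for a
      using r[of j] R by (simp add: powr_divide powr_minus_divide)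
    have "r j ^ (DIM('a) - 1) = r j powr (2 * b)"
    proof -
      have "2 * b = real (DIM('a) - 1)"
        using dim by (simp add: b of_nat_diff)
      then show ?thesis
        using r[of j] by (simp only: powr_realpow)
    qed
    moreover have "dyadic j = r j / R"
      using R by (simp add: r_def)
    ultimately have "1 / ?c j * r j ^ (DIM('a) - 1)
        = (r j / R) powr (- 2 * e) * r j powr (2 * b) + (r j / R) powr (2 * d) * r j powr (2 * b)"
      by (simp add: dyadic_weight_def distrib_right)
    also have "(r j / R) powr (- 2 * e) * r j powr (2 * b) = R powr (2 * e) * r j powr (2 * (b - e))"
    proof -
      have "r j powr (2 * (b - e)) = r j powr (- 2 * e) * r j powr (2 * b)"
        unfolding powr_add[symmetric] by (simp add: algebra_simps)
      then show ?thesis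
        by (simp add: quotient)
    qed
    also have "(r j / R) powr (2 * d) * r j powr (2 * b) = R powr (- 2 * d) * r j powr (2 * (b + d))"
    proof -
      have "r j powr (2 * (b + d)) = r j powr (2 * d) * r j powr (2 * b)"
        unfolding powr_add[symmetric] by (simp add: algebra_simps)
      then show ?thesis
        by (simp add: quotient)
    qed
    also have "R powr (2 * e) * r j powr (2 * (b - e)) + R powr (- 2 * d) * r j powr (2 * (b + d))
       \<le> R powr (2 * e) * (norm y powr (b - e))\<^sup>2 + R powr (- 2 * d) * (norm y powr (b + d))\<^sup>2"
      using e d e_le by (intro add_mono mult_left_mono mono) auto
    finally have "1 / ?c j * r j ^ (DIM('a) - 1) * (norm (G y))\<^sup>2 \<le>
        (R powr (2 * e) * (norm y powr (b - e))\<^sup>2 + R powr (- 2 * d) * (norm y powr (b + d))\<^sup>2) * (norm (G y))\<^sup>2"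
      by (rule mult_right_mono) simp
    also have "\<dots> = H y"
      by (simp add: H_def power_mult_distrib distrib_right mult.assoc)
    finally have "C * (1 / ?c j * r j ^ (DIM('a) - 1) * (norm (G y))\<^sup>2) \<le> C * H y"
      using C by (rule mult_left_mono)
    then show ?thesis
      using True by (simp add: dyadic_piece_def mult_ac)
  next
    case False
    then show ?thesis
      by (simp add: dyadic_piece_def)
  qed
  have "(\<integral>\<^sup>+t. (\<Sum>j. U j t)\<^sup>2 \<partial>lborel) \<le> (\<integral>\<^sup>+t. ennreal (\<Sum>j. ?c j) * (\<Sum>j. ennreal (1 / ?c j) * (U j t)\<^sup>2) \<partial>lborel)"
    by (intro nn_integral_mono weighted_suminf_square_le dyadic_weight_pos dyadic_weight_summable e d)
  also have "\<dots> = ennreal (\<Sum>j. ?c j) * (\<Sum>j. ennreal (1 / ?c j) * (\<integral>\<^sup>+t. (U j t)\<^sup>2 \<partial>lborel))"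
    by (simp add: nn_integral_cmult nn_integral_suminf)
  also have "\<dots> \<le> ennreal (\<Sum>j. ?c j) * (\<Sum>j. \<integral>\<^sup>+y. ennreal (C * (indicator (dyadic_shell R j) y * H y)) \<partial>lborel)"
  proof (intro mult_left_mono suminf_le)
    fix j
    have "ennreal (1 / ?c j) * (\<integral>\<^sup>+t. (U j t)\<^sup>2 \<partial>lborel) \<le> ennreal (1 / ?c j) *
        (ennreal (C * r j ^ (DIM('a) - 1)) * sq_norm lborel (dyadic_piece R G j))"
      by (intro mult_left_mono U_int) simp
    also have "\<dots> = (\<integral>\<^sup>+y. ennreal (1 / ?c j) * (ennreal (C * r j ^ (DIM('a) - 1)) * ennreal ((norm (dyadic_piece R G j y))\<^sup>2)) \<partial>lborel)"
      by (subst nn_integral_cmult, measurable, subst nn_integral_cmult, measurable)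
    also have "\<dots> = (\<integral>\<^sup>+y. ennreal (1 / ?c j * (C * r j ^ (DIM('a) - 1)) * (norm (dyadic_piece R G j y))\<^sup>2) \<partial>lborel)"
      using C r[of j] dyadic_weight_pos[of e d j]
      by (intro nn_integral_cong) (simp only: ennreal_mult mult.assoc mult_nonneg_nonneg zero_le_power zero_le_power2 less_imp_le zero_le_divide_1_iff norm_ge_zero)
    also have "\<dots> \<le> (\<integral>\<^sup>+y. ennreal (C * (indicator (dyadic_shell R j) y * H y)) \<partial>lborel)"
      by (intro nn_integral_mono ennreal_leI piece)
    finally show "ennreal (1 / ?c j) * (\<integral>\<^sup>+t. (U j t)\<^sup>2 \<partial>lborel)
        \<le> (\<integral>\<^sup>+y. ennreal (C * (indicator (dyadic_shell R j) y * H y)) \<partial>lborel)" .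
  qed auto
  also have "(\<Sum>j. \<integral>\<^sup>+y. ennreal (C * (indicator (dyadic_shell R j) y * H y)) \<partial>lborel)
      = (\<integral>\<^sup>+y. (\<Sum>j. ennreal (C * (indicator (dyadic_shell R j) y * H y))) \<partial>lborel)"
    by (rule nn_integral_suminf[symmetric]) measurable
  also have "\<dots> \<le> (\<integral>\<^sup>+y. ennreal C * ennreal (H y) \<partial>lborel)"
  proof (rule nn_integral_mono)
    fix y :: 'a
    have "(\<Sum>j. ennreal (C * (indicator (dyadic_shell R j) y * H y)))
        = (\<Sum>j. ennreal (C * H y) * indicator (dyadic_shell R j) y)"
      by (intro suminf_cong) (auto split: split_indicator)
    also have "\<dots> = ennreal (C * H y) * (\<Sum>j. indicator (dyadic_shell R j) y)"
      by (rule ennreal_suminf_cmult)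
    also have "(\<Sum>j. indicator (dyadic_shell R j) y :: ennreal) = indicator (\<Union>j. dyadic_shell R j) y"
      by (rule suminf_indicator[OF dyadic_shell_disjoint[OF R]])
    also have "ennreal (C * H y) * indicator (\<Union>j. dyadic_shell R j) y \<le> ennreal C * ennreal (H y)"
      using C H_nonneg[of y] by (auto simp: ennreal_mult split: split_indicator)
    finally show "(\<Sum>j. ennreal (C * (indicator (dyadic_shell R j) y * H y))) \<le> ennreal C * ennreal (H y)" .
  qed
  also have "\<dots> = ennreal C * (\<integral>\<^sup>+y. ennreal (H y) \<partial>lborel)"
    by (rule nn_integral_cmult) measurable
  also have "(\<integral>\<^sup>+y. ennreal (H y) \<partial>lborel) = ennreal (R powr (2 * e)) * weighted_energy (b - e) G
      + ennreal (R powr (- 2 * d)) * weighted_energy (b + d) G"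
    unfolding H_def weighted_energy_def
    by (simp add: ennreal_mult nn_integral_add nn_integral_cmult)
  finally have "(\<integral>\<^sup>+t. (\<Sum>j. U j t)\<^sup>2 \<partial>lborel) \<le> ennreal (\<Sum>j. ?c j) * (ennreal C *
      (ennreal (R powr (2 * e)) * weighted_energy (b - e) G
        + ennreal (R powr (- 2 * d)) * weighted_energy (b + d) G))"
    by (simp add: mult_left_mono)
  also have "\<dots> = ennreal ((\<Sum>j. ?c j) * C) * (ennreal (R powr (2 * e)) * weighted_energy (b - e) G
        + ennreal (R powr (- 2 * d)) * weighted_energy (b + d) G)"
    using C by (simp add: ennreal_mult'' mult.assoc)
  finally show thesis
    unfolding C_def by (intro that[OF U U_ge])
qed

section \<open>A class of Schwartz functions\<close>

definition bounded_support :: "(real ^ 'n::finite \<Rightarrow> complex) \<Rightarrow> bool" where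
  "bounded_support s \<longleftrightarrow> s \<in> borel_measurable borel \<and>
     (\<exists>B. \<forall>y. norm (s y) \<le> B) \<and> (\<exists>r. \<forall>y. s y \<noteq> 0 \<longrightarrow> norm y \<le> r)"

lemma bounded_support_integrable:
  fixes s p :: "real ^ 'n::finite \<Rightarrow> complex"
  assumes "bounded_support s" and [measurable]: "p \<in> borel_measurable borel"
    and "\<And>r. \<exists>B. \<forall>y. norm y \<le> r \<longrightarrow> norm (p y) \<le> B"
  shows "integrable lborel (\<lambda>y. p y * s y)"
proof -
  from assms(1) obtain B r where [measurable]: "s \<in> borel_measurable borel"
    and B: "\<And>y. norm (s y) \<le> B" and r: "\<And>y. s y \<noteq> 0 \<Longrightarrow> norm y \<le> r"
    unfolding bounded_support_def by blast
  from assms(3) obtain B' where B': "\<And>y. norm y \<le> r \<Longrightarrow> norm (p y) \<le> B'"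
    by blast
  show ?thesis
  proof (rule Bochner_Integration.integrable_bound)
    show "integrable lborel (\<lambda>y :: real ^ 'n. indicator (cball 0 r) y * (B' * B))"
      using emeasure_lborel_cball_finite[of "0 :: real ^ 'n" r]
      by (intro integrable_mult_left) (auto simp: integrable_indicator_iff)
    show "AE y in lborel. norm (p y * s y) \<le> norm (indicator (cball 0 r) y * (B' * B))"
    proof (rule AE_I2)
      fix y
      show "norm (p y * s y) \<le> norm (indicator (cball 0 r) y * (B' * B))"
      proof (cases "s y = 0")
        case False
        with r have y: "norm y \<le> r"
          by blast
        have "norm (p y) * norm (s y) \<le> B' * B"
          using B[of y] B'[OF y] by (intro mult_mono) (auto intro: order_trans[OF norm_ge_zero])
        then show ?thesis
          using y by (simp add: norm_mult)
      qed simp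
    qed
  qed measurable
qed

lemma bounded_support_imp_integrable: "bounded_support s \<Longrightarrow> integrable lborel s"
  using bounded_support_integrable[of s "\<lambda>_. 1"] by (auto intro: exI[of _ 1])

lemma bounded_support_coordinate:
  assumes "bounded_support s"
  shows "bounded_support (\<lambda>y. - \<i> * complex_of_real (y $ i) * s y)"
proof -
  from assms obtain B r where [measurable]: "s \<in> borel_measurable borel"
    and B: "\<And>y. norm (s y) \<le> B" and r: "\<And>y. s y \<noteq> 0 \<Longrightarrow> norm y \<le> r"
    unfolding bounded_support_def by blast
  have "norm (- \<i> * complex_of_real (y $ i) * s y) \<le> \<bar>r\<bar> * B" for y
  proof (cases "s y = 0")
    case False
    then have "\<bar>y $ i\<bar> \<le> \<bar>r\<bar>"
      using r[OF False] component_le_norm_cart[of y i] by linarith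
    then show ?thesis
      using B[of y] by (auto simp: norm_mult intro!: mult_mono)
  next
    case True
    then show ?thesis
      using B[of y] by (auto intro!: mult_nonneg_nonneg)
  qed
  moreover have "(\<lambda>y. - \<i> * complex_of_real (y $ i) * s y) \<in> borel_measurable borel"
    by measurable
  ultimately show ?thesis
    unfolding bounded_support_def using r by (metis mult_zero_right)
qed

lemma norm_cis_Taylor: "norm (cis \<theta> - 1 - \<i> * complex_of_real \<theta>) \<le> \<theta>\<^sup>2"
proof -
  have "norm (cis \<theta> - 1 - \<i> * complex_of_real \<theta>) \<le> \<bar>\<theta>\<bar> ^ 2 / 2"
    using iexp_approx1[of \<theta> 1] by (simp add: cis_conv_exp numeral_2_eq_2 algebra_simps)
  also have "\<dots> \<le> \<theta>\<^sup>2"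
    by simp
  finally show ?thesis .
qed

text \<open>
  The increment is compared with its linearisation under the integral sign; the remainder is at
  most \<open>|h|\<^sup>2\<close> times the second absolute moment of \<open>s\<close>.
\<close>

lemma fourier_has_derivative:
  fixes s :: "real ^ 'n::finite \<Rightarrow> complex"
  assumes s: "bounded_support s"
  shows "(fourier s has_derivative
    (\<lambda>h. \<Sum>i\<in>UNIV. complex_of_real (h $ i) * fourier (\<lambda>y. - \<i> * complex_of_real (y $ i) * s y) x)) (at x)"
proof -
  define D where "D = (\<lambda>h. \<Sum>i\<in>UNIV. complex_of_real (h $ i) * fourier (\<lambda>y. - \<i> * complex_of_real (y $ i) * s y) x)"
  from s have [measurable]: "s \<in> borel_measurable borel"
    by (simp add: bounded_support_def)
  have cis_int: "integrable lborel (\<lambda>y. cis (- (y \<bullet> z)) * s y)" for z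
    by (intro bounded_support_integrable s) (auto intro: exI[of _ 1])
  have coord_int: "integrable lborel (\<lambda>y. cis (- (y \<bullet> z)) * (- \<i> * complex_of_real (y $ i) * s y))" for z i
    by (intro bounded_support_integrable bounded_support_coordinate s) (auto intro: exI[of _ 1])
  have sq_int: "integrable lborel (\<lambda>y. (norm y)\<^sup>2 * norm (s y))"
  proof -
    have "integrable lborel (\<lambda>y. complex_of_real ((norm y)\<^sup>2) * s y)"
    proof (rule bounded_support_integrable[OF s])
      show "\<exists>B. \<forall>y :: real ^ 'n. norm y \<le> r \<longrightarrow> norm (complex_of_real ((norm y)\<^sup>2)) \<le> B" for r
        by (intro exI[of _ "r\<^sup>2"]) (auto simp: norm_power intro!: power_mono)
    qed measurable
    then have "integrable lborel (\<lambda>y. norm (complex_of_real ((norm y)\<^sup>2) * s y))"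
      by (rule integrable_norm)
    then show ?thesis
      by (simp add: norm_mult norm_power)
  qed
  define K where "K = (LINT y|lborel. (norm y)\<^sup>2 * norm (s y))"
  have D_eq: "D h = (LINT y|lborel. cis (- (y \<bullet> x)) * (- \<i> * complex_of_real (y \<bullet> h)) * s y)" for h
  proof -
    have "D h = (\<Sum>i\<in>UNIV. LINT y|lborel. complex_of_real (h $ i) * (cis (- (y \<bullet> x)) * (- \<i> * complex_of_real (y $ i) * s y)))"
      unfolding D_def fourier_def integral_mult_right_zero ..
    also have "\<dots> = (LINT y|lborel. (\<Sum>i\<in>UNIV. complex_of_real (h $ i) * (cis (- (y \<bullet> x)) * (- \<i> * complex_of_real (y $ i) * s y))))"
      by (intro Bochner_Integration.integral_sum[symmetric] integrable_mult_right coord_int)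
    also have "(\<lambda>y. \<Sum>i\<in>UNIV. complex_of_real (h $ i) * (cis (- (y \<bullet> x)) * (- \<i> * complex_of_real (y $ i) * s y)))
       = (\<lambda>y. cis (- (y \<bullet> x)) * (- \<i> * complex_of_real (y \<bullet> h)) * s y)"
      by (simp add: inner_vec_def sum_distrib_left sum_distrib_right sum_negf mult_ac)
    finally show ?thesis .
  qed
  have lin: "bounded_linear D"
    unfolding D_def
    by (intro bounded_linear_sum bounded_linear_mult_left bounded_linear_compose[OF bounded_linear_of_real]
        bounded_linear_mult_left[THEN bounded_linear_compose] bounded_linear_vec_nth)
  have D_h_int: "integrable lborel (\<lambda>y. cis (- (y \<bullet> x)) * (- \<i> * complex_of_real (y \<bullet> h)) * s y)" for h
  proof (rule bounded_support_integrable[OF s])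
    show "\<exists>B. \<forall>y :: real ^ 'n. norm y \<le> r \<longrightarrow> norm (cis (- (y \<bullet> x)) * (- \<i> * complex_of_real (y \<bullet> h))) \<le> B" for r
    proof (intro exI[of _ "r * norm h"] allI impI)
      fix y :: "real ^ 'n" assume "norm y \<le> r"
      then have "\<bar>y \<bullet> h\<bar> \<le> r * norm h"
        using Cauchy_Schwarz_ineq2[of y h] mult_right_mono[of "norm y" r "norm h"] by simp
      then show "norm (cis (- (y \<bullet> x)) * (- \<i> * complex_of_real (y \<bullet> h))) \<le> r * norm h"
        by (simp add: norm_mult)
    qed
  qed measurable
  have rem: "norm (fourier s (x + h) - fourier s x - D h) \<le> K * (norm h)\<^sup>2" for h
  proof -
    let ?r = "\<lambda>y. cis (- (y \<bullet> x)) * (cis (- (y \<bullet> h)) - 1 - \<i> * complex_of_real (- (y \<bullet> h))) * s y"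
    have split: "cis (- (y \<bullet> (x + h))) * s y - cis (- (y \<bullet> x)) * s y
        - cis (- (y \<bullet> x)) * (- \<i> * complex_of_real (y \<bullet> h)) * s y = ?r y" for y
    proof -
      have "cis (- (y \<bullet> (x + h))) = cis (- (y \<bullet> x)) * cis (- (y \<bullet> h))"
        by (simp add: inner_add_right cis_mult)
      then show ?thesis
        by (simp add: algebra_simps)
    qed
    have "fourier s (x + h) - fourier s x - D h = (LINT y|lborel. ?r y)"
      unfolding D_eq fourier_def split[symmetric] using cis_int D_h_int by simp
    also have "norm \<dots> \<le> (LINT y|lborel. (norm h)\<^sup>2 * ((norm y)\<^sup>2 * norm (s y)))"
    proof (rule Bochner_Integration.integral_norm_bound_integral)
      show "integrable lborel ?r"
        unfolding split[symmetric] by (intro Bochner_Integration.integrable_diff cis_int D_h_int)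
      show "integrable lborel (\<lambda>y. (norm h)\<^sup>2 * ((norm y)\<^sup>2 * norm (s y)))"
        using sq_int by simp
      fix y
      have "norm (cis (- (y \<bullet> h)) - 1 - \<i> * complex_of_real (- (y \<bullet> h))) \<le> (y \<bullet> h)\<^sup>2"
        using norm_cis_Taylor[of "- (y \<bullet> h)"] by simp
      also have "\<dots> \<le> (norm y * norm h)\<^sup>2"
        using Cauchy_Schwarz_ineq2[of y h] by (simp add: abs_le_square_iff[symmetric])
      finally have "norm (?r y) \<le> (norm y * norm h)\<^sup>2 * norm (s y)"
        by (simp add: norm_mult mult_right_mono)
      then show "norm (?r y) \<le> (norm h)\<^sup>2 * ((norm y)\<^sup>2 * norm (s y))"
        by (simp add: power_mult_distrib mult_ac)
    qed
    also have "\<dots> = K * (norm h)\<^sup>2"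
      by (simp add: K_def mult.commute)
    finally show ?thesis .
  qed
  have "((\<lambda>h. norm (fourier s (x + h) - fourier s x - D h) / norm h) \<longlongrightarrow> 0) (at 0)"
  proof (rule Lim_null_comparison)
    show "\<forall>\<^sub>F h in at 0. norm (norm (fourier s (x + h) - fourier s x - D h) / norm h) \<le> K * norm h"
      unfolding eventually_at_filter
    proof (rule always_eventually, intro allI impI)
      fix h :: "real ^ 'n" assume "h \<noteq> 0"
      then show "norm (norm (fourier s (x + h) - fourier s x - D h) / norm h) \<le> K * norm h"
        using rem[of h] by (simp add: divide_le_eq power2_eq_square mult.assoc)
    qed
    show "((\<lambda>h. K * norm h) \<longlongrightarrow> 0) (at (0 :: real ^ 'n))"
      by (auto intro!: tendsto_eq_intros)
  qed
  then show ?thesis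
    unfolding D_def[symmetric] using lin by (simp add: has_derivative_at)
qed

text \<open>
  A class of explicit functions, rich enough for duality arguments: it is closed under partial
  derivatives and all of its members decay rapidly, so they are Schwartz functions. The inverse Fourier
  transforms of the generators in the second clause are the Gaussian mollifications of \<open>s\<close>.
\<close>

inductive gaussian_type :: "real \<Rightarrow> (real ^ 'n::finite \<Rightarrow> complex) \<Rightarrow> bool" for a where
  gauss: "gaussian_type a (\<lambda>x. complex_of_real (exp (- a * (norm x)\<^sup>2)))"
| trans: "bounded_support s \<Longrightarrow> gaussian_type a (\<lambda>x. complex_of_real (exp (- a * (norm x)\<^sup>2)) * fourier s x)"
| coord: "gaussian_type a \<phi> \<Longrightarrow> gaussian_type a (\<lambda>x. complex_of_real (x $ i) * \<phi> x)"
| add: "gaussian_type a \<phi> \<Longrightarrow> gaussian_type a \<psi> \<Longrightarrow> gaussian_type a (\<lambda>x. \<phi> x + \<psi> x)"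
| scale: "gaussian_type a \<phi> \<Longrightarrow> gaussian_type a (\<lambda>x. c * \<phi> x)"

lemma gaussian_has_derivative:
  fixes x :: "real ^ 'n::finite"
  shows "((\<lambda>x. complex_of_real (exp (- a * (norm x)\<^sup>2))) has_derivative
    (\<lambda>h. \<Sum>i\<in>UNIV. complex_of_real (h $ i) * (complex_of_real (- 2 * a) *
       (complex_of_real (x $ i) * complex_of_real (exp (- a * (norm x)\<^sup>2)))))) (at x)"
proof -
  have "((\<lambda>x. complex_of_real (exp (- a * (x \<bullet> x)))) has_derivative
      (\<lambda>h. complex_of_real (exp (- a * (x \<bullet> x)) * (- a * (x \<bullet> h + h \<bullet> x))))) (at x)"
    by (auto intro!: derivative_eq_intros)
  moreover have "complex_of_real (exp (- a * (x \<bullet> x)) * (- a * (x \<bullet> h + h \<bullet> x)))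
    = (\<Sum>i\<in>UNIV. complex_of_real (h $ i) * (complex_of_real (- 2 * a) *
       (complex_of_real (x $ i) * complex_of_real (exp (- a * (norm x)\<^sup>2)))))" for h
  proof -
    have "x \<bullet> h + h \<bullet> x = (\<Sum>i\<in>UNIV. 2 * (h $ i * x $ i))"
      unfolding inner_commute[of x h] by (simp add: inner_vec_def sum_distrib_left)
    then have "exp (- a * (x \<bullet> x)) * (- a * (x \<bullet> h + h \<bullet> x))
        = (\<Sum>i\<in>UNIV. h $ i * (- 2 * a * (x $ i * exp (- a * (norm x)\<^sup>2))))"
      by (simp add: sum_distrib_left power2_norm_eq_inner mult_ac sum_negf)
    then show ?thesis
      by simp
  qed
  ultimately show ?thesis
    by (simp add: power2_norm_eq_inner)
qed

lemma gaussian_type_has_partials: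
  fixes \<phi> :: "real ^ 'n::finite \<Rightarrow> complex"
  assumes "gaussian_type a \<phi>"
  shows "\<exists>D. (\<forall>i. gaussian_type a (D i)) \<and>
    (\<forall>x. (\<phi> has_derivative (\<lambda>h. \<Sum>i\<in>UNIV. complex_of_real (h $ i) * D i x)) (at x))"
  using assms
proof induction
  case gauss
  show ?case
    by (intro exI[of _ "\<lambda>i x. complex_of_real (- 2 * a) * (complex_of_real (x $ i) * complex_of_real (exp (- a * (norm x)\<^sup>2)))"]
        conjI allI gaussian_has_derivative gaussian_type.intros)
next
  case (trans s)
  let ?e = "\<lambda>x::real ^ 'n. complex_of_real (exp (- a * (norm x)\<^sup>2))"
  let ?D = "\<lambda>i x. complex_of_real (- 2 * a) * (complex_of_real (x $ i) * (?e x * fourier s x))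
      + ?e x * fourier (\<lambda>y. - \<i> * complex_of_real (y $ i) * s y) x"
  show ?case
  proof (intro exI[of _ ?D] conjI allI)
    show "gaussian_type a (?D i)" for i
      by (intro gaussian_type.intros bounded_support_coordinate trans)
    show "((\<lambda>x. ?e x * fourier s x) has_derivative (\<lambda>h. \<Sum>i\<in>UNIV. complex_of_real (h $ i) * ?D i x)) (at x)" for x
      by (rule has_derivative_eq_rhs[OF has_derivative_mult[OF gaussian_has_derivative fourier_has_derivative[OF trans]]])
        (simp add: fun_eq_iff sum_distrib_left sum_distrib_right distrib_left right_diff_distrib
          sum.distrib sum_subtractf sum_negf mult_ac)
  qed
next
  case (coord \<phi> j)
  then obtain D where D: "\<And>i. gaussian_type a (D i)"
    "\<And>x. (\<phi> has_derivative (\<lambda>h. \<Sum>i\<in>UNIV. complex_of_real (h $ i) * D i x)) (at x)"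
    by blast
  let ?D = "\<lambda>i x. (if i = j then 1 else 0) * \<phi> x + complex_of_real (x $ j) * D i x"
  show ?case
  proof (intro exI[of _ ?D] conjI allI)
    show "gaussian_type a (?D i)" for i
      by (intro gaussian_type.intros coord D)
    have lin: "((\<lambda>x. complex_of_real (x $ j)) has_derivative (\<lambda>h. complex_of_real (h $ j))) (at x)" for x :: "real ^ 'n"
      by (intro bounded_linear_imp_has_derivative bounded_linear_compose[OF bounded_linear_of_real] bounded_linear_vec_nth)
    show "((\<lambda>x. complex_of_real (x $ j) * \<phi> x) has_derivative (\<lambda>h. \<Sum>i\<in>UNIV. complex_of_real (h $ i) * ?D i x)) (at x)" for x
    proof (rule has_derivative_eq_rhs[OF has_derivative_mult[OF lin D(2)]], rule ext)
      fix h :: "real ^ 'n"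
      have "(\<Sum>i\<in>UNIV. complex_of_real (h $ i) * ((if i = j then 1 else 0) * \<phi> x)) = complex_of_real (h $ j) * \<phi> x"
        by (subst sum.remove[of _ j]) auto
      then show "complex_of_real (x $ j) * (\<Sum>i\<in>UNIV. complex_of_real (h $ i) * D i x) + complex_of_real (h $ j) * \<phi> x
          = (\<Sum>i\<in>UNIV. complex_of_real (h $ i) * ?D i x)"
        by (simp add: distrib_left sum.distrib sum_distrib_left mult_ac)
    qed
  qed
next
  case (add \<phi> \<psi>)
  then obtain D D' where D: "\<And>i. gaussian_type a (D i)"
      "\<And>x. (\<phi> has_derivative (\<lambda>h. \<Sum>i\<in>UNIV. complex_of_real (h $ i) * D i x)) (at x)"
    and D': "\<And>i. gaussian_type a (D' i)"
      "\<And>x. (\<psi> has_derivative (\<lambda>h. \<Sum>i\<in>UNIV. complex_of_real (h $ i) * D' i x)) (at x)"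
    by blast
  show ?case
  proof (intro exI[of _ "\<lambda>i x. D i x + D' i x"] conjI allI gaussian_type.add D D')
    show "((\<lambda>x. \<phi> x + \<psi> x) has_derivative (\<lambda>h. \<Sum>i\<in>UNIV. complex_of_real (h $ i) * (D i x + D' i x))) (at x)" for x
      by (rule has_derivative_eq_rhs[OF has_derivative_add[OF D(2) D'(2)]]) (simp add: distrib_left sum.distrib)
  qed
next
  case (scale \<phi> c)
  then obtain D where D: "\<And>i. gaussian_type a (D i)"
    "\<And>x. (\<phi> has_derivative (\<lambda>h. \<Sum>i\<in>UNIV. complex_of_real (h $ i) * D i x)) (at x)"
    by blast
  show ?case
  proof (intro exI[of _ "\<lambda>i x. c * D i x"] conjI allI gaussian_type.scale D)
    show "((\<lambda>x. c * \<phi> x) has_derivative (\<lambda>h. \<Sum>i\<in>UNIV. complex_of_real (h $ i) * (c * D i x))) (at x)" for x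
      by (rule has_derivative_eq_rhs[OF has_derivative_mult_right[OF D(2)]]) (simp add: sum_distrib_left mult_ac)
  qed
qed

lemma gaussian_type_partial_deriv:
  fixes \<phi> :: "real ^ 'n::finite \<Rightarrow> complex"
  assumes "gaussian_type a \<phi>"
  shows "\<phi> differentiable (at x)" and "gaussian_type a (partial_deriv i \<phi>)"
proof -
  obtain D where D: "\<And>i. gaussian_type a (D i)"
    "\<And>x. (\<phi> has_derivative (\<lambda>h. \<Sum>i\<in>UNIV. complex_of_real (h $ i) * D i x)) (at x)"
    using gaussian_type_has_partials[OF assms] by blast
  show "\<phi> differentiable (at x)"
    using D(2) by (auto simp: differentiable_def)
  have "partial_deriv i \<phi> = D i"
  proof
    fix x
    have "frechet_derivative \<phi> (at x) = (\<lambda>h. \<Sum>i\<in>UNIV. complex_of_real (h $ i) * D i x)"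
      by (rule frechet_derivative_at[OF D(2), symmetric])
    moreover have "(\<Sum>k\<in>UNIV. complex_of_real (axis i 1 $ k) * D k x) = D i x"
      by (subst sum.remove[of _ i]) (auto simp: axis_def)
    ultimately show "partial_deriv i \<phi> x = D i x"
      by (simp add: partial_deriv_def)
  qed
  then show "gaussian_type a (partial_deriv i \<phi>)"
    using D(1) by simp
qed

lemma fourier_norm_bound:
  assumes "integrable lborel s"
  shows "norm (fourier s x) \<le> (LINT y|lborel. norm (s y))"
  unfolding fourier_def
  by (rule order_trans[OF integral_norm_bound]) (simp add: norm_mult)

text \<open>
  For the generators this is \<open>(1 + r) ^ k \<le> exp (k r)\<close> and completing the square; a coordinate
  factor costs one power of \<open>1 + |x|\<close>.
\<close>

lemma gaussian_type_decay:
  fixes \<phi> :: "real ^ 'n::finite \<Rightarrow> complex"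
  assumes "gaussian_type a \<phi>" and a: "a > 0"
  shows "\<exists>C. \<forall>x. (1 + norm x) ^ k * norm (\<phi> x) \<le> C"
  using assms(1)
proof (induction arbitrary: k)
  have bound: "(1 + norm x) ^ k * exp (- a * (norm x)\<^sup>2) \<le> exp ((real k)\<^sup>2 / (4 * a))" for k and x :: "real ^ 'n"
  proof -
    have "(1 + norm x) ^ k \<le> exp (norm x) ^ k"
      by (intro power_mono exp_ge_add_one_self) auto
    also have "\<dots> = exp (real k * norm x)"
      by (simp add: exp_of_nat_mult)
    finally have "(1 + norm x) ^ k * exp (- a * (norm x)\<^sup>2) \<le> exp (real k * norm x) * exp (- a * (norm x)\<^sup>2)"
      by (rule mult_right_mono) simp
    also have "\<dots> = exp (real k * norm x - a * (norm x)\<^sup>2)"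
      by (simp add: exp_add[symmetric])
    also have "real k * norm x - a * (norm x)\<^sup>2 \<le> (real k)\<^sup>2 / (4 * a)"
    proof -
      have "0 \<le> (real k - 2 * a * norm x)\<^sup>2"
        by simp
      then have "(real k * norm x - a * (norm x)\<^sup>2) * (4 * a) \<le> (real k)\<^sup>2"
        by (simp add: power2_eq_square algebra_simps)
      then show ?thesis
        using a by (simp add: pos_le_divide_eq)
    qed
    finally show ?thesis
      by simp
  qed
  {
    case gauss
    show ?case
      using bound[of _ k] by (intro exI[of _ "exp ((real k)\<^sup>2 / (4 * a))"]) simp
  next
    case (trans s)
    show ?case
    proof (intro exI allI)
      fix x :: "real ^ 'n"
      have "(1 + norm x) ^ k * norm (complex_of_real (exp (- a * (norm x)\<^sup>2)) * fourier s x)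
          = ((1 + norm x) ^ k * exp (- a * (norm x)\<^sup>2)) * norm (fourier s x)"
        by (simp add: norm_mult)
      also have "\<dots> \<le> exp ((real k)\<^sup>2 / (4 * a)) * (LINT y|lborel. norm (s y))"
        by (intro mult_mono bound fourier_norm_bound bounded_support_imp_integrable trans) auto
      finally show "(1 + norm x) ^ k * norm (complex_of_real (exp (- a * (norm x)\<^sup>2)) * fourier s x) \<le>
          exp ((real k)\<^sup>2 / (4 * a)) * (LINT y|lborel. norm (s y))" .
    qed
  next
    case (coord \<phi> i)
    then obtain C where C: "\<And>x. (1 + norm x) ^ Suc k * norm (\<phi> x) \<le> C"
      by blast
    show ?case
    proof (intro exI allI)
      fix x :: "real ^ 'n"
      have "(1 + norm x) ^ k * norm (complex_of_real (x $ i) * \<phi> x) = (1 + norm x) ^ k * \<bar>x $ i\<bar> * norm (\<phi> x)"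
        by (simp add: norm_mult)
      also have "\<dots> \<le> (1 + norm x) ^ k * (1 + norm x) * norm (\<phi> x)"
        using component_le_norm_cart[of x i] by (intro mult_right_mono mult_left_mono) auto
      also have "\<dots> \<le> C"
        using C[of x] by (simp add: mult_ac)
      finally show "(1 + norm x) ^ k * norm (complex_of_real (x $ i) * \<phi> x) \<le> C" .
    qed
  next
    case (add \<phi> \<psi>)
    then obtain C C' where C: "\<And>x. (1 + norm x) ^ k * norm (\<phi> x) \<le> C" "\<And>x. (1 + norm x) ^ k * norm (\<psi> x) \<le> C'"
      by meson
    have "(1 + norm x) ^ k * norm (\<phi> x + \<psi> x) \<le> C + C'" for x
    proof -
      have "(1 + norm x) ^ k * norm (\<phi> x + \<psi> x) \<le> (1 + norm x) ^ k * (norm (\<phi> x) + norm (\<psi> x))"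
        by (intro mult_left_mono norm_triangle_ineq) auto
      then show ?thesis
        using C[of x] by (simp add: distrib_left)
    qed
    then show ?case
      by blast
  next
    case (scale \<phi> c)
    then obtain C where C: "\<And>x. (1 + norm x) ^ k * norm (\<phi> x) \<le> C"
      by blast
    have "(1 + norm x) ^ k * norm (c * \<phi> x) \<le> norm c * C" for x
      using mult_left_mono[OF C[of x], of "norm c"] by (simp add: norm_mult mult_ac)
    then show ?case
      by blast
  }
qed

lemma gaussian_type_schwartz:
  fixes \<phi> :: "real ^ 'n::finite \<Rightarrow> complex"
  assumes "gaussian_type a \<phi>" "a > 0"
  shows "schwartz \<phi>"
proof -
  have type: "gaussian_type a (iter_partial is \<phi>)" for "is"
    unfolding iter_partial_def by (induction "is") (auto simp: assms(1) gaussian_type_partial_deriv(2))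
  show ?thesis
    unfolding schwartz_def smooth_def
  proof (intro conjI allI)
    show "iter_partial is \<phi> differentiable (at x)" for "is" x
      by (rule gaussian_type_partial_deriv(1)[OF type])
    show "bounded (range (\<lambda>x. (1 + norm x) ^ k *\<^sub>R iter_partial is \<phi> x))" for "is" k
      using gaussian_type_decay[OF type assms(2), of k "is"] by (force simp: bounded_iff)
  qed
qed

section \<open>Schwartz functions are integrable\<close>

text \<open>
  Comparison with a product of one-dimensional functions: \<open>(1 + |x|)\<^sup>2 \<ge> 1 + x\<^sub>i\<^sup>2\<close> for every
  coordinate.
\<close>

lemma integrable_inverse_power_norm:
  "integrable lborel (\<lambda>x::'a::euclidean_space. 1 / (1 + norm x) ^ (2 * DIM('a)))"
proof (rule integrableI_bounded)
  have one_dim: "(\<integral>\<^sup>+y. ennreal (inverse (1 + y\<^sup>2)) \<partial>lborel) < \<infinity>"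
  proof -
    have "integrable lborel (\<lambda>y::real. inverse (1 + y\<^sup>2))"
      using integrable_inverse_1_plus_square by (simp add: set_integrable_def einterval_eq)
    then show ?thesis
      by (simp add: integrable_iff_bounded)
  qed
  have "(\<integral>\<^sup>+(x::'a). ennreal (norm (1 / (1 + norm x) ^ (2 * DIM('a)))) \<partial>lborel)
      \<le> (\<integral>\<^sup>+(x::'a). (\<Prod>b\<in>Basis. ennreal (inverse (1 + (x \<bullet> b)\<^sup>2))) \<partial>lborel)"
  proof (rule nn_integral_mono)
    fix x :: 'a
    have "1 + (x \<bullet> b)\<^sup>2 \<le> (1 + norm x)\<^sup>2" if "b \<in> Basis" for b
    proof -
      have "(x \<bullet> b)\<^sup>2 \<le> (norm x)\<^sup>2"
        using Basis_le_norm[OF that, of x] by (simp add: abs_le_square_iff[symmetric])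
      moreover have "(1 + norm x)\<^sup>2 = 1 + (norm x)\<^sup>2 + 2 * norm x"
        by (simp add: power2_sum)
      ultimately show ?thesis
        using norm_ge_zero[of x] by linarith
    qed
    then have "(\<Prod>b\<in>(Basis::'a set). 1 + (x \<bullet> b)\<^sup>2) \<le> (\<Prod>b\<in>(Basis::'a set). (1 + norm x)\<^sup>2)"
      by (intro prod_mono) auto
    also have "\<dots> = (1 + norm x) ^ (2 * DIM('a))"
      by (simp add: power_mult)
    finally have "1 / (1 + norm x) ^ (2 * DIM('a)) \<le> 1 / (\<Prod>b\<in>(Basis::'a set). 1 + (x \<bullet> b)\<^sup>2)"
      by (intro divide_left_mono mult_pos_pos prod_pos) (auto simp: add_pos_nonneg)
    also have "\<dots> = (\<Prod>b\<in>(Basis::'a set). inverse (1 + (x \<bullet> b)\<^sup>2))"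
      by (simp add: divide_inverse prod_inversef[symmetric] comp_def)
    finally show "ennreal (norm (1 / (1 + norm x) ^ (2 * DIM('a)))) \<le> (\<Prod>b\<in>Basis. ennreal (inverse (1 + (x \<bullet> b)\<^sup>2)))"
      by (simp add: prod_ennreal ennreal_leI)
  qed
  also have "\<dots> = (\<Prod>b\<in>(Basis::'a set). \<integral>\<^sup>+y. ennreal (inverse (1 + y\<^sup>2)) \<partial>lborel)"
    by (rule nn_integral_lborel_prod) auto
  also have "\<dots> < \<infinity>"
    using one_dim by (simp add: power_less_top_ennreal)
  finally show "(\<integral>\<^sup>+(x::'a). ennreal (norm (1 / (1 + norm x) ^ (2 * DIM('a)))) \<partial>lborel) < \<infinity>" .
qed measurable

lemma schwartz_continuous:
  assumes "schwartz \<phi>"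
  shows "continuous_on UNIV \<phi>"
proof -
  have "iter_partial [] \<phi> differentiable (at x)" for x
    using assms by (auto simp: schwartz_def smooth_def)
  then show ?thesis
    by (intro differentiable_imp_continuous_on) (simp add: iter_partial_def differentiable_on_def)
qed

lemma schwartz_measurable: "schwartz \<phi> \<Longrightarrow> \<phi> \<in> borel_measurable borel"
  by (intro borel_measurable_continuous_onI schwartz_continuous)

lemma schwartz_decay:
  assumes "schwartz \<phi>"
  shows "\<exists>C. \<forall>x. norm (\<phi> x) \<le> C * (1 / (1 + norm x) ^ k)"
proof -
  have "bounded (range (\<lambda>x. (1 + norm x) ^ k *\<^sub>R iter_partial [] \<phi> x))"
    using assms by (simp add: schwartz_def)
  then obtain C where "\<And>x. (1 + norm x) ^ k * norm (\<phi> x) \<le> C"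
    by (auto simp: bounded_iff iter_partial_def)
  then have "norm (\<phi> x) \<le> C * (1 / (1 + norm x) ^ k)" for x
    by (simp add: field_simps add_pos_nonneg)
  then show ?thesis
    by blast
qed

lemma schwartz_integrable:
  fixes \<phi> :: "real ^ 'n::finite \<Rightarrow> complex"
  assumes "schwartz \<phi>"
  shows "integrable lborel \<phi>"
proof -
  obtain C where C: "\<And>x. norm (\<phi> x) \<le> C * (1 / (1 + norm x) ^ (2 * DIM(real ^ 'n)))"
    using schwartz_decay[OF assms] by blast
  show ?thesis
  proof (rule Bochner_Integration.integrable_bound)
    show "integrable lborel (\<lambda>x::real ^ 'n. C * (1 / (1 + norm x) ^ (2 * DIM(real ^ 'n))))"
      by (intro integrable_mult_right integrable_inverse_power_norm)
    show "AE x in lborel. norm (\<phi> x) \<le> norm (C * (1 / (1 + norm x) ^ (2 * DIM(real ^ 'n))))"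
    proof (rule AE_I2)
      fix x
      show "norm (\<phi> x) \<le> norm (C * (1 / (1 + norm x) ^ (2 * DIM(real ^ 'n))))"
        by (rule order_trans[OF C]) (simp only: real_norm_def abs_ge_self)
    qed
  qed (simp add: schwartz_measurable[OF assms])
qed

lemma schwartz_square_integrable:
  fixes \<phi> :: "real ^ 'n::finite \<Rightarrow> complex"
  assumes "schwartz \<phi>"
  shows "sq_norm lborel \<phi> < \<infinity>"
proof -
  obtain C where C: "\<And>x. norm (\<phi> x) \<le> C * (1 / (1 + norm x) ^ 0)"
    using schwartz_decay[OF assms] by blast
  have [measurable]: "\<phi> \<in> borel_measurable borel"
    by (rule schwartz_measurable[OF assms])
  have "sq_norm lborel \<phi> \<le> (\<integral>\<^sup>+x. ennreal C * ennreal (norm (\<phi> x)) \<partial>lborel)"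
  proof (rule nn_integral_mono)
    fix x
    have "norm (\<phi> x) * norm (\<phi> x) \<le> C * norm (\<phi> x)"
      using C[of x] by (intro mult_right_mono) auto
    then show "ennreal ((norm (\<phi> x))\<^sup>2) \<le> ennreal C * ennreal (norm (\<phi> x))"
      by (simp add: power2_eq_square ennreal_mult''[symmetric] ennreal_leI)
  qed
  also have "\<dots> = ennreal C * (\<integral>\<^sup>+x. ennreal (norm (\<phi> x)) \<partial>lborel)"
    by (rule nn_integral_cmult) measurable
  also have "\<dots> < \<infinity>"
    using schwartz_integrable[OF assms] by (simp add: integrable_iff_bounded ennreal_mult_less_top)
  finally show ?thesis .
qed

section \<open>Bessel's inequality\<close>

lemma nn_integral_lborel_affine:
  fixes f :: "'a::euclidean_space \<Rightarrow> ennreal"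
  assumes [measurable]: "f \<in> borel_measurable borel" and "c \<noteq> 0"
  shows "(\<integral>\<^sup>+x. f x \<partial>lborel) = ennreal (\<bar>c\<bar> ^ DIM('a)) * (\<integral>\<^sup>+x. f (t + c *\<^sub>R x) \<partial>lborel)"
  by (subst lborel_affine[OF \<open>c \<noteq> 0\<close>, of t])
    (simp add: nn_integral_density nn_integral_distr nn_integral_cmult)

lemma integral_lborel_affine:
  fixes f :: "'a::euclidean_space \<Rightarrow> complex"
  assumes [measurable]: "f \<in> borel_measurable borel" and "c \<noteq> 0"
  shows "(LINT x|lborel. f x) = complex_of_real (\<bar>c\<bar> ^ DIM('a)) * (LINT x|lborel. f (t + c *\<^sub>R x))"
  by (subst lborel_affine[OF \<open>c \<noteq> 0\<close>, of t])
    (simp add: integral_density integral_distr scaleR_conv_of_real)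

lemma gaussian_integral:
  assumes "s > 0"
  shows "integrable lborel (\<lambda>x::'a::euclidean_space. exp (- s * (norm x)\<^sup>2))"
    and "(LINT x|lborel. exp (- s * (norm (x::'a))\<^sup>2)) = sqrt (pi / s) ^ DIM('a)"
proof -
  have "integrable lborel (\<lambda>y::'a. complex_of_real (exp (- s * (norm y)\<^sup>2)))"
    "(LINT y|lborel. complex_of_real (exp (- s * (norm (y::'a))\<^sup>2))) = complex_of_real (sqrt (pi / s) ^ DIM('a))"
    using gaussian_fourier[OF assms, of "0::'a"] by (simp_all del: of_real_power)
  then show "integrable lborel (\<lambda>x::'a. exp (- s * (norm x)\<^sup>2))"
    "(LINT x|lborel. exp (- s * (norm (x::'a))\<^sup>2)) = sqrt (pi / s) ^ DIM('a)"
    by (simp_all only: complex_of_real_integrable_eq integral_complex_of_real of_real_eq_iff)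
qed

lemma gaussian_nn_integral:
  assumes "s > 0"
  shows "(\<integral>\<^sup>+x. ennreal (exp (- s * (norm (x::'a::euclidean_space))\<^sup>2)) \<partial>lborel) = ennreal (sqrt (pi / s) ^ DIM('a))"
  unfolding gaussian_integral(2)[OF assms, symmetric]
  by (intro nn_integral_eq_integral gaussian_integral assms) auto

text \<open>
  One half of Plancherel's theorem. With a Gaussian weight on the frequency side it is Schur's test,
  because the kernel is then a Gaussian with total mass \<open>(2 pi) ^ n\<close> whatever its width. The weight is removed by
  Fatou's lemma.
\<close>

lemma bessel_inequality:
  fixes \<phi> :: "'a::euclidean_space \<Rightarrow> complex"
  assumes \<phi>: "integrable lborel \<phi>"
  shows "(\<integral>\<^sup>+\<xi>. ennreal ((norm (LINT x|lborel. \<phi> x * cis (x \<bullet> \<xi>)))\<^sup>2) \<partial>lborel)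
    \<le> ennreal ((2 * pi) ^ DIM('a)) * sq_norm lborel \<phi>"
proof -
  have [measurable]: "\<phi> \<in> borel_measurable borel"
    using \<phi> by auto
  define T where "T = (\<lambda>\<xi>. LINT x|lborel. \<phi> x * cis (x \<bullet> \<xi>))"
  have [measurable]: "T \<in> borel_measurable borel"
    unfolding T_def by measurable
  have damped: "(\<integral>\<^sup>+\<xi>. ennreal ((norm (T \<xi>))\<^sup>2 * exp (- a * (norm \<xi>)\<^sup>2)) \<partial>lborel)
      \<le> ennreal ((2 * pi) ^ DIM('a)) * sq_norm lborel \<phi>" if a: "a > 0" for a
  proof -
    define \<kappa> where "\<kappa> = (\<lambda>x y::'a. ennreal (sqrt (pi / a) ^ DIM('a)) * ennreal (exp (- (1 / (4 * a)) * (norm (x - y))\<^sup>2)))"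
    have total: "ennreal (sqrt (pi / a) ^ DIM('a)) *
        (\<integral>\<^sup>+(x::'a). ennreal (exp (- (1 / (4 * a)) * (norm x)\<^sup>2)) \<partial>lborel) = ennreal ((2 * pi) ^ DIM('a))"
    proof -
      have "sqrt (pi / a) * sqrt (pi / (1 / (4 * a))) = 2 * pi"
        using a by (simp add: real_sqrt_divide real_sqrt_mult)
      then have "sqrt (pi / a) ^ DIM('a) * sqrt (pi / (1 / (4 * a))) ^ DIM('a) = (2 * pi) ^ DIM('a)"
        by (simp only: power_mult_distrib[symmetric])
      moreover have "(\<integral>\<^sup>+(x::'a). ennreal (exp (- (1 / (4 * a)) * (norm x)\<^sup>2)) \<partial>lborel)
          = ennreal (sqrt (pi / (1 / (4 * a))) ^ DIM('a))"
        by (rule gaussian_nn_integral) (use a in simp)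
      ultimately show ?thesis
        using a by (simp only: ennreal_mult[symmetric] zero_le_power real_sqrt_ge_zero divide_nonneg_pos pi_ge_zero less_imp_le)
          (simp add: ennreal_mult[symmetric])
    qed
    show ?thesis
      unfolding T_def
    proof (rule schur_quadratic_form[where \<kappa> = \<kappa>])
      show "integrable lborel (\<lambda>\<xi>::'a. exp (- a * (norm \<xi>)\<^sup>2))"
        by (rule gaussian_integral[OF a])
      show "ennreal (norm (LINT \<xi>|lborel. cis (x \<bullet> \<xi>) * cnj (cis (y \<bullet> \<xi>)) * complex_of_real (exp (- a * (norm \<xi>)\<^sup>2)))) \<le> \<kappa> x y"
        for x y :: 'a
      proof -
        have "cis (x \<bullet> \<xi>) * cnj (cis (y \<bullet> \<xi>)) = cis ((x - y) \<bullet> \<xi>)" for \<xi>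
          by (simp add: cis_cnj cis_mult inner_diff_left)
        then have "(LINT \<xi>|lborel. cis (x \<bullet> \<xi>) * cnj (cis (y \<bullet> \<xi>)) * complex_of_real (exp (- a * (norm \<xi>)\<^sup>2)))
            = complex_of_real (sqrt (pi / a) ^ DIM('a) * exp (- (norm (x - y))\<^sup>2 / (4 * a)))"
          using gaussian_fourier(2)[OF a, of "x - y"] by simp
        then show ?thesis
          using a by (simp add: \<kappa>_def ennreal_mult[symmetric] abs_mult del: of_real_mult)
      qed
      have \<kappa>_total: "(\<integral>\<^sup>+y. \<kappa> x y \<partial>lborel) = ennreal ((2 * pi) ^ DIM('a))" for x
      proof -
        have "(\<integral>\<^sup>+y. \<kappa> x y \<partial>lborel) = ennreal (sqrt (pi / a) ^ DIM('a)) *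
            (\<integral>\<^sup>+y. ennreal (exp (- (1 / (4 * a)) * (norm (x - y))\<^sup>2)) \<partial>lborel)"
          unfolding \<kappa>_def by (rule nn_integral_cmult) measurable
        also have "(\<integral>\<^sup>+y. ennreal (exp (- (1 / (4 * a)) * (norm (x - y))\<^sup>2)) \<partial>lborel)
            = (\<integral>\<^sup>+(y::'a). ennreal (exp (- (1 / (4 * a)) * (norm y)\<^sup>2)) \<partial>lborel)"
          by (subst nn_integral_lborel_affine[of _ "- 1" x]) auto
        finally show ?thesis
          using total by simp
      qed
      then show "(\<integral>\<^sup>+y. \<kappa> x y \<partial>lborel) \<le> ennreal ((2 * pi) ^ DIM('a))" for x
        by simp
      have "\<kappa> x y = \<kappa> y x" for x y
        by (simp add: \<kappa>_def norm_minus_commute)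
      then show "(\<integral>\<^sup>+x. \<kappa> x y \<partial>lborel) \<le> ennreal ((2 * pi) ^ DIM('a))" for y
        using \<kappa>_total[of y] by simp
      show "case_prod \<kappa> \<in> borel_measurable (lborel \<Otimes>\<^sub>M lborel)"
        unfolding \<kappa>_def by measurable
      show "(\<lambda>(x, y). cis (x \<bullet> y)) \<in> borel_measurable (lborel \<Otimes>\<^sub>M (lborel :: 'a measure))"
        by measurable
    qed (simp_all add: \<phi> sigma_finite_lborel)
  qed
  define u where "u = (\<lambda>m \<xi>. ennreal ((norm (T \<xi>))\<^sup>2 * exp (- (1 / real (Suc m)) * (norm \<xi>)\<^sup>2)))"
  have "sq_norm lborel T = (\<integral>\<^sup>+\<xi>. liminf (\<lambda>m. u m \<xi>) \<partial>lborel)"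
  proof (rule nn_integral_cong)
    fix \<xi> :: 'a
    have "(\<lambda>m. (norm (T \<xi>))\<^sup>2 * exp (- (1 / real (Suc m)) * (norm \<xi>)\<^sup>2)) \<longlonglongrightarrow> (norm (T \<xi>))\<^sup>2 * exp (- 0 * (norm \<xi>)\<^sup>2)"
      using LIMSEQ_inverse_real_of_nat by (intro tendsto_intros) (simp add: inverse_eq_divide)
    then have "(\<lambda>m. u m \<xi>) \<longlonglongrightarrow> ennreal ((norm (T \<xi>))\<^sup>2)"
      unfolding u_def by (intro tendsto_ennrealI) simp
    then show "ennreal ((norm (T \<xi>))\<^sup>2) = liminf (\<lambda>m. u m \<xi>)"
      by (intro lim_imp_Liminf[symmetric]) auto
  qed
  also have "\<dots> \<le> liminf (\<lambda>m. \<integral>\<^sup>+\<xi>. u m \<xi> \<partial>lborel)"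
    unfolding u_def by (intro nn_integral_liminf) measurable
  also have "\<dots> \<le> ennreal ((2 * pi) ^ DIM('a)) * sq_norm lborel \<phi>"
    unfolding u_def by (intro Liminf_le always_eventually allI damped) simp_all
  finally show ?thesis
    unfolding T_def .
qed

lemma fourier_bessel:
  fixes s :: "real ^ 'n::finite \<Rightarrow> complex"
  assumes "integrable lborel s"
  shows "sq_norm lborel (fourier s)
    \<le> ennreal ((2 * pi) ^ CARD('n)) * sq_norm lborel s"
proof -
  have "norm (fourier s \<xi>) = norm (LINT x|lborel. cnj (s x) * cis (x \<bullet> \<xi>))" for \<xi>
  proof -
    have "(LINT x|lborel. cnj (s x) * cis (x \<bullet> \<xi>)) = (LINT x|lborel. cnj (cis (- (x \<bullet> \<xi>)) * s x))"
      by (simp add: cis_cnj mult.commute)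
    also have "\<dots> = cnj (fourier s \<xi>)"
      unfolding fourier_def using assms by (simp del: complex_cnj_mult)
    finally show ?thesis
      by simp
  qed
  then show ?thesis
    using bessel_inequality[of "\<lambda>x. cnj (s x)"] assms by simp
qed

lemma inv_fourier_bessel:
  fixes \<phi> :: "real ^ 'n::finite \<Rightarrow> complex"
  assumes "integrable lborel \<phi>"
  shows "sq_norm lborel (inv_fourier \<phi>)
    \<le> ennreal (1 / (2 * pi) ^ CARD('n)) * sq_norm lborel \<phi>"
proof -
  have [measurable]: "\<phi> \<in> borel_measurable borel"
    using assms by auto
  let ?T = "\<lambda>\<xi>. LINT x|lborel. \<phi> x * cis (x \<bullet> \<xi>)"
  define c where "c = 1 / (2 * pi) ^ CARD('n)"
  have c: "c > 0" "c * (2 * pi) ^ CARD('n) = 1"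
    by (simp_all add: c_def)
  have "inv_fourier \<phi> \<xi> = complex_of_real c * ?T \<xi>" for \<xi>
    unfolding inv_fourier_def c_def by (simp add: mult.commute inner_commute)
  then have "sq_norm lborel (inv_fourier \<phi>) = (\<integral>\<^sup>+\<xi>. ennreal (c\<^sup>2) * ennreal ((norm (?T \<xi>))\<^sup>2) \<partial>lborel)"
    by (simp add: norm_mult power_mult_distrib ennreal_mult)
  also have "\<dots> = ennreal (c\<^sup>2) * sq_norm lborel ?T"
    by (rule nn_integral_cmult) measurable
  also have "\<dots> \<le> ennreal (c\<^sup>2) * (ennreal ((2 * pi) ^ DIM(real ^ 'n)) * sq_norm lborel \<phi>)"
    by (intro mult_left_mono bessel_inequality assms) simp
  also have "\<dots> = ennreal (c\<^sup>2 * (2 * pi) ^ CARD('n)) * sq_norm lborel \<phi>"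
    by (simp add: ennreal_mult mult.assoc)
  also have "c\<^sup>2 * (2 * pi) ^ CARD('n) = c"
    using c by (simp add: power2_eq_square mult.assoc)
  finally show ?thesis
    unfolding c_def .
qed

section \<open>Plancherel's theorem by duality\<close>

definition mollified_transform :: "real \<Rightarrow> (real ^ 'n::finite \<Rightarrow> complex) \<Rightarrow> real ^ 'n \<Rightarrow> complex" where
  "mollified_transform a s x = complex_of_real (exp (- a * (norm x)\<^sup>2)) * fourier s x"

lemma mollified_transform_schwartz:
  "bounded_support s \<Longrightarrow> a > 0 \<Longrightarrow> schwartz (mollified_transform a s)"
  unfolding mollified_transform_def by (intro gaussian_type_schwartz[of a] gaussian_type.trans)

text \<open>
  The function on the right is the convolution of \<open>s\<close> with a Gaussian of width \<open>c\<close>. The identity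
  is Fubini's theorem, the Fourier transform of the Gaussian, and a substitution.
\<close>

lemma inv_fourier_mollified_transform:
  fixes s :: "real ^ 'n::finite \<Rightarrow> complex"
  assumes s: "bounded_support s" and c: "c > 0"
  shows "inv_fourier (mollified_transform (c\<^sup>2 / 4) s) \<xi> =
    (LINT z|lborel. s (\<xi> + c *\<^sub>R z) * complex_of_real ((1 / sqrt pi) ^ CARD('n) * exp (- (norm z)\<^sup>2)))"
proof -
  let ?n = "CARD('n)"
  define a where "a = c\<^sup>2 / 4"
  have a: "a > 0"
    using c by (simp add: a_def)
  have [measurable]: "s \<in> borel_measurable borel"
    using s by (simp add: bounded_support_def)
  have s_int: "integrable lborel s"
    by (rule bounded_support_imp_integrable[OF s])
  define F where "F = (\<lambda>x y. s y * (cis ((\<xi> - y) \<bullet> x) * complex_of_real (exp (- a * (norm x)\<^sup>2))))"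
  have gauss_int: "integrable lborel (\<lambda>x :: real ^ 'n. complex_of_real (exp (- a * (norm x)\<^sup>2)))"
    using gaussian_integral(1)[OF a] by (simp only: complex_of_real_integrable_eq)
  have cis_meas: "(\<lambda>(x :: real ^ 'n, y). cis ((\<xi> - y) \<bullet> x)) \<in> borel_measurable (lborel \<Otimes>\<^sub>M lborel)"
    by measurable
  have "integrable (lborel \<Otimes>\<^sub>M lborel)
      (\<lambda>(x :: real ^ 'n, y). complex_of_real (exp (- a * (norm x)\<^sup>2)) * s y * cis ((\<xi> - y) \<bullet> x))"
    by (rule lborel_pair.integrable_tensor_kernel[OF gauss_int s_int cis_meas]) simp
  then have F_int: "integrable (lborel \<Otimes>\<^sub>M lborel) (case_prod F)"
    by (simp add: F_def mult_ac)
  have "(LINT x|lborel. cis (\<xi> \<bullet> x) * mollified_transform a s x) = (LINT x|lborel. LINT y|lborel. F x y)"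
  proof (rule Bochner_Integration.integral_cong[OF refl])
    fix x
    have "cis (\<xi> \<bullet> x) * mollified_transform a s x
        = (LINT y|lborel. (cis (\<xi> \<bullet> x) * complex_of_real (exp (- a * (norm x)\<^sup>2))) * (cis (- (y \<bullet> x)) * s y))"
      by (simp add: mollified_transform_def fourier_def)
    also have "\<dots> = (LINT y|lborel. F x y)"
    proof -
      have "cis ((\<xi> - y) \<bullet> x) = cis (\<xi> \<bullet> x) * cis (- (y \<bullet> x))" for y
        by (simp add: inner_diff_left cis_mult)
      then show ?thesis
        by (simp add: F_def mult_ac)
    qed
    finally show "cis (\<xi> \<bullet> x) * mollified_transform a s x = (LINT y|lborel. F x y)" .
  qed
  also have "\<dots> = (LINT y|lborel. LINT x|lborel. F x y)"
    by (rule lborel_pair.Fubini_integral[OF F_int, symmetric])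
  also have "\<dots> = (LINT y|lborel. s y * complex_of_real (sqrt (pi / a) ^ ?n * exp (- (norm (\<xi> - y))\<^sup>2 / (4 * a))))"
    unfolding F_def integral_mult_right_zero gaussian_fourier(2)[OF a] by simp
  also have "\<dots> = complex_of_real (\<bar>c\<bar> ^ DIM(real ^ 'n)) * (LINT z|lborel. s (\<xi> + c *\<^sub>R z) *
      complex_of_real (sqrt (pi / a) ^ ?n * exp (- (norm (\<xi> - (\<xi> + c *\<^sub>R z)))\<^sup>2 / (4 * a))))"
    by (rule integral_lborel_affine) (use c in auto)
  also have "\<dots> = (LINT z|lborel. complex_of_real (c ^ ?n * sqrt (pi / a) ^ ?n) *
      (s (\<xi> + c *\<^sub>R z) * complex_of_real (exp (- (norm z)\<^sup>2))))"
  proof -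
    have "(norm (\<xi> - (\<xi> + c *\<^sub>R z)))\<^sup>2 / (4 * a) = (norm z)\<^sup>2" for z
      using c by (simp add: a_def power_mult_distrib)
    then show ?thesis
      using c unfolding integral_mult_right_zero[symmetric] by (simp add: mult_ac)
  qed
  finally have main: "(LINT x|lborel. cis (\<xi> \<bullet> x) * mollified_transform a s x) = (LINT z|lborel.
      complex_of_real (c ^ ?n * sqrt (pi / a) ^ ?n) * (s (\<xi> + c *\<^sub>R z) * complex_of_real (exp (- (norm z)\<^sup>2))))" .
  have const: "1 / (2 * pi) ^ ?n * (c ^ ?n * sqrt (pi / a) ^ ?n) = (1 / sqrt pi) ^ ?n"
  proof -
    have "c * sqrt (pi / a) = 2 * sqrt pi"
      using c by (simp add: a_def real_sqrt_divide real_sqrt_mult)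
    moreover have "1 / (2 * pi) * (2 * sqrt pi) = 1 / sqrt pi"
      by (simp add: field_simps)
    ultimately have "1 / (2 * pi) * (c * sqrt (pi / a)) = 1 / sqrt pi"
      by simp
    then show ?thesis
      by (metis power_mult_distrib power_one_over)
  qed
  show ?thesis
    unfolding inv_fourier_def a_def[symmetric] main integral_mult_right_zero[symmetric]
    unfolding const[symmetric] by (simp add: mult_ac)
qed

lemma closest_point_cball_bounded: "B \<ge> 0 \<Longrightarrow> norm (closest_point (cball 0 B) z) \<le> B"
  using closest_point_in_set[of "cball 0 B" z] by (simp add: dist_norm)

text \<open>
  A measurable function is an almost everywhere limit of continuous ones. Composing these
  with the projection onto a disc, and multiplying by a cutoff, makes them uniformly bounded with a common
  bounded support without changing the limit.
\<close>

lemma bounded_support_approximation: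
  fixes s :: "real ^ 'n::finite \<Rightarrow> complex"
  assumes "bounded_support s"
  obtains S B r where "\<And>k. bounded_support (S k)" "\<And>k. continuous_on UNIV (S k)"
    "\<And>k y. norm (S k y) \<le> B * indicator (cball 0 r) y" "AE y in lborel. (\<lambda>k. S k y) \<longlonglongrightarrow> s y"
proof -
  from assms obtain B r where s_meas: "s \<in> borel_measurable borel"
    and B: "\<And>y. norm (s y) \<le> B" and r: "\<And>y. s y \<noteq> 0 \<Longrightarrow> norm y \<le> r"
    unfolding bounded_support_def by blast
  have B0: "B \<ge> 0"
    using B[of 0] norm_ge_zero order_trans by blast
  have "s \<in> borel_measurable lebesgue"
    using s_meas by (intro measurable_completion) simp
  then have "s measurable_on UNIV"
    by (intro lebesgue_measurable_imp_measurable_on) auto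
  then obtain N g where N: "negligible N" and g: "\<And>k. continuous_on UNIV (g k :: real ^ 'n \<Rightarrow> complex)"
    and lim: "\<And>y. y \<notin> N \<Longrightarrow> (\<lambda>k. g k y) \<longlonglongrightarrow> s y"
    unfolding measurable_on_def by auto
  \<comment> \<open>\<open>P\<close> truncates the values and \<open>\<eta>\<close> the support; both leave \<open>s\<close> unchanged.\<close>
  define P where "P = closest_point (cball (0 :: complex) B)"
  define \<eta> where "\<eta> = (\<lambda>y :: real ^ 'n. max 0 (min 1 (r + 1 - norm y)))"
  define S where "S = (\<lambda>k y. complex_of_real (\<eta> y) * P (g k y))"
  have P_cont: "continuous_on UNIV P"
    unfolding P_def using B0 by (intro continuous_on_closest_point) auto
  have P_le: "norm (P z) \<le> B" for z
    unfolding P_def by (rule closest_point_cball_bounded[OF B0])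
  have \<eta>: "0 \<le> \<eta> y" "\<eta> y \<le> 1" "norm y > r + 1 \<Longrightarrow> \<eta> y = 0" for y
    by (auto simp: \<eta>_def)
  have S_cont: "continuous_on UNIV (S k)" for k
    unfolding S_def \<eta>_def
    by (intro continuous_intros continuous_on_compose2[OF P_cont g]) auto
  have S_le: "norm (S k y) \<le> B * indicator (cball 0 (r + 1)) y" for k y
  proof (cases "norm y \<le> r + 1")
    case True
    have "norm (S k y) \<le> 1 * B"
      unfolding S_def norm_mult using \<eta>[of y] P_le by (intro mult_mono) auto
    then show ?thesis
      using True by simp
  next
    case False
    then show ?thesis
      using \<eta>(3)[of y] by (simp add: S_def)
  qed
  have S_supp: "bounded_support (S k)" for k
    unfolding bounded_support_def
  proof (intro conjI exI allI impI)
    show "S k \<in> borel_measurable borel"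
      by (rule borel_measurable_continuous_onI[OF S_cont])
    show "norm (S k y) \<le> B" for y
      using S_le[of k y] B0 by (auto split: split_indicator_asm)
    show "norm y \<le> r + 1" if "S k y \<noteq> 0" for y
      using S_le[of k y] that by (auto split: split_indicator_asm)
  qed
  have "AE y in lebesgue. y \<notin> N"
    using N by (intro AE_not_in) (simp add: negligible_iff_null_sets)
  then have "AE y in lborel. y \<notin> N"
    by (simp add: AE_completion_iff)
  then have "AE y in lborel. (\<lambda>k. S k y) \<longlonglongrightarrow> s y"
  proof eventually_elim
    fix y assume "y \<notin> N"
    have "(\<lambda>k. P (g k y)) \<longlonglongrightarrow> P (s y)"
      by (rule isCont_tendsto_compose[OF _ lim[OF \<open>y \<notin> N\<close>]])
        (use P_cont in \<open>simp add: continuous_on_eq_continuous_at\<close>)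
    then have "(\<lambda>k. S k y) \<longlonglongrightarrow> complex_of_real (\<eta> y) * P (s y)"
      unfolding S_def by (intro tendsto_intros)
    also have "P (s y) = s y"
      unfolding P_def using B by (intro closest_point_self) simp
    also have "complex_of_real (\<eta> y) * s y = s y"
      using r[of y] by (cases "s y = 0") (auto simp: \<eta>_def)
    finally show "(\<lambda>k. S k y) \<longlonglongrightarrow> s y" .
  qed
  then show thesis
    by (rule that[OF S_supp S_cont S_le])
qed

text \<open>
  The Gaussian is a Schwartz function, so \<open>W\<close> can be tested against it. This replaces growth
  assumptions on \<open>W\<close> as a source of dominating functions.
\<close>

lemma tempered_fun_gaussian_integrable:
  fixes W :: "real ^ 'n::finite \<Rightarrow> complex"
  assumes "tempered_fun W"
  shows "integrable lborel (\<lambda>\<xi>. W \<xi> * complex_of_real (exp (- (norm \<xi>)\<^sup>2)))"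
proof -
  have "schwartz (\<lambda>x :: real ^ 'n. complex_of_real (exp (- 1 * (norm x)\<^sup>2)))"
    by (rule gaussian_type_schwartz[OF gaussian_type.gauss]) simp
  then show ?thesis
    using assms unfolding tempered_fun_def by fastforce
qed

lemma tempered_fun_locally_integrable:
  fixes W :: "real ^ 'n::finite \<Rightarrow> complex"
  assumes "tempered_fun W"
  shows "integrable lborel (\<lambda>\<xi>. norm (W \<xi>) * indicator (cball 0 r) \<xi>)"
proof -
  have [measurable]: "W \<in> borel_measurable borel"
    using assms by (simp add: tempered_fun_def)
  have "integrable lborel (\<lambda>\<xi>. exp (r\<^sup>2) * norm (W \<xi> * complex_of_real (exp (- (norm \<xi>)\<^sup>2))))"
    by (intro integrable_mult_right integrable_norm tempered_fun_gaussian_integrable assms)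
  then show ?thesis
  proof (rule Bochner_Integration.integrable_bound)
    show "AE \<xi> in lborel. norm (norm (W \<xi>) * indicator (cball 0 r) \<xi>)
        \<le> norm (exp (r\<^sup>2) * norm (W \<xi> * complex_of_real (exp (- (norm \<xi>)\<^sup>2))))"
    proof (rule AE_I2)
      fix \<xi> :: "real ^ 'n"
      show "norm (norm (W \<xi>) * indicator (cball 0 r) \<xi>)
        \<le> norm (exp (r\<^sup>2) * norm (W \<xi> * complex_of_real (exp (- (norm \<xi>)\<^sup>2))))"
      proof (cases "norm \<xi> \<le> r")
        case True
        then have "(norm \<xi>)\<^sup>2 \<le> r\<^sup>2"
          by (intro power_mono) auto
        then have "1 \<le> exp (r\<^sup>2) * exp (- (norm \<xi>)\<^sup>2)"
          by (simp add: exp_add[symmetric])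
        then have "norm (W \<xi>) * 1 \<le> norm (W \<xi>) * (exp (r\<^sup>2) * exp (- (norm \<xi>)\<^sup>2))"
          by (rule mult_left_mono) simp
        then show ?thesis
          using True by (simp add: norm_mult abs_mult mult_ac)
      qed simp
    qed
  qed (measurable, simp)
qed

text \<open>
  Testing the representation of the inverse transform of \<open>W\<close> by \<open>h\<close> with a Schwartz function whose
  inverse transform is a mollification of \<open>s\<close>; Cauchy-Schwarz and Bessel's inequality do the rest.
\<close>

lemma pairing_bound_schwartz:
  fixes W h s :: "real ^ 'n::finite \<Rightarrow> complex"
  assumes rep: "is_fun (inv_fourier_distr (distr_of_fun W)) h"
    and s: "bounded_support s" and a: "a > 0"
  shows "ennreal ((norm (LINT \<xi>|lborel. W \<xi> * inv_fourier (mollified_transform a s) \<xi>))\<^sup>2)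
    \<le> sq_norm lborel h *
      (ennreal ((2 * pi) ^ CARD('n)) * sq_norm lborel s)"
proof -
  let ?\<phi> = "mollified_transform a s"
  have \<phi>: "schwartz ?\<phi>"
    by (rule mollified_transform_schwartz[OF s a])
  have [measurable]: "h \<in> borel_measurable borel" "?\<phi> \<in> borel_measurable borel"
    using rep schwartz_measurable[OF \<phi>] by (auto simp: is_fun_def tempered_fun_def)
  have "(LINT \<xi>|lborel. W \<xi> * inv_fourier ?\<phi> \<xi>) = (LINT x|lborel. h x * ?\<phi> x)"
    using rep \<phi> by (simp add: is_fun_def distr_eq_def inv_fourier_distr_def distr_of_fun_def)
  then have "ennreal ((norm (LINT \<xi>|lborel. W \<xi> * inv_fourier ?\<phi> \<xi>))\<^sup>2) = (ennreal (norm (LINT x|lborel. h x * ?\<phi> x)))\<^sup>2"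
    by (simp add: ennreal_power)
  also have "\<dots> \<le> (\<integral>\<^sup>+x. ennreal (norm (h x * ?\<phi> x)) \<partial>lborel)\<^sup>2"
    using rep \<phi> by (intro power_mono integral_norm_bound_ennreal) (auto simp: is_fun_def tempered_fun_def)
  also have "\<dots> = (\<integral>\<^sup>+x. ennreal (norm (h x)) * ennreal (norm (?\<phi> x)) \<partial>lborel)\<^sup>2"
    by (simp add: norm_mult ennreal_mult)
  also have "\<dots> \<le> (\<integral>\<^sup>+x. (ennreal (norm (h x)))\<^sup>2 \<partial>lborel) * (\<integral>\<^sup>+x. (ennreal (norm (?\<phi> x)))\<^sup>2 \<partial>lborel)"
    by (rule Cauchy_Schwarz_nn_integral) measurable
  also have "\<dots> = sq_norm lborel h * sq_norm lborel ?\<phi>"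
    by (simp add: ennreal_power)
  also have "\<dots> \<le> sq_norm lborel h *
      (ennreal ((2 * pi) ^ CARD('n)) * sq_norm lborel s)"
  proof (intro mult_left_mono)
    have "sq_norm lborel ?\<phi> \<le> sq_norm lborel (fourier s)"
    proof (intro nn_integral_mono ennreal_leI power_mono)
      fix x
      have "exp (- a * (norm x)\<^sup>2) * norm (fourier s x) \<le> 1 * norm (fourier s x)"
        using a by (intro mult_right_mono) auto
      then show "norm (?\<phi> x) \<le> norm (fourier s x)"
        by (simp add: mollified_transform_def norm_mult)
    qed simp
    also have "\<dots> \<le> ennreal ((2 * pi) ^ CARD('n)) * sq_norm lborel s"
      by (intro fourier_bessel bounded_support_imp_integrable s)
    finally show "sq_norm lborel ?\<phi>
        \<le> ennreal ((2 * pi) ^ CARD('n)) * sq_norm lborel s" .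
  qed simp
  finally show ?thesis .
qed

text \<open>
  The mollifications of a continuous \<open>s\<close> converge to \<open>s\<close> pointwise, and for widths at most
  \<open>1 / 3\<close> they are dominated by a multiple of \<open>exp (- |\<xi>|\<^sup>2)\<close>, against which \<open>W\<close> is integrable.
\<close>

lemma pairing_mollified_tendsto:
  fixes W s :: "real ^ 'n::finite \<Rightarrow> complex"
  assumes W: "tempered_fun W" and s: "bounded_support s" and s_cont: "continuous_on UNIV s"
  defines "c \<equiv> \<lambda>k. 1 / (3 * real (Suc k))"
  shows "(\<lambda>k. LINT \<xi>|lborel. W \<xi> * inv_fourier (mollified_transform ((c k)\<^sup>2 / 4) s) \<xi>)
    \<longlonglongrightarrow> (LINT \<xi>|lborel. W \<xi> * s \<xi>)"
proof -
  let ?n = "CARD('n)"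
  define g where "g = (\<lambda>z :: real ^ 'n. (1 / sqrt pi) ^ ?n * exp (- (norm z)\<^sup>2))"
  have c: "c k > 0" "(c k)\<^sup>2 \<le> 1 / 9" for k
  proof -
    show "c k > 0"
      by (simp add: c_def)
    have "c k \<le> 1 / 3"
      by (simp add: c_def divide_le_eq)
    then have "(c k)\<^sup>2 \<le> (1 / 3)\<^sup>2"
      using \<open>c k > 0\<close> by (intro power_mono) auto
    then show "(c k)\<^sup>2 \<le> 1 / 9"
      by (simp add: power_divide)
  qed
  have c_lim: "c \<longlonglongrightarrow> 0"
    using tendsto_mult_right_zero[OF LIMSEQ_inverse_real_of_nat, of "1 / 3"]
    by (simp add: c_def inverse_eq_divide)
  from s obtain B r where [measurable]: "s \<in> borel_measurable borel"
    and B: "\<And>y. norm (s y) \<le> B" and r: "\<And>y. s y \<noteq> 0 \<Longrightarrow> norm y \<le> r"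
    unfolding bounded_support_def by blast
  have B0: "B \<ge> 0"
    using B[of 0] norm_ge_zero order_trans by blast
  have [measurable]: "W \<in> borel_measurable borel" "g \<in> borel_measurable borel"
    using W by (auto simp: tempered_fun_def g_def)
  have g_nonneg: "g z \<ge> 0" for z
    by (simp add: g_def)
  have g_int: "integrable lborel g" "integral\<^sup>L lborel g = 1"
    using gaussian_integral[of 1, where ?'a = "real ^ 'n"]
    by (simp_all add: g_def power_mult_distrib[symmetric])
  define \<psi> where "\<psi> = (\<lambda>k \<xi>. LINT z|lborel. s (\<xi> + c k *\<^sub>R z) * complex_of_real (g z))"
  have \<psi>: "inv_fourier (mollified_transform ((c k)\<^sup>2 / 4) s) \<xi> = \<psi> k \<xi>" for k \<xi>
    unfolding \<psi>_def g_def by (rule inv_fourier_mollified_transform[OF s c(1)])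
  have \<psi>_lim: "(\<lambda>k. \<psi> k \<xi>) \<longlonglongrightarrow> s \<xi>" for \<xi>
  proof -
    have "(\<lambda>k. \<psi> k \<xi>) \<longlonglongrightarrow> (LINT z|lborel. s \<xi> * complex_of_real (g z))"
      unfolding \<psi>_def
    proof (rule integral_dominated_convergence[where w = "\<lambda>z. B * g z"])
      show "AE z in lborel. (\<lambda>k. s (\<xi> + c k *\<^sub>R z) * complex_of_real (g z)) \<longlonglongrightarrow> s \<xi> * complex_of_real (g z)"
      proof (rule AE_I2)
        fix z :: "real ^ 'n"
        have "(\<lambda>k. \<xi> + c k *\<^sub>R z) \<longlonglongrightarrow> \<xi> + 0 *\<^sub>R z"
          by (intro tendsto_intros c_lim)
        then have "(\<lambda>k. \<xi> + c k *\<^sub>R z) \<longlonglongrightarrow> \<xi>"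
          by simp
        then have "(\<lambda>k. s (\<xi> + c k *\<^sub>R z)) \<longlonglongrightarrow> s \<xi>"
          by (rule isCont_tendsto_compose[rotated]) (use s_cont in \<open>simp add: continuous_on_eq_continuous_at\<close>)
        then show "(\<lambda>k. s (\<xi> + c k *\<^sub>R z) * complex_of_real (g z)) \<longlonglongrightarrow> s \<xi> * complex_of_real (g z)"
          by (intro tendsto_intros)
      qed
      show "AE z in lborel. norm (s (\<xi> + c k *\<^sub>R z) * complex_of_real (g z)) \<le> B * g z" for k
        using B g_nonneg by (auto simp: norm_mult intro!: mult_right_mono)
    qed (measurable, use g_int in simp)
    also have "(LINT z|lborel. s \<xi> * complex_of_real (g z)) = s \<xi>"
      using g_int by simp
    finally show ?thesis .
  qed
  \<comment> \<open>Half of the Gaussian in \<open>z\<close> stays integrable, and the other half bounds \<open>exp (- (norm \<xi>)\<^sup>2)\<close> on the support of \<open>s\<close>.\<close>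
  define e where "e = (\<lambda>z :: real ^ 'n. exp (- (1 / 2) * (norm z)\<^sup>2))"
  define K where "K = B * (1 / sqrt pi) ^ ?n * exp (4 * r\<^sup>2) * integral\<^sup>L lborel e"
  have e_int: "integrable lborel e"
    unfolding e_def by (rule gaussian_integral(1)) simp
  have \<psi>_le: "norm (\<psi> k \<xi>) \<le> K * exp (- (norm \<xi>)\<^sup>2)" for k \<xi>
  proof -
    have "norm (\<psi> k \<xi>) \<le> (LINT z|lborel. B * (1 / sqrt pi) ^ ?n * exp (4 * r\<^sup>2) * exp (- (norm \<xi>)\<^sup>2) * e z)"
      unfolding \<psi>_def
    proof (rule Bochner_Integration.integral_norm_bound_integral)
      show "integrable lborel (\<lambda>z. s (\<xi> + c k *\<^sub>R z) * complex_of_real (g z))"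
      proof (rule Bochner_Integration.integrable_bound)
        show "integrable lborel (\<lambda>z. B * g z)"
          using g_int by simp
        show "AE z in lborel. norm (s (\<xi> + c k *\<^sub>R z) * complex_of_real (g z)) \<le> norm (B * g z)"
          using B B0 g_nonneg by (auto simp: norm_mult abs_mult intro!: mult_right_mono)
      qed measurable
      show "integrable lborel (\<lambda>z. B * (1 / sqrt pi) ^ ?n * exp (4 * r\<^sup>2) * exp (- (norm \<xi>)\<^sup>2) * e z)"
        using e_int by simp
      fix z :: "real ^ 'n"
      show "norm (s (\<xi> + c k *\<^sub>R z) * complex_of_real (g z))
          \<le> B * (1 / sqrt pi) ^ ?n * exp (4 * r\<^sup>2) * exp (- (norm \<xi>)\<^sup>2) * e z"
      proof (cases "s (\<xi> + c k *\<^sub>R z) = 0")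
        case False
        then have "norm (\<xi> + c k *\<^sub>R z) \<le> r"
          by (rule r)
        moreover have "norm \<xi> \<le> norm (\<xi> + c k *\<^sub>R z) + norm (c k *\<^sub>R z)"
          using norm_triangle_ineq4[of "\<xi> + c k *\<^sub>R z" "c k *\<^sub>R z"] by simp
        ultimately have "norm \<xi> \<le> r + c k * norm z"
          using c(1)[of k] by simp
        then have "(norm \<xi>)\<^sup>2 \<le> (r + c k * norm z)\<^sup>2"
          by (intro power_mono) auto
        also have "\<dots> \<le> 2 * r\<^sup>2 + 2 * (c k * norm z)\<^sup>2"
          using sum_squares_bound[of r "c k * norm z"] by (simp add: power2_sum)
        also have "(c k * norm z)\<^sup>2 \<le> 1 / 9 * (norm z)\<^sup>2"
          unfolding power_mult_distrib using c(2) by (intro mult_right_mono) auto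
        finally have "(norm \<xi>)\<^sup>2 \<le> 2 * r\<^sup>2 + 2 * (1 / 9 * (norm z)\<^sup>2)"
          by simp
        then have "- (norm z)\<^sup>2 \<le> 4 * r\<^sup>2 + - (norm \<xi>)\<^sup>2 + - (1 / 2) * (norm z)\<^sup>2"
          using zero_le_power2[of "norm z"] zero_le_power2[of r] by linarith
        then have "exp (- (norm z)\<^sup>2) \<le> exp (4 * r\<^sup>2) * exp (- (norm \<xi>)\<^sup>2) * e z"
          by (simp add: e_def exp_add[symmetric])
        then have "g z \<le> (1 / sqrt pi) ^ ?n * (exp (4 * r\<^sup>2) * exp (- (norm \<xi>)\<^sup>2) * e z)"
          unfolding g_def by (rule mult_left_mono) simp
        then have "norm (s (\<xi> + c k *\<^sub>R z)) * g z \<le> B * ((1 / sqrt pi) ^ ?n * (exp (4 * r\<^sup>2) * exp (- (norm \<xi>)\<^sup>2) * e z))"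
          using B B0 g_nonneg by (intro mult_mono) auto
        then show ?thesis
          using g_nonneg[of z] by (simp add: norm_mult mult.assoc)
      qed (use B0 in \<open>simp add: e_def\<close>)
    qed
    also have "\<dots> = K * exp (- (norm \<xi>)\<^sup>2)"
      by (simp add: K_def mult_ac)
    finally show ?thesis .
  qed
  have [measurable]: "\<psi> k \<in> borel_measurable borel" for k
    unfolding \<psi>_def by measurable
  show ?thesis
    unfolding \<psi>
  proof (rule integral_dominated_convergence[where w = "\<lambda>\<xi>. K * norm (W \<xi> * complex_of_real (exp (- (norm \<xi>)\<^sup>2)))"])
    show "integrable lborel (\<lambda>\<xi>. K * norm (W \<xi> * complex_of_real (exp (- (norm \<xi>)\<^sup>2))))"
      by (intro integrable_mult_right integrable_norm tempered_fun_gaussian_integrable W)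
    show "AE \<xi> in lborel. (\<lambda>k. W \<xi> * \<psi> k \<xi>) \<longlonglongrightarrow> W \<xi> * s \<xi>"
      by (intro AE_I2 tendsto_intros \<psi>_lim)
    show "AE \<xi> in lborel. norm (W \<xi> * \<psi> k \<xi>) \<le> K * norm (W \<xi> * complex_of_real (exp (- (norm \<xi>)\<^sup>2)))" for k
    proof (rule AE_I2)
      fix \<xi>
      show "norm (W \<xi> * \<psi> k \<xi>) \<le> K * norm (W \<xi> * complex_of_real (exp (- (norm \<xi>)\<^sup>2)))"
        using mult_left_mono[OF \<psi>_le[of k \<xi>], of "norm (W \<xi>)"] by (simp add: norm_mult mult_ac)
    qed
  qed measurable
qed

text \<open>
  The other half of Plancherel's theorem, for the distribution side. The previous two lemmas
  bound the pairing of \<open>W\<close> with \<open>s\<close> by the \<open>L\<^sup>2\<close> norms of \<open>h\<close> and \<open>s\<close>, first for continuous \<open>s\<close> and then, by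
  approximation, for bounded \<open>s\<close> of bounded support. Taking for \<open>s\<close> the conjugate of \<open>W\<close>, cut off where \<open>W\<close>
  or its argument is large, gives the bound on an exhausting sequence of sets.
\<close>

lemma plancherel_dual:
  fixes W h :: "real ^ 'n::finite \<Rightarrow> complex"
  assumes W: "tempered_fun W" and rep: "is_fun (inv_fourier_distr (distr_of_fun W)) h"
  shows "sq_norm lborel W
    \<le> ennreal ((2 * pi) ^ CARD('n)) * sq_norm lborel h"
proof -
  define Q where "Q = ennreal ((2 * pi) ^ CARD('n)) * sq_norm lborel h"
  have [measurable]: "W \<in> borel_measurable borel"
    using W by (simp add: tempered_fun_def)
  have cont: "ennreal ((norm (LINT \<xi>|lborel. W \<xi> * s \<xi>))\<^sup>2) \<le> Q * sq_norm lborel s"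
    if s: "bounded_support s" "continuous_on UNIV s" for s
  proof (rule LIMSEQ_le_const2)
    show "(\<lambda>k. ennreal ((norm (LINT \<xi>|lborel. W \<xi> * inv_fourier (mollified_transform ((1 / (3 * real (Suc k)))\<^sup>2 / 4) s) \<xi>))\<^sup>2))
        \<longlonglongrightarrow> ennreal ((norm (LINT \<xi>|lborel. W \<xi> * s \<xi>))\<^sup>2)"
      by (intro tendsto_ennrealI tendsto_power tendsto_norm pairing_mollified_tendsto W s)
    show "\<exists>N. \<forall>k\<ge>N. ennreal ((norm (LINT \<xi>|lborel. W \<xi> * inv_fourier (mollified_transform ((1 / (3 * real (Suc k)))\<^sup>2 / 4) s) \<xi>))\<^sup>2)
        \<le> Q * sq_norm lborel s"
      using pairing_bound_schwartz[OF rep s(1)] by (simp add: Q_def mult_ac)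
  qed
  have general: "ennreal ((norm (LINT \<xi>|lborel. W \<xi> * s \<xi>))\<^sup>2) \<le> Q * sq_norm lborel s"
    if s: "bounded_support s" and Q: "Q < \<infinity>" for s
  proof -
    obtain S B r where S: "\<And>k. bounded_support (S k)" "\<And>k. continuous_on UNIV (S k)"
      and S_le: "\<And>k y. norm (S k y) \<le> B * indicator (cball 0 r) y"
      and S_lim: "AE y in lborel. (\<lambda>k. S k y) \<longlonglongrightarrow> s y"
      using bounded_support_approximation[OF s] by blast
    have [measurable]: "S k \<in> borel_measurable borel" "s \<in> borel_measurable borel" for k
      using S(1) s by (auto simp: bounded_support_def)
    have lim1: "(\<lambda>k. LINT \<xi>|lborel. W \<xi> * S k \<xi>) \<longlonglongrightarrow> (LINT \<xi>|lborel. W \<xi> * s \<xi>)"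
    proof (rule integral_dominated_convergence[where w = "\<lambda>\<xi>. B * (norm (W \<xi>) * indicator (cball 0 r) \<xi>)"])
      show "integrable lborel (\<lambda>\<xi>. B * (norm (W \<xi>) * indicator (cball 0 r) \<xi>))"
        by (intro integrable_mult_right tempered_fun_locally_integrable W)
      show "AE \<xi> in lborel. (\<lambda>k. W \<xi> * S k \<xi>) \<longlonglongrightarrow> W \<xi> * s \<xi>"
        using S_lim by eventually_elim (intro tendsto_intros)
      show "AE \<xi> in lborel. norm (W \<xi> * S k \<xi>) \<le> B * (norm (W \<xi>) * indicator (cball 0 r) \<xi>)" for k
      proof (rule AE_I2)
        fix \<xi>
        show "norm (W \<xi> * S k \<xi>) \<le> B * (norm (W \<xi>) * indicator (cball 0 r) \<xi>)"
          using mult_left_mono[OF S_le[of k \<xi>], of "norm (W \<xi>)"] by (simp add: norm_mult mult_ac)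
      qed
    qed measurable
    have lim2: "(\<lambda>k. \<integral>\<^sup>+x. ennreal ((norm (S k x))\<^sup>2) \<partial>lborel) \<longlonglongrightarrow> sq_norm lborel s"
    proof (rule nn_integral_dominated_convergence[where w = "\<lambda>y. ennreal (B\<^sup>2) * indicator (cball 0 r) y"])
      show "AE y in lborel. ennreal ((norm (S k y))\<^sup>2) \<le> ennreal (B\<^sup>2) * indicator (cball 0 r) y" for k
      proof (rule AE_I2)
        fix y
        show "ennreal ((norm (S k y))\<^sup>2) \<le> ennreal (B\<^sup>2) * indicator (cball 0 r) y"
          using power_mono[OF S_le[of k y], of 2] by (auto split: split_indicator_asm intro!: ennreal_leI)
      qed
      show "(\<integral>\<^sup>+y. ennreal (B\<^sup>2) * indicator (cball 0 r) y \<partial>(lborel :: (real ^ 'n) measure)) < \<infinity>"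
        using emeasure_lborel_cball_finite[of "0 :: real ^ 'n" r]
        by (simp add: nn_integral_cmult_indicator ennreal_mult_less_top)
      show "AE y in lborel. (\<lambda>k. ennreal ((norm (S k y))\<^sup>2)) \<longlonglongrightarrow> ennreal ((norm (s y))\<^sup>2)"
        using S_lim by eventually_elim (intro tendsto_ennrealI tendsto_power tendsto_norm)
    qed (auto intro!: borel_measurable_times_ennreal borel_measurable_indicator)
    have "(\<lambda>k. ennreal ((norm (LINT \<xi>|lborel. W \<xi> * S k \<xi>))\<^sup>2)) \<longlonglongrightarrow> ennreal ((norm (LINT \<xi>|lborel. W \<xi> * s \<xi>))\<^sup>2)"
      by (intro tendsto_ennrealI tendsto_power tendsto_norm lim1)
    moreover have "(\<lambda>k. Q * sq_norm lborel (S k)) \<longlonglongrightarrow> Q * sq_norm lborel s"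
      using Q by (intro ennreal_tendsto_cmult lim2) simp
    ultimately show ?thesis
      by (rule LIMSEQ_le) (use cont S in blast)
  qed
  have "sq_norm lborel W \<le> Q" if Q: "Q < \<infinity>"
  proof -
    define E where "E = (\<lambda>k. {\<xi> :: real ^ 'n. norm \<xi> \<le> real k \<and> norm (W \<xi>) \<le> real k})"
    have [measurable]: "E k \<in> sets borel" for k
      unfolding E_def by measurable
    have piece: "(\<integral>\<^sup>+\<xi>. ennreal ((norm (W \<xi>))\<^sup>2) * indicator (E k) \<xi> \<partial>lborel) \<le> Q" for k
    proof -
      define s where "s = (\<lambda>\<xi>. indicator (E k) \<xi> * cnj (W \<xi>))"
      have s: "bounded_support s"
        unfolding bounded_support_def
      proof (intro conjI exI allI impI)
        show "s \<in> borel_measurable borel"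
          unfolding s_def by measurable
        show "norm (s \<xi>) \<le> real k" for \<xi>
          by (auto simp: s_def E_def norm_mult split: split_indicator)
        show "norm \<xi> \<le> real k" if "s \<xi> \<noteq> 0" for \<xi>
          using that by (auto simp: s_def E_def split: split_indicator_asm)
      qed
      define I where "I = sq_norm lborel s"
      have s_eq: "ennreal ((norm (s \<xi>))\<^sup>2) = ennreal ((norm (W \<xi>))\<^sup>2) * indicator (E k) \<xi>" for \<xi>
        by (simp add: s_def split: split_indicator)
      have sq_int: "integrable lborel (\<lambda>\<xi>. (norm (s \<xi>))\<^sup>2)"
      proof -
        have s': "bounded_support (\<lambda>\<xi>. cnj (s \<xi>) * s \<xi>)"
        proof -
          from s obtain B r where [measurable]: "s \<in> borel_measurable borel"
            and B: "\<And>y. norm (s y) \<le> B" and r: "\<And>y. s y \<noteq> 0 \<Longrightarrow> norm y \<le> r"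
            unfolding bounded_support_def by blast
          have "norm (cnj (s y) * s y) \<le> B * B" for y
            using B[of y] by (auto simp: norm_mult intro!: mult_mono order_trans[OF norm_ge_zero B])
          moreover have "(\<lambda>\<xi>. cnj (s \<xi>) * s \<xi>) \<in> borel_measurable borel"
            by measurable
          ultimately show ?thesis
            unfolding bounded_support_def using r by (metis mult_zero_right)
        qed
        have "(norm (s \<xi>))\<^sup>2 = norm (cnj (s \<xi>) * s \<xi>)" for \<xi>
          by (simp add: norm_mult power2_eq_square)
        then show ?thesis
          using integrable_norm[OF bounded_support_imp_integrable[OF s']] by simp
      qed
      have I_fin: "I < \<infinity>"
        using sq_int by (simp add: I_def nn_integral_eq_integral)
      have "I = ennreal (LINT \<xi>|lborel. (norm (s \<xi>))\<^sup>2)"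
        unfolding I_def by (intro nn_integral_eq_integral sq_int) simp
      also have "\<dots> = ennreal (norm (LINT \<xi>|lborel. complex_of_real ((norm (s \<xi>))\<^sup>2)))"
        unfolding integral_complex_of_real norm_of_real by (simp add: Bochner_Integration.integral_nonneg)
      also have "(\<lambda>\<xi>. complex_of_real ((norm (s \<xi>))\<^sup>2)) = (\<lambda>\<xi>. W \<xi> * s \<xi>)"
        unfolding complex_norm_square by (auto simp: s_def fun_eq_iff split: split_indicator)
      finally have "I\<^sup>2 = ennreal ((norm (LINT \<xi>|lborel. W \<xi> * s \<xi>))\<^sup>2)"
        by (simp add: ennreal_power)
      also have "\<dots> \<le> Q * I"
        unfolding I_def by (rule general[OF s Q])
      finally have le: "I * I \<le> Q * I"
        by (simp add: power2_eq_square)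
      have "I \<le> Q"
        by (rule ennreal_le_cancel[OF le I_fin])
      then show ?thesis
        unfolding I_def s_eq .
    qed
    have "incseq E"
      by (intro incseq_SucI) (auto simp: E_def)
    moreover have "(\<Union>k. E k) = UNIV"
    proof -
      have "\<exists>k. \<xi> \<in> E k" for \<xi>
        using real_arch_simple[of "max (norm \<xi>) (norm (W \<xi>))"] by (auto simp: E_def)
      then show ?thesis
        by auto
    qed
    ultimately show ?thesis
      using piece by - (rule nn_integral_le_exhaustion[of _ _ E], auto)
  qed
  then show ?thesis
    unfolding Q_def[symmetric] by (cases "Q < \<infinity>") (auto simp: less_top[symmetric])
qed

section \<open>Representation of the half-wave flow\<close>

lemma inv_fourier_measurable [measurable]:
  assumes [measurable]: "\<phi> \<in> borel_measurable borel"
  shows "inv_fourier \<phi> \<in> borel_measurable borel"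
  unfolding inv_fourier_def by measurable

lemma inv_fourier_norm_bound:
  fixes \<phi> :: "real ^ 'n::finite \<Rightarrow> complex"
  assumes "integrable lborel \<phi>"
  shows "norm (inv_fourier \<phi> \<xi>) \<le> 1 / (2 * pi) ^ CARD('n) * (LINT x|lborel. norm (\<phi> x))"
proof -
  have "norm (LINT x|lborel. cis (\<xi> \<bullet> x) * \<phi> x) \<le> (LINT x|lborel. norm (\<phi> x))"
    by (rule order_trans[OF integral_norm_bound]) (simp add: norm_mult)
  then show ?thesis
    unfolding inv_fourier_def norm_mult norm_of_real by (intro mult_mono) auto
qed

text \<open>
  Near the origin \<open>G\<close> is locally integrable and the inverse transform bounded; away from it \<open>|G|\<close> is at most
  \<open>|\<xi>| powr \<sigma> |G|\<close>, so that both factors are square integrable by Bessel's inequality.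
\<close>

lemma energy_pairing_integrable:
  fixes G \<phi> :: "real ^ 'n::finite \<Rightarrow> complex"
  assumes G: "tempered_fun G" and fin: "weighted_energy \<sigma> G < \<infinity>" and \<sigma>: "\<sigma> \<ge> 0"
    and \<phi>: "schwartz \<phi>"
  shows "integrable lborel (\<lambda>\<xi>. G \<xi> * inv_fourier \<phi> \<xi>)"
proof (rule integrableI_bounded)
  have [measurable]: "G \<in> borel_measurable borel" "\<phi> \<in> borel_measurable borel"
    using G schwartz_measurable[OF \<phi>] by (auto simp: tempered_fun_def)
  define M where "M = 1 / (2 * pi) ^ CARD('n) * (LINT x|lborel. norm (\<phi> x))"
  have M: "M \<ge> 0"
    unfolding M_def by (intro mult_nonneg_nonneg Bochner_Integration.integral_nonneg) auto
  have "(\<integral>\<^sup>+\<xi>. ennreal (norm (G \<xi> * inv_fourier \<phi> \<xi>)) \<partial>lborel) \<le>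
      (\<integral>\<^sup>+\<xi>. ennreal M * ennreal (norm (norm (G \<xi>) * indicator (cball 0 1) \<xi>))
        + (ennreal ((norm \<xi> powr \<sigma> * norm (G \<xi>))\<^sup>2) + ennreal ((norm (inv_fourier \<phi> \<xi>))\<^sup>2)) \<partial>lborel)"
  proof (rule nn_integral_mono)
    fix \<xi> :: "real ^ 'n"
    let ?g = "norm (G \<xi>)" and ?p = "norm (inv_fourier \<phi> \<xi>)"
    have "?g * ?p \<le> M * (?g * indicator (cball 0 1) \<xi>) + ((norm \<xi> powr \<sigma> * ?g)\<^sup>2 + ?p\<^sup>2)"
    proof (cases "norm \<xi> \<le> 1")
      case True
      have "?g * ?p \<le> ?g * M"
        unfolding M_def by (intro mult_left_mono inv_fourier_norm_bound schwartz_integrable \<phi>) simp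
      then show ?thesis
        using True by (simp add: mult.commute add_increasing2)
    next
      case False
      then have "1 \<le> norm \<xi> powr \<sigma>"
        using \<sigma> by (intro ge_one_powr_ge_zero) auto
      then have "?g * ?p \<le> (norm \<xi> powr \<sigma> * ?g) * ?p"
        by (intro mult_right_mono) (auto simp: mult_le_cancel_right1)
      also have "\<dots> \<le> (norm \<xi> powr \<sigma> * ?g)\<^sup>2 + ?p\<^sup>2"
      proof -
        have "0 \<le> (norm \<xi> powr \<sigma> * ?g) * ?p"
          by simp
        then show ?thesis
          using sum_squares_bound[of "norm \<xi> powr \<sigma> * ?g" ?p] unfolding mult.assoc by linarith
      qed
      finally show ?thesis
        using False by simp
    qed
    then show "ennreal (norm (G \<xi> * inv_fourier \<phi> \<xi>)) \<le>
      ennreal M * ennreal (norm (?g * indicator (cball 0 1) \<xi>)) + (ennreal ((norm \<xi> powr \<sigma> * ?g)\<^sup>2) + ennreal (?p\<^sup>2))"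
      using M by (simp add: norm_mult ennreal_mult[symmetric] ennreal_plus[symmetric] abs_mult ennreal_leI del: ennreal_plus)
  qed
  also have "\<dots> = ennreal M * (\<integral>\<^sup>+\<xi>. ennreal (norm (norm (G \<xi>) * indicator (cball 0 1) \<xi>)) \<partial>lborel)
      + (weighted_energy \<sigma> G + sq_norm lborel (inv_fourier \<phi>))"
  proof -
    have [measurable]: "cball (0 :: real ^ 'n) 1 \<in> sets borel"
      by simp
    show ?thesis
      unfolding weighted_energy_def by (simp add: nn_integral_add nn_integral_cmult)
  qed
  also have "\<dots> < \<infinity>"
  proof -
    have "(\<integral>\<^sup>+\<xi>. ennreal (norm (norm (G \<xi>) * indicator (cball 0 1) \<xi>)) \<partial>lborel) < \<infinity>"
      using tempered_fun_locally_integrable[OF G, of 1] unfolding integrable_iff_bounded by blast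
    moreover have "sq_norm lborel (inv_fourier \<phi>) < \<infinity>"
    proof (rule order.strict_trans1[OF inv_fourier_bessel[OF schwartz_integrable[OF \<phi>]]])
      show "ennreal (1 / (2 * pi) ^ CARD('n)) * sq_norm lborel \<phi> < \<infinity>"
        using schwartz_square_integrable[OF \<phi>] by (simp add: ennreal_mult_less_top)
    qed
    ultimately show ?thesis
      using fin by (simp add: ennreal_mult_less_top)
  qed
  finally show "(\<integral>\<^sup>+\<xi>. ennreal (norm (G \<xi> * inv_fourier \<phi> \<xi>)) \<partial>lborel) < \<infinity>" .
  show "(\<lambda>\<xi>. G \<xi> * inv_fourier \<phi> \<xi>) \<in> borel_measurable lborel"
    by measurable
qed

lemma wave_pairing:
  fixes g \<phi> :: "real ^ 'n::finite \<Rightarrow> complex"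
  assumes g: "integrable lborel g" and \<phi>: "integrable lborel \<phi>"
  shows "(LINT \<xi>|lborel. cis (t * norm \<xi>) * g \<xi> * inv_fourier \<phi> \<xi>)
    = (LINT x|lborel. complex_of_real (1 / (2 * pi) ^ CARD('n)) * wave g t x * \<phi> x)"
proof -
  have [measurable]: "g \<in> borel_measurable borel" "\<phi> \<in> borel_measurable borel"
    using g \<phi> by auto
  define c where "c = complex_of_real (1 / (2 * pi) ^ CARD('n))"
  define F where "F = (\<lambda>x \<xi>. c * \<phi> x * (g \<xi> * cis (x \<bullet> \<xi> + t * norm \<xi>)))"
  have "integrable (lborel \<Otimes>\<^sub>M lborel) (\<lambda>(x, \<xi>). (c * \<phi> x) * g \<xi> * cis (x \<bullet> \<xi> + t * norm \<xi>))"
    by (rule lborel_pair.integrable_tensor_kernel) (use \<phi> g in simp_all)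
  then have F_int: "integrable (lborel \<Otimes>\<^sub>M lborel) (case_prod F)"
    by (simp add: F_def mult_ac)
  have "(LINT \<xi>|lborel. cis (t * norm \<xi>) * g \<xi> * inv_fourier \<phi> \<xi>) = (LINT \<xi>|lborel. LINT x|lborel. F x \<xi>)"
  proof (rule Bochner_Integration.integral_cong[OF refl])
    fix \<xi> :: "real ^ 'n"
    have "F x \<xi> = (c * cis (t * norm \<xi>) * g \<xi>) * (cis (\<xi> \<bullet> x) * \<phi> x)" for x
      by (simp add: F_def inner_commute cis_mult[symmetric] mult_ac)
    then show "cis (t * norm \<xi>) * g \<xi> * inv_fourier \<phi> \<xi> = (LINT x|lborel. F x \<xi>)"
      by (simp add: inv_fourier_def c_def)
  qed
  also have "\<dots> = (LINT x|lborel. LINT \<xi>|lborel. F x \<xi>)"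
    by (rule lborel_pair.Fubini_integral[OF F_int])
  also have "\<dots> = (LINT x|lborel. c * wave g t x * \<phi> x)"
    by (simp add: F_def wave_def mult_ac)
  finally show ?thesis
    unfolding c_def .
qed

lemma dyadic_piece_partial_sums:
  fixes G :: "'a::euclidean_space \<Rightarrow> complex"
  assumes R: "R > 0"
  shows "norm (\<Sum>j<m. dyadic_piece R G j y) \<le> norm (G y)"
    and "y \<noteq> 0 \<Longrightarrow> (\<lambda>m. \<Sum>j<m. dyadic_piece R G j y) \<longlonglongrightarrow> G y"
proof -
  have in_shell: "(\<Sum>j<m. dyadic_piece R G j y) = (if i < m then G y else 0)" if i: "y \<in> dyadic_shell R i" for i m
  proof -
    have "dyadic_piece R G j y = (if j = i then G y else 0)" for j
      using i dyadic_shell_disjoint[OF R] by (auto simp: dyadic_piece_def disjoint_family_on_def split: split_indicator)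
    then show ?thesis
      by simp
  qed
  show "norm (\<Sum>j<m. dyadic_piece R G j y) \<le> norm (G y)"
  proof (cases "\<exists>i. y \<in> dyadic_shell R i")
    case True
    then show ?thesis
      using in_shell by auto
  next
    case False
    then show ?thesis
      by (simp add: dyadic_piece_def)
  qed
  show "(\<lambda>m. \<Sum>j<m. dyadic_piece R G j y) \<longlonglongrightarrow> G y" if nonzero: "y \<noteq> 0"
  proof -
    obtain i where i: "y \<in> dyadic_shell R i"
      using dyadic_shell_cover[OF R nonzero] by blast
    have "\<forall>\<^sub>F m in sequentially. (\<Sum>j<m. dyadic_piece R G j y) = G y"
      using eventually_gt_at_top[of i] by eventually_elim (simp add: in_shell[OF i])
    then show ?thesis
      by (rule tendsto_eventually)
  qed
qed

text \<open>
  If \<open>\<Sum>j. U j\<close> is finite, the flows of the dyadic pieces sum to a bounded function \<open>h\<close>, uniformly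
  in \<open>x\<close>. It represents the flow of \<open>f\<close>, since both sides of the pairing with a Schwartz function are
  limits of the pairings of the partial sums, by dominated convergence. If the sum is infinite, there is
  nothing to prove; so no null set of times has to be discarded.
\<close>

lemma half_wave_sup_bound:
  fixes f :: "'n::finite distr"
  defines "G \<equiv> fourier_fun f"
  assumes G: "tempered_fun G" and fin: "weighted_energy \<sigma> G < \<infinity>" and \<sigma>: "\<sigma> \<ge> 0"
    and R: "R > 0"
    and U: "\<And>j x. ennreal (norm (wave (dyadic_piece R G j) t x)) \<le> U j"
  shows "distr_Lp_norm \<infinity> (half_wave t f) \<le> ennreal (1 / (2 * pi) ^ CARD('n)) * (\<Sum>j. U j)"
proof (cases "(\<Sum>j. U j) = \<infinity>")
  case True
  then show ?thesis
    by (simp add: ennreal_mult_top)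
next
  case False
  define c where "c = 1 / (2 * pi) ^ CARD('n)"
  have c: "c > 0"
    by (simp add: c_def)
  have [measurable]: "G \<in> borel_measurable borel"
    using G by (simp add: tempered_fun_def)
  have U_fin: "U j < \<infinity>" for j
    using False ennreal_suminf_lessD[of U \<infinity> j] by (simp add: less_top)
  define u where "u = (\<lambda>j. enn2real (U j))"
  have u: "U j = ennreal (u j)" "u j \<ge> 0" for j
    using U_fin[of j] by (simp_all add: u_def)
  have u_sum: "summable u"
    using False u by (intro summable_suminf_not_top) auto
  let ?w = "\<lambda>j x. wave (dyadic_piece R G j) t x"
  have w_le: "norm (?w j x) \<le> u j" for j x
    using U[of j x] u[of j] by simp
  have piece_int: "integrable lborel (dyadic_piece R G j)" for j
    using fin by (intro dyadic_piece_integrable[OF _ R]) auto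
  have w_meas [measurable]: "?w j \<in> borel_measurable borel" for j
    by (rule borel_measurable_continuous_onI[OF wave_continuous[OF piece_int]])
  define h where "h = (\<lambda>x. complex_of_real c * (\<Sum>j. ?w j x))"
  have w_summable: "summable (\<lambda>j. norm (?w j x))" for x
    by (rule summable_comparison_test'[OF u_sum, of 0]) (simp add: w_le)
  have h_meas [measurable]: "h \<in> borel_measurable borel"
    unfolding h_def by measurable
  have h_le: "norm (h x) \<le> c * (\<Sum>j. u j)" for x
  proof -
    have "norm (\<Sum>j. ?w j x) \<le> (\<Sum>j. norm (?w j x))"
      by (rule summable_norm[OF w_summable])
    also have "\<dots> \<le> (\<Sum>j. u j)"
      by (intro suminf_le w_le w_summable u_sum)
    finally show ?thesis
      using c by (simp add: h_def norm_mult)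
  qed
  have h_tempered: "tempered_fun h"
    unfolding tempered_fun_def
  proof (intro conjI allI impI)
    fix \<phi> :: "real ^ 'n \<Rightarrow> complex" assume \<phi>: "schwartz \<phi>"
    have [measurable]: "\<phi> \<in> borel_measurable borel"
      by (rule schwartz_measurable[OF \<phi>])
    show "integrable lborel (\<lambda>x. h x * \<phi> x)"
    proof (rule Bochner_Integration.integrable_bound)
      show "integrable lborel (\<lambda>x. c * (\<Sum>j. u j) * norm (\<phi> x))"
        by (intro integrable_mult_right integrable_norm schwartz_integrable \<phi>)
      show "AE x in lborel. norm (h x * \<phi> x) \<le> norm (c * (\<Sum>j. u j) * norm (\<phi> x))"
      proof (rule AE_I2)
        fix x
        have "norm (h x) * norm (\<phi> x) \<le> c * (\<Sum>j. u j) * norm (\<phi> x)"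
          by (intro mult_right_mono h_le) simp
        then show "norm (h x * \<phi> x) \<le> norm (c * (\<Sum>j. u j) * norm (\<phi> x))"
          unfolding norm_mult real_norm_def by linarith
      qed
    qed measurable
  qed simp
  have "distr_eq (half_wave t f) (distr_of_fun h)"
    unfolding distr_eq_def
  proof (intro allI impI)
    fix \<phi> :: "real ^ 'n \<Rightarrow> complex" assume \<phi>: "schwartz \<phi>"
    have \<phi>_int: "integrable lborel \<phi>"
      by (rule schwartz_integrable[OF \<phi>])
    have [measurable]: "\<phi> \<in> borel_measurable borel"
      by (rule schwartz_measurable[OF \<phi>])
    have bdd_inv: "\<exists>B. \<forall>\<xi>. norm (inv_fourier \<phi> \<xi>) \<le> B"
      using inv_fourier_norm_bound[OF \<phi>_int] by blast
    have piece_pair_int: "integrable lborel (\<lambda>\<xi>. cis (t * norm \<xi>) * dyadic_piece R G j \<xi> * inv_fourier \<phi> \<xi>)" for j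
    proof -
      obtain B where B: "\<And>\<xi>. norm (inv_fourier \<phi> \<xi>) \<le> B"
        using bdd_inv by blast
      show ?thesis
      proof (rule Bochner_Integration.integrable_bound)
        show "integrable lborel (\<lambda>\<xi>. norm (dyadic_piece R G j \<xi>) * B)"
          by (intro integrable_mult_left integrable_norm piece_int)
        show "AE \<xi> in lborel. norm (cis (t * norm \<xi>) * dyadic_piece R G j \<xi> * inv_fourier \<phi> \<xi>)
            \<le> norm (norm (dyadic_piece R G j \<xi>) * B)"
        proof (rule AE_I2)
          fix \<xi> :: "real ^ 'n"
          have "norm (dyadic_piece R G j \<xi>) * norm (inv_fourier \<phi> \<xi>) \<le> norm (dyadic_piece R G j \<xi>) * B"
            by (intro mult_left_mono B) simp
          then show "norm (cis (t * norm \<xi>) * dyadic_piece R G j \<xi> * inv_fourier \<phi> \<xi>)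
            \<le> norm (norm (dyadic_piece R G j \<xi>) * B)"
            by (simp add: norm_mult)
        qed
      qed measurable
    qed
    have wave_pair_int: "integrable lborel (\<lambda>x. complex_of_real c * ?w j x * \<phi> x)" for j
    proof (rule Bochner_Integration.integrable_bound)
      show "integrable lborel (\<lambda>x. c * u j * norm (\<phi> x))"
        by (intro integrable_mult_right integrable_norm \<phi>_int)
      show "AE x in lborel. norm (complex_of_real c * ?w j x * \<phi> x) \<le> norm (c * u j * norm (\<phi> x))"
        using c u(2) w_le by (auto simp: norm_mult abs_mult intro!: mult_right_mono)
    qed measurable
    have partial: "(LINT \<xi>|lborel. (cis (t * norm \<xi>) * (\<Sum>j<m. dyadic_piece R G j \<xi>)) * inv_fourier \<phi> \<xi>)
        = (LINT x|lborel. (complex_of_real c * (\<Sum>j<m. ?w j x)) * \<phi> x)" for m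
    proof -
      have "(LINT \<xi>|lborel. (cis (t * norm \<xi>) * (\<Sum>j<m. dyadic_piece R G j \<xi>)) * inv_fourier \<phi> \<xi>)
          = (\<Sum>j<m. LINT \<xi>|lborel. cis (t * norm \<xi>) * dyadic_piece R G j \<xi> * inv_fourier \<phi> \<xi>)"
        unfolding sum_distrib_left sum_distrib_right
        by (intro Bochner_Integration.integral_sum piece_pair_int)
      also have "\<dots> = (\<Sum>j<m. LINT x|lborel. complex_of_real c * ?w j x * \<phi> x)"
        unfolding c_def by (intro sum.cong refl wave_pairing piece_int \<phi>_int)
      also have "\<dots> = (LINT x|lborel. (complex_of_real c * (\<Sum>j<m. ?w j x)) * \<phi> x)"
        unfolding sum_distrib_left sum_distrib_right
        by (intro Bochner_Integration.integral_sum[symmetric] wave_pair_int)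
      finally show ?thesis .
    qed
    have lim_freq: "(\<lambda>m. LINT \<xi>|lborel. (cis (t * norm \<xi>) * (\<Sum>j<m. dyadic_piece R G j \<xi>)) * inv_fourier \<phi> \<xi>)
        \<longlonglongrightarrow> (LINT \<xi>|lborel. (cis (t * norm \<xi>) * G \<xi>) * inv_fourier \<phi> \<xi>)"
    proof (rule integral_dominated_convergence[where w = "\<lambda>\<xi>. norm (G \<xi> * inv_fourier \<phi> \<xi>)"])
      show "integrable lborel (\<lambda>\<xi>. norm (G \<xi> * inv_fourier \<phi> \<xi>))"
        by (intro integrable_norm energy_pairing_integrable[OF G fin \<sigma> \<phi>])
      have "AE \<xi> in lborel. \<xi> \<noteq> (0 :: real ^ 'n)"
        by (rule AE_lborel_singleton)
      then show "AE \<xi> in lborel. (\<lambda>m. (cis (t * norm \<xi>) * (\<Sum>j<m. dyadic_piece R G j \<xi>)) * inv_fourier \<phi> \<xi>)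
          \<longlonglongrightarrow> (cis (t * norm \<xi>) * G \<xi>) * inv_fourier \<phi> \<xi>"
        by eventually_elim (intro tendsto_intros dyadic_piece_partial_sums(2)[OF R])
      show "AE \<xi> in lborel. norm ((cis (t * norm \<xi>) * (\<Sum>j<m. dyadic_piece R G j \<xi>)) * inv_fourier \<phi> \<xi>)
          \<le> norm (G \<xi> * inv_fourier \<phi> \<xi>)" for m
        by (intro AE_I2) (simp add: norm_mult mult_right_mono dyadic_piece_partial_sums(1)[OF R])
    qed measurable
    have lim_space: "(\<lambda>m. LINT x|lborel. (complex_of_real c * (\<Sum>j<m. ?w j x)) * \<phi> x) \<longlonglongrightarrow> (LINT x|lborel. h x * \<phi> x)"
    proof (rule integral_dominated_convergence[where w = "\<lambda>x. c * (\<Sum>j. u j) * norm (\<phi> x)"])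
      show "integrable lborel (\<lambda>x. c * (\<Sum>j. u j) * norm (\<phi> x))"
        by (intro integrable_mult_right integrable_norm \<phi>_int)
      show "AE x in lborel. (\<lambda>m. (complex_of_real c * (\<Sum>j<m. ?w j x)) * \<phi> x) \<longlonglongrightarrow> h x * \<phi> x"
        unfolding h_def by (intro AE_I2 tendsto_mult tendsto_const summable_LIMSEQ summable_norm_cancel[OF w_summable])
      show "AE x in lborel. norm ((complex_of_real c * (\<Sum>j<m. ?w j x)) * \<phi> x) \<le> c * (\<Sum>j. u j) * norm (\<phi> x)" for m
      proof (rule AE_I2)
        fix x
        have "norm (\<Sum>j<m. ?w j x) \<le> (\<Sum>j<m. u j)"
          by (rule sum_norm_le) (rule w_le)
        also have "\<dots> \<le> (\<Sum>j. u j)"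
          using u(2) by (intro sum_le_suminf u_sum) auto
        finally have "c * norm (\<Sum>j<m. ?w j x) * norm (\<phi> x) \<le> c * (\<Sum>j. u j) * norm (\<phi> x)"
          using c by (intro mult_right_mono mult_left_mono) auto
        then show "norm ((complex_of_real c * (\<Sum>j<m. ?w j x)) * \<phi> x) \<le> c * (\<Sum>j. u j) * norm (\<phi> x)"
          using c by (simp add: norm_mult)
      qed
    qed measurable
    have "(LINT \<xi>|lborel. (cis (t * norm \<xi>) * G \<xi>) * inv_fourier \<phi> \<xi>) = (LINT x|lborel. h x * \<phi> x)"
      using LIMSEQ_unique[OF lim_freq lim_space[folded partial]] .
    then show "half_wave t f \<phi> = distr_of_fun h \<phi>"
      by (simp add: half_wave_def multiplier_def inv_fourier_distr_def distr_of_fun_def G_def)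
  qed
  then have "is_fun (half_wave t f) h"
    using h_tempered by (simp add: is_fun_def)
  then have "distr_Lp_norm \<infinity> (half_wave t f) \<le> Lp_norm \<infinity> lborel (\<lambda>x. ennreal (norm (h x)))"
    unfolding distr_Lp_norm_def by (intro INF_lower) simp
  also have "\<dots> \<le> ennreal (c * (\<Sum>j. u j))"
    unfolding Lp_norm_def by (auto intro!: esssup_I AE_I2 ennreal_leI h_le)
  also have "\<dots> = ennreal c * (\<Sum>j. U j)"
    using c u u_sum by (simp add: ennreal_mult suminf_nonneg suminf_ennreal2)
  finally show ?thesis
    unfolding c_def .
qed

section \<open>Homogeneous Sobolev norms and the interpolated estimate\<close>

lemma ennreal_powr_mono: "x \<le> y \<Longrightarrow> a > 0 \<Longrightarrow> ennreal_powr x a \<le> ennreal_powr y a"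
  unfolding ennreal_powr_def
  by (cases x; cases y) (auto simp: top_unique intro!: ennreal_leI powr_mono2)

lemma ennreal_powr_2: "ennreal_powr x 2 = x\<^sup>2"
  unfolding ennreal_powr_def by (cases x) (auto simp: ennreal_power powr_numeral power2_eq_square ennreal_top_mult ennreal_mult)

lemma ennreal_powr_half_square: "(ennreal_powr x (1 / 2))\<^sup>2 = x"
  unfolding ennreal_powr_def by (cases x) (auto simp: ennreal_power powr_half_sqrt power2_eq_square ennreal_top_mult ennreal_mult[symmetric])

text \<open>
  The dual form of Plancherel's theorem, applied to every function representing \<open>D\<^sup>s f\<close>.
\<close>

lemma weighted_energy_le_hom_sobolev_norm:
  fixes f :: "'n::finite distr"
  assumes dom: "multiplier_dom (Dpow s) f"
  shows "weighted_energy s (fourier_fun f) \<le> ennreal ((2 * pi) ^ CARD('n)) * (hom_sobolev_norm s f)\<^sup>2"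
proof -
  define W where "W = (\<lambda>\<xi>. Dpow s (norm \<xi>) * fourier_fun f \<xi>)"
  define P where "P = (2 * pi) ^ CARD('n)"
  have P: "P > 0"
    by (simp add: P_def)
  have W: "tempered_fun W"
    using dom by (simp add: multiplier_dom_def W_def)
  have energy: "weighted_energy s (fourier_fun f) = sq_norm lborel W"
    by (simp add: weighted_energy_def W_def Dpow_def norm_mult)
  define e where "e = weighted_energy s (fourier_fun f) / ennreal P"
  have "ennreal_powr e (1 / 2) \<le> Lp_norm 2 lborel (\<lambda>x. ennreal (norm (h x)))"
    if h: "is_fun (multiplier (Dpow s) f) h" for h
  proof -
    have "is_fun (inv_fourier_distr (distr_of_fun W)) h"
      using h by (simp add: multiplier_def W_def)
    from plancherel_dual[OF W this]
    have "e \<le> ennreal P * sq_norm lborel h / ennreal P"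
      unfolding e_def energy P_def by (rule divide_right_mono_ennreal)
    also have "\<dots> = (\<integral>\<^sup>+x. ennreal_powr (ennreal (norm (h x))) 2 \<partial>lborel)"
      using P by (simp add: ennreal_powr_2 ennreal_power mult.commute[of "ennreal P"] ennreal_mult_divide_eq)
    finally show ?thesis
      by (auto simp: Lp_norm_def intro: ennreal_powr_mono)
  qed
  then have "ennreal_powr e (1 / 2) \<le> hom_sobolev_norm s f"
    using dom by (auto simp: hom_sobolev_norm_def distr_Lp_norm_def intro!: INF_greatest)
  then have "e \<le> (hom_sobolev_norm s f)\<^sup>2"
    using power_mono[of "ennreal_powr e (1 / 2)" "hom_sobolev_norm s f" 2] by (simp add: ennreal_powr_half_square)
  then have "ennreal P * e \<le> ennreal P * (hom_sobolev_norm s f)\<^sup>2"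
    by (rule mult_left_mono) simp
  then show ?thesis
    using P by (simp add: e_def P_def ennreal_times_divide mult.commute[of _ "weighted_energy s (fourier_fun f)"] ennreal_mult_divide_eq)
qed

lemma weighted_energy_eq_0_iff:
  fixes G :: "real ^ 'n::finite \<Rightarrow> complex"
  assumes [measurable]: "G \<in> borel_measurable borel"
  shows "weighted_energy s G = 0 \<longleftrightarrow> (AE \<xi> in lborel. G \<xi> = 0)"
proof -
  have "AE \<xi> in lborel. \<xi> \<noteq> (0 :: real ^ 'n)"
    by (rule AE_lborel_singleton)
  then have "AE \<xi> in lborel. ennreal ((norm \<xi> powr s * norm (G \<xi>))\<^sup>2) = 0 \<longleftrightarrow> G \<xi> = 0"
    by eventually_elim simp
  then have "(AE \<xi> in lborel. ennreal ((norm \<xi> powr s * norm (G \<xi>))\<^sup>2) = 0) \<longleftrightarrow> (AE \<xi> in lborel. G \<xi> = 0)"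
    by (rule eventually_subst)
  then show ?thesis
    unfolding weighted_energy_def by (subst nn_integral_0_iff_AE) measurable
qed

text \<open>
  Used to exclude, when the norm of higher order vanishes, that the one of lower order is infinite.
\<close>

lemma hom_sobolev_norm_eq_0:
  fixes f :: "'n::finite distr"
  assumes f: "tempered f" "\<exists>g. is_fun (fourier_distr f) g"
    and G [measurable]: "fourier_fun f \<in> borel_measurable borel" and zero: "AE \<xi> in lborel. fourier_fun f \<xi> = 0"
  shows "hom_sobolev_norm s f = 0"
proof -
  define W where "W = (\<lambda>\<xi>. Dpow s (norm \<xi>) * fourier_fun f \<xi>)"
  have [measurable]: "W \<in> borel_measurable borel"
    unfolding W_def Dpow_def by measurable
  have W0: "AE \<xi> in lborel. W \<xi> * p \<xi> = 0" for p
    using zero by eventually_elim (simp add: W_def)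
  have "integrable lborel (\<lambda>\<xi>. W \<xi> * \<phi> \<xi>)" if "schwartz \<phi>" for \<phi>
  proof -
    have [measurable]: "\<phi> \<in> borel_measurable borel"
      by (rule schwartz_measurable[OF that])
    show ?thesis
      by (rule integrable_cong_AE_imp[of _ "\<lambda>_. 0"]) (use W0[of \<phi>] in \<open>auto elim: eventually_mono\<close>)
  qed
  then have dom: "multiplier_dom (Dpow s) f"
    using f unfolding multiplier_dom_def tempered_fun_def W_def[symmetric] by auto
  have "(LINT \<xi>|lborel. W \<xi> * p \<xi>) = 0" for p
    using integral_eq_zero_AE[OF W0[of p]] .
  then have "is_fun (multiplier (Dpow s) f) (\<lambda>_. 0)"
    by (simp add: is_fun_def tempered_fun_def distr_eq_def multiplier_def inv_fourier_distr_def distr_of_fun_def W_def)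
  then have "distr_Lp_norm 2 (multiplier (Dpow s) f) \<le> Lp_norm 2 lborel (\<lambda>x :: real ^ 'n. ennreal (norm (0 :: complex)))"
    unfolding distr_Lp_norm_def by (intro INF_lower) simp
  also have "\<dots> = 0"
    by (simp add: Lp_norm_def ennreal_powr_def)
  finally show ?thesis
    using dom by (simp add: hom_sobolev_norm_def)
qed

text \<open>
  The estimate at a fixed frequency \<open>R\<close>, which separates the part of \<open>G\<close> that is controlled by the lower
  Sobolev norm from the part controlled by the higher one.
\<close>

lemma mixed_norm_le:
  fixes f :: "'n::finite distr"
  defines "G \<equiv> fourier_fun f"
  assumes dim: "CARD('n) \<ge> 4" and R: "R > 0" and e: "e > 0" and d: "d > 0"
    and b: "b = (real CARD('n) - 1) / 2" and e_le: "e \<le> b"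
    and G: "tempered_fun G"
    and fin: "weighted_energy (b - e) G < \<infinity>"
  shows "mixed_norm 2 \<infinity> (\<lambda>t. half_wave t f) \<le> ennreal_powr (ennreal ((1 / (2 * pi) ^ CARD('n))\<^sup>2 *
      ((\<Sum>j. dyadic_weight e d j) * strichartz_const CARD('n))) *
    (ennreal (R powr (2 * e)) * weighted_energy (b - e) G + ennreal (R powr (- 2 * d)) * weighted_energy (b + d) G)) (1 / 2)"
proof -
  define c where "c = 1 / (2 * pi) ^ CARD('n)"
  have c: "c > 0"
    by (simp add: c_def)
  define K where "K = (\<Sum>j. dyadic_weight e d j) * strichartz_const CARD('n)"
  define X where "X = ennreal (R powr (2 * e)) * weighted_energy (b - e) G
      + ennreal (R powr (- 2 * d)) * weighted_energy (b + d) G"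
  have [measurable]: "G \<in> borel_measurable borel"
    using G by (simp add: tempered_fun_def)
  have dim': "DIM(real ^ 'n) \<ge> 4" "b = (real DIM(real ^ 'n) - 1) / 2"
    using dim b by simp_all
  obtain U :: "nat \<Rightarrow> real \<Rightarrow> ennreal" where U [measurable]: "\<And>j. U j \<in> borel_measurable borel"
    and U_ge: "\<And>j t x. ennreal (norm (wave (dyadic_piece R G j) t x)) \<le> U j t"
    and U_int: "(\<integral>\<^sup>+t. (\<Sum>j. U j t)\<^sup>2 \<partial>lborel) \<le> ennreal K * X"
    using dyadic_strichartz[OF dim'(1) R e d dim'(2) e_le _ fin] by (auto simp: K_def X_def)
  have "(\<integral>\<^sup>+t. (distr_Lp_norm \<infinity> (half_wave t f))\<^sup>2 \<partial>lborel) \<le> (\<integral>\<^sup>+t. ennreal (c\<^sup>2) * (\<Sum>j. U j t)\<^sup>2 \<partial>lborel)"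
  proof (rule nn_integral_mono)
    fix t
    have "distr_Lp_norm \<infinity> (half_wave t f) \<le> ennreal c * (\<Sum>j. U j t)"
      unfolding c_def using e_le
      by (intro half_wave_sup_bound[OF G[unfolded G_def] fin[unfolded G_def] _ R U_ge[unfolded G_def]]) simp
    then have "(distr_Lp_norm \<infinity> (half_wave t f))\<^sup>2 \<le> (ennreal c * (\<Sum>j. U j t))\<^sup>2"
      by (rule power_mono) simp
    then show "(distr_Lp_norm \<infinity> (half_wave t f))\<^sup>2 \<le> ennreal (c\<^sup>2) * (\<Sum>j. U j t)\<^sup>2"
      using c by (simp add: power_mult_distrib ennreal_power)
  qed
  also have "\<dots> = ennreal (c\<^sup>2) * (\<integral>\<^sup>+t. (\<Sum>j. U j t)\<^sup>2 \<partial>lborel)"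
    by (rule nn_integral_cmult) measurable
  also have "\<dots> \<le> ennreal (c\<^sup>2) * (ennreal K * X)"
    by (intro mult_left_mono U_int) simp
  also have "\<dots> = ennreal (c\<^sup>2 * K) * X"
    by (simp add: ennreal_mult' mult.assoc)
  finally have "(\<integral>\<^sup>+t. ennreal_powr (distr_Lp_norm \<infinity> (half_wave t f)) 2 \<partial>lborel) \<le> ennreal (c\<^sup>2 * K) * X"
    by (simp add: ennreal_powr_2)
  then have "ennreal_powr (\<integral>\<^sup>+t. ennreal_powr (distr_Lp_norm \<infinity> (half_wave t f)) 2 \<partial>lborel) (1 / 2)
      \<le> ennreal_powr (ennreal (c\<^sup>2 * K) * X) (1 / 2)"
    by (rule ennreal_powr_mono) simp
  then show ?thesis
    unfolding mixed_norm_def Lp_norm_def K_def X_def c_def by simp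
qed

text \<open>
  The frequency at which the contributions of the two norms are equal; the balance produces the
  exponents \<open>\<theta>\<close> and \<open>1 - \<theta>\<close>.
\<close>

lemma balanced_scale:
  fixes A B e d \<theta> :: real
  assumes "A > 0" "B > 0" "e > 0" "d > 0" and \<theta>: "d = (d + e) * \<theta>"
  obtains R where "R > 0" "R powr (2 * e) * A\<^sup>2 = (A powr \<theta> * B powr (1 - \<theta>))\<^sup>2"
    "R powr (- 2 * d) * B\<^sup>2 = (A powr \<theta> * B powr (1 - \<theta>))\<^sup>2"
proof
  define R where "R = (B / A) powr (1 / (d + e))"
  show "R > 0"
    using assms by (simp add: R_def)
  have \<theta>': "\<theta> = d / (d + e)"
    using assms by (simp add: field_simps)
  have exp_e: "1 / (d + e) * (2 * e) = 2 * (1 - \<theta>)"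
    using assms unfolding \<theta>' by (simp add: field_simps)
  have exp_d: "1 / (d + e) * (- 2 * d) = - 2 * \<theta>"
    unfolding \<theta>' by simp
  have target: "(A powr \<theta> * B powr (1 - \<theta>))\<^sup>2 = A powr (2 * \<theta>) * B powr (2 * (1 - \<theta>))"
    by (simp only: power_mult_distrib) (simp only: power2_eq_square powr_add[symmetric] mult_2)
  have "R powr (2 * e) * A\<^sup>2 = B powr (2 * (1 - \<theta>)) * (A powr 2 / A powr (2 * (1 - \<theta>)))"
    unfolding R_def powr_powr exp_e using assms by (simp add: powr_divide)
  also have "A powr 2 / A powr (2 * (1 - \<theta>)) = A powr (2 * \<theta>)"
    unfolding powr_diff[symmetric] by simp
  finally show "R powr (2 * e) * A\<^sup>2 = (A powr \<theta> * B powr (1 - \<theta>))\<^sup>2"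
    unfolding target by (simp add: mult.commute)
  have "R powr (- 2 * d) * B\<^sup>2 = (B powr 2 * B powr (- 2 * \<theta>)) / A powr (- 2 * \<theta>)"
    unfolding R_def powr_powr exp_d using assms by (simp add: powr_divide)
  also have "B powr 2 * B powr (- 2 * \<theta>) = B powr (2 * (1 - \<theta>))"
    unfolding powr_add[symmetric] by (simp add: algebra_simps)
  finally show "R powr (- 2 * d) * B\<^sup>2 = (A powr \<theta> * B powr (1 - \<theta>))\<^sup>2"
    unfolding target by (simp add: powr_minus field_simps)
qed

theorem proposition2:
  fixes n :: nat and b \<epsilon> \<delta> \<theta> :: real
  assumes "n = CARD('n::finite)" and "n \<ge> 4"
    and "b = (real n - 1) / 2"
    and "0 < \<epsilon>" and "\<epsilon> < real n * (real n - 3) / (2 * (real n - 1))"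
    and "0 < \<delta>" and "\<delta> < real n"
    and "\<delta> = (\<delta> + \<epsilon>) * \<theta>"
  shows "\<exists>C::ennreal. C < \<infinity> \<and>
    (\<forall>f :: 'n distr. f \<in> hom_sobolev (b - \<epsilon>) \<longrightarrow> hom_sobolev_norm (b + \<delta>) f < \<infinity> \<longrightarrow>
       mixed_norm 2 \<infinity> (\<lambda>t. half_wave t f)
         \<le> C * ennreal_powr (hom_sobolev_norm (b - \<epsilon>) f) \<theta>
             * ennreal_powr (hom_sobolev_norm (b + \<delta>) f) (1 - \<theta>))"
proof -
  have \<epsilon>_le: "\<epsilon> \<le> b"
  proof -
    have "real n * (real n - 3) \<le> (real n - 1) * (real n - 1)"
      using assms(2) by (simp add: algebra_simps)
    then have "real n * (real n - 3) / (2 * (real n - 1)) \<le> (real n - 1) * (real n - 1) / (2 * (real n - 1))"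
      using assms(2) by (intro divide_right_mono) auto
    also have "\<dots> = b"
    proof -
      have "x * x / (2 * x) = x / 2" if "x > 0" for x :: real
        using that by simp
      from this[of "real n - 1"] show ?thesis
        unfolding assms(3) using assms(2) by simp
    qed
    finally show ?thesis
      using assms(5) by simp
  qed
  have \<theta>: "\<theta> > 0" "1 - \<theta> > 0"
  proof -
    have \<theta>_eq: "\<theta> = \<delta> / (\<delta> + \<epsilon>)"
      using assms(4,6,8) by (simp add: field_simps)
    show "\<theta> > 0" "1 - \<theta> > 0"
      unfolding \<theta>_eq using assms(4,6) by simp_all
  qed
  define c where "c = 1 / (2 * pi) ^ n"
  have c: "c > 0"
    by (simp add: c_def)
  define K where "K = c\<^sup>2 * ((\<Sum>j. dyadic_weight \<epsilon> \<delta> j) * strichartz_const n)"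
  have K: "K \<ge> 0"
    unfolding K_def using strichartz_const_nonneg dyadic_weight_summable[OF assms(4,6)] less_imp_le[OF dyadic_weight_pos]
    by (intro mult_nonneg_nonneg suminf_nonneg) auto
  \<comment> \<open>The summand 1 makes \<open>C\<close> positive, so that the right-hand side is infinite when the lower norm is.\<close>
  define C where "C = sqrt (K * (2 / c)) + 1"
  have C: "C > 0"
    using K c by (simp add: C_def add_nonneg_pos)
  show ?thesis
  proof (intro exI[of _ "ennreal C"] conjI allI impI)
    fix f :: "'n distr"
    assume "f \<in> hom_sobolev (b - \<epsilon>)" and fin: "hom_sobolev_norm (b + \<delta>) f < \<infinity>"
    define N\<^sub>0 where "N\<^sub>0 = hom_sobolev_norm (b - \<epsilon>) f"
    define N\<^sub>1 where "N\<^sub>1 = hom_sobolev_norm (b + \<delta>) f"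
    define G where "G = fourier_fun f"
    have dom\<^sub>1: "multiplier_dom (Dpow (b + \<delta>)) f"
      using fin by (auto simp: hom_sobolev_norm_def split: if_splits)
    then have f: "tempered f" "\<exists>g. is_fun (fourier_distr f) g"
      by (auto simp: multiplier_dom_def)
    have "is_fun (fourier_distr f) G"
      unfolding G_def fourier_fun_def using f(2) by (rule someI_ex)
    then have G: "tempered_fun G"
      by (simp add: is_fun_def)
    then have G_meas: "G \<in> borel_measurable borel"
      by (simp add: tempered_fun_def)
    have zero_energy: "weighted_energy s G = 0" if "weighted_energy s' G = 0" for s s'
      using that unfolding weighted_energy_eq_0_iff[OF G_meas] .
    have energy\<^sub>1: "weighted_energy (b + \<delta>) G \<le> ennreal (1 / c) * N\<^sub>1\<^sup>2"
      using weighted_energy_le_hom_sobolev_norm[OF dom\<^sub>1] by (simp add: G_def N\<^sub>1_def c_def assms(1))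
    have "mixed_norm 2 \<infinity> (\<lambda>t. half_wave t f) \<le> ennreal C * ennreal_powr N\<^sub>0 \<theta> * ennreal_powr N\<^sub>1 (1 - \<theta>)"
    proof (cases "N\<^sub>0 = \<infinity>")
      case True
      \<comment> \<open>Otherwise the right-hand side would be \<open>\<infinity> * 0 = 0\<close>.\<close>
      have "N\<^sub>1 \<noteq> 0"
      proof
        assume "N\<^sub>1 = 0"
        then have "weighted_energy (b + \<delta>) G = 0"
          using energy\<^sub>1 by simp
        then have "AE \<xi> in lborel. fourier_fun f \<xi> = 0"
          unfolding weighted_energy_eq_0_iff[OF G_meas] by (simp add: G_def)
        then have "N\<^sub>0 = 0"
          unfolding N\<^sub>0_def using f G_meas by (intro hom_sobolev_norm_eq_0) (auto simp: G_def)
        with True show False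
          by simp
      qed
      then have "ennreal_powr N\<^sub>1 (1 - \<theta>) \<noteq> 0"
        by (cases N\<^sub>1) (auto simp: ennreal_powr_def)
      then have "ennreal C * ennreal_powr N\<^sub>0 \<theta> * ennreal_powr N\<^sub>1 (1 - \<theta>) = \<infinity>"
        using True C by (simp add: ennreal_powr_def ennreal_mult_top ennreal_top_mult)
      then show ?thesis
        by simp
    next
      case False
      then have dom\<^sub>0: "multiplier_dom (Dpow (b - \<epsilon>)) f"
        by (auto simp: N\<^sub>0_def hom_sobolev_norm_def split: if_splits)
      have energy\<^sub>0: "weighted_energy (b - \<epsilon>) G \<le> ennreal (1 / c) * N\<^sub>0\<^sup>2"
        using weighted_energy_le_hom_sobolev_norm[OF dom\<^sub>0] by (simp add: G_def N\<^sub>0_def c_def assms(1))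
      obtain A where A: "N\<^sub>0 = ennreal A" "A \<ge> 0"
        using False by (cases N\<^sub>0) auto
      obtain B where B: "N\<^sub>1 = ennreal B" "B \<ge> 0"
        using fin by (cases N\<^sub>1) (auto simp: N\<^sub>1_def)
      have fin\<^sub>0: "weighted_energy (b - \<epsilon>) G < \<infinity>"
        by (rule order.strict_trans1[OF energy\<^sub>0]) (simp add: A ennreal_power ennreal_mult_less_top)
      have mixed: "mixed_norm 2 \<infinity> (\<lambda>t. half_wave t f) \<le> ennreal_powr (ennreal K *
          (ennreal (R powr (2 * \<epsilon>)) * weighted_energy (b - \<epsilon>) G
            + ennreal (R powr (- 2 * \<delta>)) * weighted_energy (b + \<delta>) G)) (1 / 2)" if "R > 0" for R
        unfolding K_def c_def G_def assms(1)
        by (rule mixed_norm_le[OF _ that assms(4,6) _ \<epsilon>_le])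
          (use assms(2) assms(3)[unfolded assms(1)] G fin\<^sub>0 in \<open>simp_all only: assms(1) G_def\<close>)
      show ?thesis
      proof (cases "A = 0 \<or> B = 0")
        case True
        then have "weighted_energy (b - \<epsilon>) G = 0 \<or> weighted_energy (b + \<delta>) G = 0"
          using energy\<^sub>0 energy\<^sub>1 A B by auto
        then have "weighted_energy s G = 0" for s
          using zero_energy by blast
        \<comment> \<open>Both energies vanish, so any scale will do.\<close>
        then show ?thesis
          using mixed[of 1] by (simp add: ennreal_powr_def)
      next
        case False
        then have pos: "A > 0" "B > 0"
          using A B by auto
        obtain R where R: "R > 0" "R powr (2 * \<epsilon>) * A\<^sup>2 = (A powr \<theta> * B powr (1 - \<theta>))\<^sup>2"
          "R powr (- 2 * \<delta>) * B\<^sup>2 = (A powr \<theta> * B powr (1 - \<theta>))\<^sup>2"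
          using balanced_scale[OF pos assms(4,6,8)] by blast
        define Y where "Y = A powr \<theta> * B powr (1 - \<theta>)"
        have Y: "Y \<ge> 0"
          by (simp add: Y_def)
        have "ennreal K * (ennreal (R powr (2 * \<epsilon>)) * weighted_energy (b - \<epsilon>) G
            + ennreal (R powr (- 2 * \<delta>)) * weighted_energy (b + \<delta>) G)
          \<le> ennreal K * (ennreal (R powr (2 * \<epsilon>)) * (ennreal (1 / c) * N\<^sub>0\<^sup>2)
            + ennreal (R powr (- 2 * \<delta>)) * (ennreal (1 / c) * N\<^sub>1\<^sup>2))"
          by (intro mult_left_mono add_mono energy\<^sub>0 energy\<^sub>1) auto
        also have "\<dots> = ennreal (K * (R powr (2 * \<epsilon>) * (1 / c * A\<^sup>2) + R powr (- 2 * \<delta>) * (1 / c * B\<^sup>2)))"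
          unfolding A B using K c A(2) B(2)
          by (simp add: ennreal_power ennreal_mult[symmetric] ennreal_plus[symmetric] del: ennreal_plus)
        also have "R powr (2 * \<epsilon>) * (1 / c * A\<^sup>2) + R powr (- 2 * \<delta>) * (1 / c * B\<^sup>2)
            = (R powr (2 * \<epsilon>) * A\<^sup>2) / c + (R powr (- 2 * \<delta>) * B\<^sup>2) / c"
          by simp
        also have "K * \<dots> = K * (2 / c) * Y\<^sup>2"
          unfolding R(2,3) Y_def by simp
        finally have "mixed_norm 2 \<infinity> (\<lambda>t. half_wave t f) \<le> ennreal_powr (ennreal (K * (2 / c) * Y\<^sup>2)) (1 / 2)"
          using mixed[OF R(1)] ennreal_powr_mono[of _ _ "1 / 2"] by (meson half_gt_zero_iff order_trans zero_less_one)
        also have "\<dots> = ennreal (sqrt (K * (2 / c)) * Y)"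
        proof -
          have "sqrt (K * (2 / c) * Y\<^sup>2) = sqrt (K * (2 / c)) * Y"
            using Y by (simp only: real_sqrt_mult real_sqrt_abs abs_of_nonneg)
          moreover have "K * (2 / c) * Y\<^sup>2 \<ge> 0"
            using K c by (intro mult_nonneg_nonneg) auto
          ultimately show ?thesis
            by (simp add: ennreal_powr_def powr_half_sqrt del: times_divide_eq_right times_divide_eq_left)
        qed
        also have "\<dots> \<le> ennreal (C * Y)"
          using Y by (intro ennreal_leI mult_right_mono) (auto simp: C_def)
        also have "\<dots> = ennreal C * ennreal_powr N\<^sub>0 \<theta> * ennreal_powr N\<^sub>1 (1 - \<theta>)"
          using C A B by (simp add: Y_def ennreal_powr_def ennreal_mult mult.assoc)
        finally show ?thesis .
      qed
    qed
    then show "mixed_norm 2 \<infinity> (\<lambda>t. half_wave t f) \<le> ennreal C *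
        ennreal_powr (hom_sobolev_norm (b - \<epsilon>) f) \<theta> * ennreal_powr (hom_sobolev_norm (b + \<delta>) f) (1 - \<theta>)"
      by (simp add: N\<^sub>0_def N\<^sub>1_def)
  qed simp
qed

end
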